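(* Let $f\in L^2(\Omega)$ and for every $y=(y_1,y_2)$ with $y_1,y_2>0$ let $u(y)\in H^1_0(\Omega)$ satisfy $$y_1(\nabla u(y),\nabla v)_{\Omega_1}+y_2(\nabla u(y),\nabla v)_{\Omega_2}=(f,v)_\Omega\quad\text{for all } v\in H^1_0(\Omega).$$ Then $$u(y)=\frac1{y_1}w_{\Omega_1}+\frac1{y_2}w_{\Omega_2}+\frac{2}{y_1+y_2}w_\Gamma,$$ where $w_{\Omega_1}\in V_{\Omega_1}$, $w_{\Omega_2}\in V_{\Omega_2}$, $w_\Gamma\in V_\Gamma$ satisfy $$(\nabla w_{\Omega_1},\nabla v_{\Omega_1})_\Omega=(f,v_{\Omega_1})_\Omega,\qquad (\nabla w_{\Omega_2},\nabla v_{\Omega_2})_\Omega=(f,v_{\Omega_2})_\Omega,\qquad (\nabla w_\Gamma,\nabla v_\Gamma)_\Omega=(f,v_\Gamma)_\Omega$$ for all $v_{\Omega_1}\in V_{\Omega_1}$, $v_{\Omega_2}\in V_{\Omega_2}$, $v_\Gamma\in V_\Gamma$.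
   Context: Let $r_1,r_2:(0,1)\to\mathbb R$ be sufficiently regular functions with $r_1(t)<r_2(t)$ for all $t\in(0,1)$, and set $\Omega_1=\{(x_1,x_2): x_1\in(0,1),\ r_1(x_1)<x_2<r_2(x_1)\}$, $\Omega_2=\{(x_1,x_2): (2-x_1,x_2)\in\Omega_1\}$ (the mirror image of $\Omega_1$ across the line $x_1=1$), and $\Omega=\mathrm{int}(\overline{\Omega}_1\cup\overline{\Omega}_2)$. For $\omega\subseteq\Omega$, $(\cdot,\cdot)_\omega$ is the $L^2(\omega)$ inner product (of scalar or vector functions). $V_{\Omega_i}\subset H^1_0(\Omega)$ ($i=1,2$) is the space of functions of $H^1_0(\Omega)$ supported in $\Omega_i$, i.e. the extensions by zero to $\Omega$ of functions in $H^1_0(\Omega_i)$, and $V_\Gamma=\{u\in H^1_0(\Omega): (\nabla u,\nabla v)_\Omega=0\ \text{for all } v\in V_{\Omega_1}\cup V_{\Omega_2}\}$. *)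

theory Defs
  imports "HOL-Analysis.Analysis"
begin

(* Elements of L2 and of the Sobolev spaces below are representatives: total functions whose
   values outside the domain are irrelevant. Equality of such elements is equality almost
   everywhere with respect to lebesgue_on \<Omega>. *)

definition L2 :: "'a::euclidean_space set \<Rightarrow> ('a \<Rightarrow> 'b::euclidean_space) set" where
  "L2 \<Omega> = {f \<in> borel_measurable (lebesgue_on \<Omega>).
            integrable (lebesgue_on \<Omega>) (\<lambda>x. (norm (f x))\<^sup>2)}"

definition inner_L2 ::
  "'a::euclidean_space set \<Rightarrow> ('a \<Rightarrow> 'b::euclidean_space) \<Rightarrow> ('a \<Rightarrow> 'b) \<Rightarrow> real" where
  "inner_L2 \<omega> f g = integral\<^sup>L (lebesgue_on \<omega>) (\<lambda>x. f x \<bullet> g x)"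

(* Functions of class C^k on the whole space, by recursion on directional derivatives. *)
primrec Ck :: "nat \<Rightarrow> ('a::euclidean_space \<Rightarrow> real) \<Rightarrow> bool" where
  "Ck 0 f \<longleftrightarrow> continuous_on UNIV f"
| "Ck (Suc k) f \<longleftrightarrow>
     f differentiable_on UNIV \<and> (\<forall>h. Ck k (\<lambda>x. frechet_derivative f (at x) h))"

definition test_functions :: "'a::euclidean_space set \<Rightarrow> ('a \<Rightarrow> real) set" where
  "test_functions \<Omega> = {\<phi>. (\<forall>k. Ck k \<phi>) \<and>
     compact (closure {x. \<phi> x \<noteq> 0}) \<and> closure {x. \<phi> x \<noteq> 0} \<subseteq> \<Omega>}"

definition is_weak_gradient ::
  "'a::euclidean_space set \<Rightarrow> ('a \<Rightarrow> real) \<Rightarrow> ('a \<Rightarrow> 'a) \<Rightarrow> bool" where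
  "is_weak_gradient \<Omega> u g \<longleftrightarrow>
     (\<forall>\<phi>\<in>test_functions \<Omega>. \<forall>i\<in>Basis.
        inner_L2 \<Omega> u (\<lambda>x. frechet_derivative \<phi> (at x) i) = - inner_L2 \<Omega> (\<lambda>x. g x \<bullet> i) \<phi>)"

definition H1 :: "'a::euclidean_space set \<Rightarrow> ('a \<Rightarrow> real) set" where
  "H1 \<Omega> = {u \<in> L2 \<Omega>. \<exists>g\<in>L2 \<Omega>. is_weak_gradient \<Omega> u g}"

(* For open \<Omega> and u \<in> H1 \<Omega> this is unique up to null sets. *)
definition grad :: "'a::euclidean_space set \<Rightarrow> ('a \<Rightarrow> real) \<Rightarrow> 'a \<Rightarrow> 'a" where
  "grad \<Omega> u = (SOME g. g \<in> L2 \<Omega> \<and> is_weak_gradient \<Omega> u g)"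

definition norm_H1 :: "'a::euclidean_space set \<Rightarrow> ('a \<Rightarrow> real) \<Rightarrow> real" where
  "norm_H1 \<Omega> u = sqrt (inner_L2 \<Omega> u u + inner_L2 \<Omega> (grad \<Omega> u) (grad \<Omega> u))"

(* The closure of the test functions in H1. *)
definition H10 :: "'a::euclidean_space set \<Rightarrow> ('a \<Rightarrow> real) set" where
  "H10 \<Omega> = {u \<in> H1 \<Omega>. \<exists>\<phi>::nat \<Rightarrow> 'a \<Rightarrow> real.
     (\<forall>n. \<phi> n \<in> test_functions \<Omega>) \<and> (\<lambda>n. norm_H1 \<Omega> (\<lambda>x. \<phi> n x - u x)) \<longlonglongrightarrow> 0}"

definition Omega1 :: "(real \<Rightarrow> real) \<Rightarrow> (real \<Rightarrow> real) \<Rightarrow> (real \<times> real) set" where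
  "Omega1 r1 r2 = {(x1, x2). x1 \<in> {0<..<1} \<and> r1 x1 < x2 \<and> x2 < r2 x1}"

definition Omega2 :: "(real \<Rightarrow> real) \<Rightarrow> (real \<Rightarrow> real) \<Rightarrow> (real \<times> real) set" where
  "Omega2 r1 r2 = {(x1, x2). (2 - x1, x2) \<in> Omega1 r1 r2}"

definition Omega :: "(real \<Rightarrow> real) \<Rightarrow> (real \<Rightarrow> real) \<Rightarrow> (real \<times> real) set" where
  "Omega r1 r2 = interior (closure (Omega1 r1 r2) \<union> closure (Omega2 r1 r2))"

(* V_sub \<Omega> \<omega>: the functions of H10 \<Omega> that are extensions by zero of functions of H10 \<omega>. *)
definition V_sub :: "'a::euclidean_space set \<Rightarrow> 'a set \<Rightarrow> ('a \<Rightarrow> real) set" where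
  "V_sub \<Omega> \<omega> = {w \<in> H10 \<Omega>. \<exists>v\<in>H10 \<omega>.
     AE x in lebesgue_on \<Omega>. w x = (if x \<in> \<omega> then v x else 0)}"

definition V_Gamma :: "(real \<Rightarrow> real) \<Rightarrow> (real \<Rightarrow> real) \<Rightarrow> (real \<times> real \<Rightarrow> real) set" where
  "V_Gamma r1 r2 = {u \<in> H10 (Omega r1 r2).
     \<forall>v \<in> V_sub (Omega r1 r2) (Omega1 r1 r2) \<union> V_sub (Omega r1 r2) (Omega2 r1 r2).
       inner_L2 (Omega r1 r2) (grad (Omega r1 r2) u) (grad (Omega r1 r2) v) = 0}"

(* w is the solution in the subspace V of the variational Poisson problem with datum f. *)
definition solves_in ::
  "'a::euclidean_space set \<Rightarrow> ('a \<Rightarrow> real) \<Rightarrow> ('a \<Rightarrow> real) set \<Rightarrow> ('a \<Rightarrow> real) \<Rightarrow> bool" where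
  "solves_in \<Omega> f V w \<longleftrightarrow>
     w \<in> V \<and> (\<forall>v\<in>V. inner_L2 \<Omega> (grad \<Omega> w) (grad \<Omega> v) = inner_L2 \<Omega> f v)"

end

theory Submission
  imports Defs "HOL-Real_Asymp.Real_Asymp"
begin

text \<open>
  Write \<open>a\<^sub>i(u, v)\<close> for the integral of the product of the gradients over \<open>\<Omega>\<^sub>i\<close>, and \<open>R\<close> for the reflection
  of functions across the line \<open>x\<^sub>1 = 1\<close>. If \<open>u \<in> H10 \<Omega>\<close>, then \<open>u - R u\<close> is odd, so its halves on \<open>\<Omega>\<^sub>1\<close>
  and \<open>\<Omega>\<^sub>2\<close>, extended by zero, lie in \<open>V\<^sub>1\<close> and \<open>V\<^sub>2\<close>. Hence every \<open>e \<in> V\<^sub>\<Gamma>\<close> is balanced: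
  \<open>a\<^sub>1(e, v) = a\<^sub>2(e, v)\<close> for all \<open>v \<in> H10 \<Omega>\<close>. It follows that the difference \<open>e\<close> of \<open>u(y)\<close> and the claimed
  combination lies in \<open>V\<^sub>\<Gamma>\<close> and satisfies \<open>a\<^sub>1(e, e) = a\<^sub>2(e, e) = 0\<close>, so \<open>e = 0\<close> by Poincare's inequality
  in the strip \<open>0 \<le> x\<^sub>1 \<le> 2\<close>. No projection theorem is needed for the existence of the components, because they
  can be written in terms of \<open>u(1,1)\<close>, \<open>u(1,3)\<close> and \<open>u(3,1)\<close>: for instance
  \<open>w\<^sub>\<Gamma> = 4 u(1,1) - 3 (u(1,3) + u(3,1))\<close>.
\<close>

section \<open>Smooth functions\<close>

text \<open>Write \<open>F v\<close> for \<open>inner_L2 \<Omega> f v\<close>. The weighted equation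
  sees only \<open>y1\<close> when tested in \<open>V1\<close>, only \<open>y2\<close> in
  \<open>V2\<close>, and only \<open>y1 + y2\<close> against a balanced function, because both
  halves then contribute equally. Over \<Omega> the form of \<open>u (y1, y2)\<close> with such a
  \<open>v\<close> is therefore \<open>F v\<close> times \<open>1 / y1\<close>,
  \<open>1 / y2\<close> or \<open>2 / (y1 + y2)\<close>: these are the coefficients of the claim.
  Combinations of the solutions with weights 1 and 3 isolate a single component because the vectors
  of these three factors at (1,1), (1,3) and (3,1) are linearly independent. For \<open>V1\<close>
  and \<open>V2\<close>, membership must be forced as well, which is done by taking the odd half of
  such a combination. The obstacle is the boundary: \<open>r1\<close> and \<open>r2\<close> are
  merely continuous on the open interval, so \<Omega> may be unbounded in the second direction and
  there are no traces to work with. Boundary values are handled only through approximating test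
  functions, which are smooth on the whole plane. The single point where vanishing on the interface
  must become membership in \<open>H10\<close> of a half is settled by explicit cut-off
  functions.\<close>

lemma Ck_SucI:
  assumes "\<And>x. (f has_derivative f' x) (at x)" "\<And>h. Ck k (\<lambda>x. f' x h)"
  shows "Ck (Suc k) f"
proof -
  have "frechet_derivative f (at x) = f' x" for x
    using frechet_derivative_at[OF assms(1)] by simp
  moreover have "f differentiable_on UNIV"
    using assms(1) by (auto simp: differentiable_on_def differentiable_def)
  ultimately show ?thesis using assms(2) by simp
qed

lemma Ck_has_derivative:
  assumes "Ck (Suc k) f"
  shows "(f has_derivative frechet_derivative f (at x)) (at x)"
  using assms by (simp add: differentiable_on_def frechet_derivative_works)

lemma Ck_frechet: "Ck (Suc k) f \<Longrightarrow> Ck k (\<lambda>x. frechet_derivative f (at x) h)"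
  by simp

lemma Ck_SucD: "Ck (Suc k) f \<Longrightarrow> Ck k f"
proof (induction k arbitrary: f)
  case 0
  then show ?case by (simp add: differentiable_imp_continuous_on)
next
  case (Suc k)
  show ?case
    by (rule Ck_SucI[OF Ck_has_derivative[OF Suc.prems]])
       (rule Suc.IH[OF Ck_frechet[OF Suc.prems]])
qed

lemma Ck_imp_continuous: "Ck k f \<Longrightarrow> continuous_on UNIV f"
  by (induction k) (use Ck_SucD in auto)

lemma Ck_add: "Ck k f \<Longrightarrow> Ck k g \<Longrightarrow> Ck k (\<lambda>x. f x + g x)"
proof (induction k arbitrary: f g)
  case 0
  then show ?case by (auto intro: continuous_intros)
next
  case (Suc k)
  show ?case
    by (rule Ck_SucI[OF has_derivative_add[OF Ck_has_derivative[OF Suc.prems(1)] Ck_has_derivative[OF Suc.prems(2)]]])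
       (rule Suc.IH[OF Ck_frechet[OF Suc.prems(1)] Ck_frechet[OF Suc.prems(2)]])
qed

text \<open>The product rule pairs a differentiated factor with an undifferentiated one, so the
  latter must be lowered to level \<open>k\<close> by \<open>Ck_SucD\<close> before the induction
  hypothesis applies.\<close>

lemma Ck_mult: "Ck k f \<Longrightarrow> Ck k g \<Longrightarrow> Ck k (\<lambda>x. f x * g x)"
proof (induction k arbitrary: f g)
  case 0
  then show ?case by (auto intro: continuous_intros)
next
  case (Suc k)
  show ?case
    by (rule Ck_SucI[OF has_derivative_mult[OF Ck_has_derivative[OF Suc.prems(1)] Ck_has_derivative[OF Suc.prems(2)]]])
       (intro Ck_add Suc.IH Ck_SucD[OF Suc.prems(1)] Ck_SucD[OF Suc.prems(2)] Ck_frechet Suc.prems)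
qed

lemma Ck_const: "Ck k (\<lambda>x. c)"
proof (induction k arbitrary: c)
  case (Suc k)
  show ?case by (rule Ck_SucI[OF has_derivative_const]) (rule Suc)
qed simp

lemma Ck_cmult: "Ck k f \<Longrightarrow> Ck k (\<lambda>x. c * f x)"
  by (intro Ck_mult Ck_const)

lemma Ck_prod: "(\<And>i. i \<in> I \<Longrightarrow> Ck k (f i)) \<Longrightarrow> Ck k (\<lambda>x. \<Prod>i\<in>I. f i x)"
  by (induction I rule: infinite_finite_induct) (auto intro: Ck_mult Ck_const)

lemma Ck_affine:
  assumes L: "bounded_linear L"
  shows "Ck k f \<Longrightarrow> Ck k (\<lambda>x. f (L x + c))"
proof (induction k arbitrary: f)
  case 0
  have "continuous_on UNIV (\<lambda>x. L x + c)"
    by (intro continuous_intros bounded_linear.continuous_on[OF L])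
  with 0 show ?case by (auto intro: continuous_on_compose2)
next
  case (Suc k)
  have "((\<lambda>x. L x + c) has_derivative L) (at x)" for x
    using bounded_linear_imp_has_derivative[OF L] by (auto intro!: derivative_eq_intros)
  then have "((\<lambda>x. f (L x + c)) has_derivative (\<lambda>h. frechet_derivative f (at (L x + c)) (L h))) (at x)" for x
    by (rule has_derivative_compose[OF _ Ck_has_derivative[OF Suc.prems]])
  then show ?case
    by (rule Ck_SucI) (rule Suc.IH[OF Ck_frechet[OF Suc.prems]])
qed

text \<open>The derivatives of the smooth function \<open>exp (- 1 / t)\<close>, extended by zero, stay within this family.
Since \<open>psi 1 (n * t)\<close> is the \<open>n\<close>-th root of \<open>psi 1 t\<close>, it increases to the indicator of \<open>t > 0\<close>.\<close>

definition psi :: "real poly \<Rightarrow> real \<Rightarrow> real" where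
  "psi P t = (if t > 0 then poly P (1 / t) * exp (- (1 / t)) else 0)"

lemma poly_exp_minus_tendsto_0: "((\<lambda>s::real. poly P s * exp (- s)) \<longlongrightarrow> 0) at_top"
proof -
  have "((\<lambda>s. \<Sum>i\<le>degree P. coeff P i * (s ^ i / exp s)) \<longlongrightarrow> (\<Sum>i\<le>degree P. coeff P i * 0)) at_top"
    by (intro tendsto_intros tendsto_power_div_exp_0)
  then show ?thesis
    by (simp add: poly_altdef sum_distrib_right exp_minus divide_inverse mult.assoc)
qed

lemma psi_tendsto_0: "(psi P \<longlongrightarrow> 0) (at_right 0)"
proof -
  have "((\<lambda>t. poly P (inverse t) * exp (- inverse t)) \<longlongrightarrow> 0) (at_right 0)"
    by (rule filterlim_compose[OF poly_exp_minus_tendsto_0 filterlim_inverse_at_top_right])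
  moreover have "eventually (\<lambda>t. poly P (inverse t) * exp (- inverse t) = psi P t) (at_right 0)"
    by (auto simp: psi_def eventually_at_right_field divide_inverse intro: exI[of _ 1])
  ultimately show ?thesis
    by (rule Lim_transform_eventually)
qed

text \<open>With \<open>s = 1 / t\<close>, whose derivative is \<open>- s^2\<close>, the product
  rule turns \<open>P(s) * exp (- s)\<close> into \<open>s^2 * (P - P')(s) * exp (- s)\<close> for
  positive \<open>t\<close>. Only the point 0 needs the difference quotient itself.\<close>

lemma psi_has_field_derivative:
  "(psi P has_field_derivative psi ([:0, 0, 1:] * (P - pderiv P)) t) (at t)"
proof -
  let ?Q = "[:0, 0, 1:] * (P - pderiv P)"
  consider "t > 0" | "t < 0" | "t = 0" by linarith
  then show ?thesis
  proof cases
    case 1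
    have "((\<lambda>t. poly P (1 / t) * exp (- (1 / t))) has_field_derivative psi ?Q t) (at t)"
      using 1 by (auto intro!: derivative_eq_intros DERIV_chain'[OF _ poly_DERIV]
          simp: psi_def field_simps power2_eq_square)
    moreover have "open {0<..<(t+1)}" "t \<in> {0<..<t+1}" using 1 by auto
    ultimately show ?thesis
      by (rule has_field_derivative_transform_within_open) (auto simp: psi_def)
  next
    case 2
    have "((\<lambda>t. 0) has_field_derivative psi ?Q t) (at t)"
      using 2 by (auto simp: psi_def)
    moreover have "open {t-1<..<0}" "t \<in> {t-1<..<0}" using 2 by auto
    ultimately show ?thesis
      by (rule has_field_derivative_transform_within_open) (auto simp: psi_def)
  next
    case 3
    \<comment> \<open>Dividing by \<open>h > 0\<close> multiplies the polynomial in
      \<open>1 / h\<close> by its variable, so the quotient is again of the form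
      \<open>psi Q h\<close> and tends to 0.\<close>
    have "((\<lambda>h. (psi P h - psi P 0) / h) \<longlongrightarrow> 0) (at_right 0)"
    proof (rule Lim_transform_eventually[OF psi_tendsto_0[of "pCons 0 P"]])
      show "eventually (\<lambda>h. psi (pCons 0 P) h = (psi P h - psi P 0) / h) (at_right 0)"
        by (auto simp: psi_def eventually_at_right_field intro: exI[of _ 1])
    qed
    moreover have "((\<lambda>h. (psi P h - psi P 0) / h) \<longlongrightarrow> 0) (at_left 0)"
    proof (rule Lim_transform_eventually[OF tendsto_const])
      show "eventually (\<lambda>h. 0 = (psi P h - psi P 0) / h) (at_left 0)"
        by (auto simp: psi_def eventually_at_left_field intro: exI[of _ "-1"])
    qed
    ultimately have "((\<lambda>h. (psi P h - psi P 0) / h) \<longlongrightarrow> 0) (at 0)"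
      by (simp add: filterlim_split_at)
    then show ?thesis
      using 3 by (simp add: DERIV_def psi_def)
  qed
qed

lemma psi_has_derivative:
  "((\<lambda>x. psi P (a \<bullet> x + c)) has_derivative
    (\<lambda>h. psi ([:0, 0, 1:] * (P - pderiv P)) (a \<bullet> x + c) * (a \<bullet> h))) (at x)"
proof -
  have "((\<lambda>x. a \<bullet> x + c) has_derivative (\<lambda>h. a \<bullet> h)) (at x)"
    by (auto intro!: derivative_eq_intros)
  from has_derivative_compose[OF this psi_has_field_derivative[unfolded has_field_derivative_def]]
  show ?thesis by (simp add: mult.commute)
qed

lemma Ck_psi: "Ck k (\<lambda>x. psi P (a \<bullet> x + c))"
proof (induction k arbitrary: P)
  case 0
  show ?case unfolding Ck.simps
    using psi_has_derivative has_derivative_continuous by (fastforce simp: continuous_on_eq_continuous_at)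
next
  case (Suc k)
  show ?case
    by (rule Ck_SucI[OF psi_has_derivative]) (intro Ck_mult Ck_const Suc)
qed

lemma psi_one: "0 \<le> psi 1 t" "psi 1 t \<le> 1" "t \<le> 0 \<Longrightarrow> psi 1 t = 0"
  by (auto simp: psi_def)

text \<open>The offset \<open>c\<close> is 0 for the bumps on boxes and -1 for the cut-off at the
  interface.\<close>

lemma psi_one_tendsto:
  assumes "t > 0"
  shows "(\<lambda>n. psi 1 (real n * t + c)) \<longlonglongrightarrow> 1"
proof -
  have lim: "filterlim (\<lambda>n. real n * t + c) at_top sequentially"
    using assms by real_asymp
  have "((\<lambda>s::real. exp (- (1 / s))) \<longlongrightarrow> 1) at_top"
    by real_asymp
  from filterlim_compose[OF this lim] have "(\<lambda>n. exp (- (1 / (real n * t + c)))) \<longlonglongrightarrow> 1" .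
  moreover have "eventually (\<lambda>n. exp (- (1 / (real n * t + c))) = psi 1 (real n * t + c)) sequentially"
    using filterlim_at_top_dense[THEN iffD1, OF lim, rule_format, of 0]
    by eventually_elim (simp add: psi_def)
  ultimately show ?thesis by (rule Lim_transform_eventually)
qed

section \<open>Integration by parts\<close>

lemma integrable_compact_support:
  fixes f :: "'a::euclidean_space \<Rightarrow> 'b::euclidean_space"
  assumes "continuous_on UNIV f" "compact K" "\<And>x. x \<notin> K \<Longrightarrow> f x = 0"
  shows "integrable lborel f"
proof -
  have "integrable lborel (\<lambda>x. indicator K x *\<^sub>R f x)"
    by (rule borel_integrable_compact[OF assms(2) continuous_on_subset[OF assms(1)]]) auto
  moreover have "(\<lambda>x. indicator K x *\<^sub>R f x) = f"
    using assms(3) by (auto simp: fun_eq_iff indicator_def)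
  ultimately show ?thesis by simp
qed

lemma bounded_compact_support:
  fixes f :: "'a::euclidean_space \<Rightarrow> 'b::euclidean_space"
  assumes "continuous_on UNIV f" "compact K" "\<And>x. x \<notin> K \<Longrightarrow> f x = 0"
  obtains B where "B > 0" "\<And>x. norm (f x) \<le> B"
proof -
  have "bounded (f ` K)"
    using assms by (meson compact_continuous_image compact_imp_bounded continuous_on_subset subset_UNIV)
  then obtain B where "B > 0" "\<And>x. x \<in> K \<Longrightarrow> norm (f x) \<le> B"
    by (auto simp: bounded_pos)
  then show ?thesis using assms(3) that[of B] by (metis norm_zero less_imp_le)
qed

lemma integral_lborel_translation:
  fixes f :: "'a::euclidean_space \<Rightarrow> real"
  assumes "continuous_on UNIV f"
  shows "(\<integral>x. f (x + c) \<partial>lborel) = (\<integral>x. f x \<partial>lborel)"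
proof -
  have f: "f \<in> borel_measurable borel"
    using assms by (rule borel_measurable_continuous_onI)
  have "(\<integral>x. f x \<partial>lborel) = (\<integral>x. f x \<partial>distr lborel borel ((+) c))"
    by (simp add: lborel_distr_plus)
  also have "\<dots> = (\<integral>x. f (c + x) \<partial>lborel)"
    by (rule integral_distr) (use f in auto)
  finally show ?thesis by (simp add: add.commute)
qed

text \<open>The difference quotients of \<open>F\<close> have integral \<open>0\<close> by translation invariance and converge
  boundedly to the derivative, so no iterated integrals are needed.\<close>

lemma integral_directional_derivative_eq_0:
  fixes F :: "'a::euclidean_space \<Rightarrow> real"
  assumes F: "\<And>x. (F has_derivative F' x) (at x)"
    and cont: "continuous_on UNIV (\<lambda>x. F' x i)"
    and K: "compact K" "\<And>x. x \<notin> K \<Longrightarrow> F x = 0" "\<And>x. x \<notin> K \<Longrightarrow> F' x i = 0"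
  shows "(\<integral>x. F' x i \<partial>lborel) = 0"
proof -
  have contF: "continuous_on UNIV F"
    using F has_derivative_continuous by (fastforce simp: continuous_on_eq_continuous_at)
  have intF: "integrable lborel F"
    by (rule integrable_compact_support[OF contF K(1,2)])
  have intFt: "integrable lborel (\<lambda>x. F (x + c))" for c
  proof (rule integrable_compact_support)
    show "continuous_on UNIV (\<lambda>x. F (x + c))"
      by (intro continuous_on_compose2[OF contF] continuous_intros) auto
    show "compact ((\<lambda>x. x - c) ` K)"
      by (intro compact_continuous_image continuous_intros K)
    show "F (x + c) = 0" if "x \<notin> (\<lambda>x. x - c) ` K" for x
      using that K(2)[of "x + c"] by force
  qed
  obtain B where B: "B > 0" "\<And>x. norm (F' x i) \<le> B"
    using bounded_compact_support[OF cont K(1,3)] by blast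
  obtain r where r: "r > 0" "\<And>x. x \<in> K \<Longrightarrow> norm x \<le> r"
    using compact_imp_bounded[OF K(1)] by (auto simp: bounded_pos)
  define h where "h n = inverse (real (Suc n))" for n
  have h: "h n > 0" "h n \<le> 1" for n by (auto simp: h_def inverse_eq_divide)
  define q where "q n x = (F (x + h n *\<^sub>R i) - F x) / h n" for n x
  have line: "((\<lambda>t. F (x + t *\<^sub>R i)) has_derivative (\<lambda>s. F' (x + t *\<^sub>R i) (s *\<^sub>R i))) (at t)" for x t
    by (rule has_derivative_compose[OF _ F]) (auto intro!: derivative_eq_intros)
  have lineR: "((\<lambda>t. F (x + t *\<^sub>R i)) has_field_derivative F' (x + t *\<^sub>R i) i) (at t)" for x t
    using line[of x t] has_derivative_bounded_linear[OF F]
    by (simp add: has_field_derivative_def linear_simps(5) mult.commute[of _ "F' _ _"] mult_commute_abs)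
  \<comment> \<open>The majorant lives on one fixed ball: each step has length at most
    \<open>norm i\<close>, so a point farther out than \<open>r + norm i\<close> lies outside
    \<open>K\<close> together with its translate. Inside the ball the mean value theorem bounds the
    quotient by \<open>B\<close>.\<close>
  have bound: "norm (q n x) \<le> B * indicator (cball 0 (r + norm i)) x" for n x
  proof (cases "norm x \<le> r + norm i")
    case True
    obtain z where z: "0 < z" "z < h n"
      "F (x + h n *\<^sub>R i) - F (x + 0 *\<^sub>R i) = (h n - 0) * F' (x + z *\<^sub>R i) i"
      using MVT2[OF h(1)[of n], of "\<lambda>t. F (x + t *\<^sub>R i)" "\<lambda>t. F' (x + t *\<^sub>R i) i"] lineR by blast
    then have "q n x = F' (x + z *\<^sub>R i) i"
      using h(1)[of n] by (simp add: q_def)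
    with B(2) True show ?thesis by simp
  next
    case False
    have "norm (h n *\<^sub>R i) \<le> norm i" using h[of n] by (simp add: mult_left_le_one_le)
    then have "norm (x + h n *\<^sub>R i) > r"
      using False norm_triangle_ineq4[of "x + h n *\<^sub>R i" "h n *\<^sub>R i"] by auto
    then have "x + h n *\<^sub>R i \<notin> K" using r(2) by (meson not_le)
    moreover have "x \<notin> K" using r(2)[of x] False norm_ge_zero[of i] by linarith
    ultimately show ?thesis using K(2) False by (simp add: q_def)
  qed
  have "(\<lambda>n. \<integral>x. q n x \<partial>lborel) \<longlonglongrightarrow> (\<integral>x. F' x i \<partial>lborel)"
  proof (rule integral_dominated_convergence)
    show "(\<lambda>x. F' x i) \<in> borel_measurable lborel"
      using borel_measurable_continuous_onI[OF cont] by simp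
    show "q n \<in> borel_measurable lborel" for n
      unfolding q_def using borel_measurable_continuous_onI[OF contF] by simp
    show "integrable lborel (\<lambda>x. B * indicator (cball 0 (r + norm i)) x :: real)"
      by (auto intro!: integrable_real_indicator emeasure_bounded_finite)
    show "AE x in lborel. norm (q n x) \<le> B * indicator (cball 0 (r + norm i)) x" for n
      using bound by auto
    have "(\<lambda>n. q n x) \<longlonglongrightarrow> F' x i" for x
    proof -
      have "filterlim h (at 0) sequentially"
        unfolding h_def filterlim_at using LIMSEQ_inverse_real_of_nat by auto
      moreover have "((\<lambda>t. (F (x + t *\<^sub>R i) - F x) / t) \<longlongrightarrow> F' x i) (at 0)"
        using lineR[of x 0] by (simp add: DERIV_def)
      ultimately show ?thesis unfolding q_def by (rule filterlim_compose[rotated])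
    qed
    then show "AE x in lborel. (\<lambda>n. q n x) \<longlonglongrightarrow> F' x i" by simp
  qed
  moreover have "(\<integral>x. q n x \<partial>lborel) = 0" for n
    unfolding q_def using intF intFt integral_lborel_translation[OF contF] by simp
  ultimately show ?thesis by (simp add: LIMSEQ_const_iff)
qed

text \<open>Bridge between two settings: integration by parts is done in \<open>lborel\<close> on
  the whole space, whereas \<open>inner_L2\<close> integrates over the completed measure restricted
  to the domain.\<close>

lemma lebesgue_on_borel_support:
  fixes f :: "'a::euclidean_space \<Rightarrow> 'b::{banach, second_countable_topology}"
  assumes "S \<in> sets lebesgue" "f \<in> borel_measurable borel" "\<And>x. x \<notin> S \<Longrightarrow> f x = 0"
  shows "integral\<^sup>L (lebesgue_on S) f = integral\<^sup>L lborel f"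
    and "integrable (lebesgue_on S) f \<longleftrightarrow> integrable lborel f"
proof -
  have "(\<lambda>x. indicator S x *\<^sub>R f x) = f"
    using assms(3) by (auto simp: fun_eq_iff indicator_def)
  then show "integral\<^sup>L (lebesgue_on S) f = integral\<^sup>L lborel f"
    and "integrable (lebesgue_on S) f \<longleftrightarrow> integrable lborel f"
    using assms by (simp_all add: integral_restrict_space integrable_restrict_space
        integral_completion integrable_completion)
qed

section \<open>Classical gradients and test functions\<close>

definition cgrad :: "('a::euclidean_space \<Rightarrow> real) \<Rightarrow> 'a \<Rightarrow> 'a" where
  "cgrad \<phi> x = (\<Sum>i\<in>Basis. frechet_derivative \<phi> (at x) i *\<^sub>R i)"

lemma cgrad_inner: "i \<in> Basis \<Longrightarrow> cgrad \<phi> x \<bullet> i = frechet_derivative \<phi> (at x) i"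
  by (simp add: cgrad_def inner_sum_left inner_Basis if_distrib sum.delta cong: if_cong)

lemma cgrad_eqI:
  assumes "(\<phi> has_derivative (\<lambda>h. v \<bullet> h)) (at x)"
  shows "cgrad \<phi> x = v"
  by (rule euclidean_eqI) (simp add: cgrad_inner frechet_derivative_at[OF assms, symmetric])

lemma cgrad_has_derivative:
  assumes "\<phi> differentiable (at x)"
  shows "(\<phi> has_derivative (\<lambda>h. cgrad \<phi> x \<bullet> h)) (at x)"
proof -
  let ?D = "frechet_derivative \<phi> (at x)"
  have D: "(\<phi> has_derivative ?D) (at x)"
    using assms by (simp add: frechet_derivative_works)
  then have lin: "linear ?D" by (simp add: has_derivative_linear)
  have "?D h = cgrad \<phi> x \<bullet> h" for h
  proof -
    have "?D h = ?D (\<Sum>i\<in>Basis. (h \<bullet> i) *\<^sub>R i)" by (simp add: euclidean_representation)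
    also have "\<dots> = (\<Sum>i\<in>Basis. (h \<bullet> i) * ?D i)"
      by (simp add: linear_sum[OF lin] linear_scale[OF lin])
    also have "\<dots> = h \<bullet> cgrad \<phi> x"
      by (simp add: cgrad_def inner_sum_right mult.commute)
    also have "\<dots> = cgrad \<phi> x \<bullet> h" by (rule inner_commute)
    finally show ?thesis .
  qed
  then have "?D = (\<lambda>h. cgrad \<phi> x \<bullet> h)" ..
  with D show ?thesis by simp
qed

lemma test_functionsI:
  assumes "\<And>k. Ck k \<phi>" "compact K" "K \<subseteq> \<Omega>" "\<And>x. x \<notin> K \<Longrightarrow> \<phi> x = 0"
  shows "\<phi> \<in> test_functions \<Omega>"
proof -
  have "closure {x. \<phi> x \<noteq> 0} \<subseteq> K"
    using assms(2,4) by (intro closure_minimal) (auto intro: compact_imp_closed)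
  then have "compact (closure {x. \<phi> x \<noteq> 0})"
    using assms(2) by (metis closed_closure compact_Int_closed inf.absorb_iff2)
  then show ?thesis
    using assms \<open>closure _ \<subseteq> K\<close> by (auto simp: test_functions_def)
qed

lemma test_functionsE:
  assumes "\<phi> \<in> test_functions \<Omega>"
  obtains K where "\<And>k. Ck k \<phi>" "compact K" "K \<subseteq> \<Omega>" "\<And>x. x \<notin> K \<Longrightarrow> \<phi> x = 0"
    "\<And>x. x \<notin> K \<Longrightarrow> cgrad \<phi> x = 0"
proof
  let ?K = "closure {x. \<phi> x \<noteq> 0}"
  show "compact ?K" "?K \<subseteq> \<Omega>" "\<And>k. Ck k \<phi>"
    using assms by (auto simp: test_functions_def)
  show 0: "\<phi> x = 0" if "x \<notin> ?K" for x
    using that closure_subset[of "{x. \<phi> x \<noteq> 0}"] by auto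
  show "cgrad \<phi> x = 0" if "x \<notin> ?K" for x
  proof (rule cgrad_eqI, rule has_derivative_transform_within_open)
    show "((\<lambda>x. 0) has_derivative (\<lambda>h. 0 \<bullet> h)) (at x)" by simp
    show "open (- ?K)" by (rule open_Compl) simp
    show "x \<in> - ?K" using that by (metis ComplI)
    show "0 = \<phi> y" if "y \<in> - ?K" for y
      using 0[of y] that by (metis ComplD)
  qed
qed

lemma test_functions_mono: "\<Omega> \<subseteq> \<Omega>' \<Longrightarrow> test_functions \<Omega> \<subseteq> test_functions \<Omega>'"
  by (auto simp: test_functions_def)

lemma test_function_Ck: "\<phi> \<in> test_functions \<Omega> \<Longrightarrow> Ck k \<phi>"
  by (auto simp: test_functions_def)

lemma test_function_continuous: "\<phi> \<in> test_functions \<Omega> \<Longrightarrow> continuous_on UNIV \<phi>"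
  using Ck_imp_continuous test_function_Ck by blast

lemma test_function_has_derivative:
  "\<phi> \<in> test_functions \<Omega> \<Longrightarrow> (\<phi> has_derivative (\<lambda>h. cgrad \<phi> x \<bullet> h)) (at x)"
  using test_function_Ck[of \<phi> \<Omega> "Suc 0"]
  by (intro cgrad_has_derivative) (auto simp: differentiable_on_def)

lemma test_function_continuous_cgrad:
  assumes "\<phi> \<in> test_functions \<Omega>"
  shows "continuous_on UNIV (cgrad \<phi>)"
  unfolding cgrad_def[abs_def]
proof (intro continuous_intros)
  fix i :: 'a
  show "continuous_on UNIV (\<lambda>x. frechet_derivative \<phi> (at x) i)"
    using test_function_Ck[OF assms, of "Suc 0"] by simp
qed

text \<open>The directional derivative of the product of the two test functions has integral 0, and
  the product rule splits it into the two sides of the claim. Everything vanishes off the support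
  \<open>K\<close> of \<phi>, so the integrals over \<Omega> and over the whole space agree.\<close>

lemma test_functions_weak_gradient:
  assumes \<Omega>: "open \<Omega>" and \<phi>: "\<phi> \<in> test_functions \<Omega>"
  shows "is_weak_gradient \<Omega> \<phi> (cgrad \<phi>)"
  unfolding is_weak_gradient_def
proof (intro ballI)
  fix \<psi> :: "'a \<Rightarrow> real" and i :: 'a assume \<psi>: "\<psi> \<in> test_functions \<Omega>" and i: "i \<in> Basis"
  obtain K where K: "compact K" "K \<subseteq> \<Omega>" "\<And>x. x \<notin> K \<Longrightarrow> \<phi> x = 0" "\<And>x. x \<notin> K \<Longrightarrow> cgrad \<phi> x = 0"
    using test_functionsE[OF \<phi>] by metis
  note cont = test_function_continuous[OF \<phi>] test_function_continuous[OF \<psi>]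
     test_function_continuous_cgrad[OF \<phi>] test_function_continuous_cgrad[OF \<psi>]
  have c1: "continuous_on UNIV (\<lambda>x. \<phi> x * (cgrad \<psi> x \<bullet> i))"
    and c2: "continuous_on UNIV (\<lambda>x. (cgrad \<phi> x \<bullet> i) * \<psi> x)"
    by (intro continuous_intros cont)+
  have I1: "integrable lborel (\<lambda>x. \<phi> x * (cgrad \<psi> x \<bullet> i))"
    and I2: "integrable lborel (\<lambda>x. (cgrad \<phi> x \<bullet> i) * \<psi> x)"
    by (rule integrable_compact_support[OF _ K(1)], use c1 c2 K(3,4) in auto)+
  have "(\<integral>x. \<phi> x * (cgrad \<psi> x \<bullet> i) + (cgrad \<phi> x \<bullet> i) * \<psi> x \<partial>lborel) = 0"
    by (rule integral_directional_derivative_eq_0[where F = "\<lambda>x. \<phi> x * \<psi> x" and K = K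
          and F' = "\<lambda>x h. \<phi> x * (cgrad \<psi> x \<bullet> h) + (cgrad \<phi> x \<bullet> h) * \<psi> x"])
       (use K in \<open>auto intro: continuous_on_add c1 c2
          has_derivative_mult[OF test_function_has_derivative[OF \<phi>] test_function_has_derivative[OF \<psi>]]\<close>)
  then have *: "(\<integral>x. \<phi> x * (cgrad \<psi> x \<bullet> i) \<partial>lborel) = - (\<integral>x. (cgrad \<phi> x \<bullet> i) * \<psi> x \<partial>lborel)"
    using I1 I2 by simp
  have b: "(\<lambda>x. \<phi> x * (cgrad \<psi> x \<bullet> i)) \<in> borel_measurable borel"
    "(\<lambda>x. (cgrad \<phi> x \<bullet> i) * \<psi> x) \<in> borel_measurable borel"
    by (rule borel_measurable_continuous_onI[OF c1], rule borel_measurable_continuous_onI[OF c2])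
  have S: "\<Omega> \<in> sets lebesgue" using \<Omega> by simp
  have off: "\<phi> x = 0" "cgrad \<phi> x = 0" if "x \<notin> \<Omega>" for x
    using that K(2-4) by blast+
  have "inner_L2 \<Omega> \<phi> (\<lambda>x. frechet_derivative \<psi> (at x) i) = (\<integral>x. \<phi> x * (cgrad \<psi> x \<bullet> i) \<partial>lborel)"
    unfolding inner_L2_def cgrad_inner[OF i, symmetric] inner_real_def
    by (rule lebesgue_on_borel_support(1)[OF S b(1)]) (simp add: off)
  moreover have "inner_L2 \<Omega> (\<lambda>x. cgrad \<phi> x \<bullet> i) \<psi> = (\<integral>x. (cgrad \<phi> x \<bullet> i) * \<psi> x \<partial>lborel)"
    unfolding inner_L2_def inner_real_def
    by (rule lebesgue_on_borel_support(1)[OF S b(2)]) (simp add: off)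
  ultimately show "inner_L2 \<Omega> \<phi> (\<lambda>x. frechet_derivative \<psi> (at x) i) = - inner_L2 \<Omega> (\<lambda>x. cgrad \<phi> x \<bullet> i) \<psi>"
    using * by simp
qed

section \<open>The fundamental lemma of the calculus of variations\<close>

lemma test_function_box:
  fixes a :: "'a::euclidean_space"
  assumes "cbox a b \<subseteq> \<Omega>" and n: "n \<ge> 0"
  shows "(\<lambda>x. \<Prod>i\<in>Basis. psi 1 (n * (x \<bullet> i - a \<bullet> i)) * psi 1 (n * (b \<bullet> i - x \<bullet> i))) \<in> test_functions \<Omega>"
proof (rule test_functionsI[OF _ compact_cbox assms(1)])
  fix k
  have "Ck k (\<lambda>x. psi 1 ((n *\<^sub>R i) \<bullet> x + - n * (a \<bullet> i)) * psi 1 ((- n *\<^sub>R i) \<bullet> x + n * (b \<bullet> i)))" for i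
    by (intro Ck_mult Ck_psi)
  moreover have "(n *\<^sub>R i) \<bullet> x + - n * (a \<bullet> i) = n * (x \<bullet> i - a \<bullet> i)"
    "(- n *\<^sub>R i) \<bullet> x + n * (b \<bullet> i) = n * (b \<bullet> i - x \<bullet> i)" for i x :: 'a
    by (simp_all add: inner_commute[of i x] algebra_simps)
  ultimately have "Ck k (\<lambda>x. psi 1 (n * (x \<bullet> i - a \<bullet> i)) * psi 1 (n * (b \<bullet> i - x \<bullet> i)))" for i :: 'a
    by simp
  then show "Ck k (\<lambda>x. \<Prod>i\<in>Basis. psi 1 (n * (x \<bullet> i - a \<bullet> i)) * psi 1 (n * (b \<bullet> i - x \<bullet> i)))"
    by (intro Ck_prod)
next
  fix x assume "x \<notin> cbox a b"
  then obtain i where "i \<in> Basis" "x \<bullet> i < a \<bullet> i \<or> b \<bullet> i < x \<bullet> i"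
    by (auto simp: mem_box not_le)
  then have "psi 1 (n * (x \<bullet> i - a \<bullet> i)) * psi 1 (n * (b \<bullet> i - x \<bullet> i)) = 0"
    using n by (auto simp: psi_one(3) mult_nonneg_nonpos)
  with \<open>i \<in> Basis\<close> show "(\<Prod>i\<in>Basis. psi 1 (n * (x \<bullet> i - a \<bullet> i)) * psi 1 (n * (b \<bullet> i - x \<bullet> i))) = 0"
    by auto
qed

text \<open>The limit is the open box because \<open>psi 1\<close> vanishes at 0: on a face one
  factor is 0 for every \<open>n\<close>.\<close>

lemma box_bump_tendsto:
  fixes x :: "'a::euclidean_space"
  shows "(\<lambda>n. \<Prod>i\<in>Basis. psi 1 (real n * (x \<bullet> i - a \<bullet> i)) * psi 1 (real n * (b \<bullet> i - x \<bullet> i)))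
    \<longlonglongrightarrow> indicator (box a b) x"
proof (cases "x \<in> box a b")
  case True
  have "(\<lambda>n. \<Prod>i\<in>Basis. psi 1 (real n * (x \<bullet> i - a \<bullet> i)) * psi 1 (real n * (b \<bullet> i - x \<bullet> i)))
    \<longlonglongrightarrow> (\<Prod>i\<in>(Basis::'a set). 1 * 1)"
    using True psi_one_tendsto[where c = 0]
    by (intro tendsto_prod tendsto_mult) (auto simp: mem_box)
  then show ?thesis using True by simp
next
  case False
  then obtain i where i: "i \<in> Basis" "x \<bullet> i \<le> a \<bullet> i \<or> b \<bullet> i \<le> x \<bullet> i"
    by (auto simp: mem_box not_less)
  then have "psi 1 (real n * (x \<bullet> i - a \<bullet> i)) * psi 1 (real n * (b \<bullet> i - x \<bullet> i)) = 0" for n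
    by (auto simp: psi_one(3) mult_nonneg_nonpos)
  then have 0: "(\<Prod>i\<in>Basis. psi 1 (real n * (x \<bullet> i - a \<bullet> i)) * psi 1 (real n * (b \<bullet> i - x \<bullet> i))) = 0" for n
    using i(1) by auto
  show ?thesis unfolding 0 using False by simp
qed

text \<open>Square integrability gives integrability on sets of finite measure, through the majorant
  in \<open>\<bar>t\<bar> \<le> 1 + t\<^sup>2\<close>; \<Omega> itself may have infinite
  measure.\<close>

lemma L2_integrable_box:
  fixes g :: "'a::euclidean_space \<Rightarrow> real"
  assumes \<Omega>: "\<Omega> \<in> sets lebesgue" and g: "g \<in> L2 \<Omega>"
  shows "integrable lebesgue (\<lambda>x. indicator (cbox a b) x * (indicator \<Omega> x * g x))"
proof -
  have m: "(\<lambda>x. indicator \<Omega> x * g x) \<in> borel_measurable lebesgue"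
    using g \<Omega> by (simp add: L2_def borel_measurable_restrict_space_iff mult.commute)
  have "integrable lebesgue (\<lambda>x. indicator \<Omega> x * (g x)\<^sup>2)"
    using g \<Omega> by (simp add: L2_def integrable_restrict_space)
  moreover have "integrable lebesgue (indicator (cbox a b) :: 'a \<Rightarrow> real)"
    using emeasure_bounded_finite[OF bounded_cbox[of a b]] by (intro integrable_real_indicator) simp_all
  ultimately have w: "integrable lebesgue (\<lambda>x. indicator (cbox a b) x + indicator \<Omega> x * (g x)\<^sup>2)"
    by simp
  show ?thesis
  proof (rule Bochner_Integration.integrable_bound[OF w])
    show "(\<lambda>x. indicator (cbox a b) x * (indicator \<Omega> x * g x)) \<in> borel_measurable lebesgue"
      by (intro borel_measurable_times[OF _ m] borel_measurable_indicator) simp_all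
    have "\<bar>t\<bar> \<le> 1 + t\<^sup>2" for t :: real
      using sum_squares_bound[of "\<bar>t\<bar>" 1] by simp
    then show "AE x in lebesgue. norm (indicator (cbox a b) x * (indicator \<Omega> x * g x))
        \<le> norm (indicator (cbox a b) x + indicator \<Omega> x * (g x)\<^sup>2)"
      by (auto simp: indicator_def)
  qed
qed

text \<open>The box bumps are test functions bounded by the indicator of the closed box, so
  dominated convergence carries the orthogonality from the bumps to the indicator of the open
  box.\<close>

lemma L2_orthogonal_integral_box:
  fixes g :: "'a::euclidean_space \<Rightarrow> real"
  assumes \<Omega>: "\<Omega> \<in> sets lebesgue" and g: "g \<in> L2 \<Omega>"
    and orth: "\<And>\<phi>. \<phi> \<in> test_functions \<Omega> \<Longrightarrow> inner_L2 \<Omega> g \<phi> = 0"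
    and sub: "cbox a b \<subseteq> \<Omega>"
  shows "(\<integral>x. indicator (box a b) x * (indicator \<Omega> x * g x) \<partial>lebesgue) = 0"
proof -
  define \<phi> where "\<phi> n x = (\<Prod>i\<in>Basis. psi 1 (real n * (x \<bullet> i - a \<bullet> i)) * psi 1 (real n * (b \<bullet> i - x \<bullet> i)))"
    for n and x :: 'a
  have test: "\<phi> n \<in> test_functions \<Omega>" for n
    unfolding \<phi>_def[abs_def] by (rule test_function_box[OF sub]) simp
  have m: "(\<lambda>x. indicator \<Omega> x * g x) \<in> borel_measurable lebesgue"
    using g \<Omega> by (simp add: L2_def borel_measurable_restrict_space_iff mult.commute)
  have off: "\<phi> n x = 0" if x: "x \<notin> cbox a b" for n x
  proof -
    obtain i where i: "i \<in> Basis" "x \<bullet> i \<le> a \<bullet> i \<or> b \<bullet> i \<le> x \<bullet> i"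
      using x unfolding mem_box by (meson le_less_linear less_imp_le)
    then have "psi 1 (real n * (x \<bullet> i - a \<bullet> i)) * psi 1 (real n * (b \<bullet> i - x \<bullet> i)) = 0"
      by (auto simp: psi_one(3) mult_nonneg_nonpos)
    then show ?thesis unfolding \<phi>_def using i(1) by auto
  qed
  have "(\<lambda>n. \<integral>x. \<phi> n x * (indicator \<Omega> x * g x) \<partial>lebesgue) \<longlonglongrightarrow>
      (\<integral>x. indicator (box a b) x * (indicator \<Omega> x * g x) \<partial>lebesgue)"
  proof (rule integral_dominated_convergence)
    show "integrable lebesgue (\<lambda>x. \<bar>indicator (cbox a b) x * (indicator \<Omega> x * g x)\<bar>)"
      using L2_integrable_box[OF \<Omega> g] by (rule integrable_abs)
    show "(\<lambda>x. indicator (box a b) x * (indicator \<Omega> x * g x)) \<in> borel_measurable lebesgue"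
      by (intro borel_measurable_times[OF _ m] borel_measurable_indicator) simp_all
    have "\<phi> n \<in> borel_measurable lebesgue" for n
      using borel_measurable_continuous_onI[OF test_function_continuous[OF test]]
      by (intro measurable_completion) simp
    then show "(\<lambda>x. \<phi> n x * (indicator \<Omega> x * g x)) \<in> borel_measurable lebesgue" for n
      by (intro borel_measurable_times[OF _ m] borel_measurable_indicator) simp_all
    have "0 \<le> \<phi> n x" "\<phi> n x \<le> 1" for n x
      unfolding \<phi>_def by (auto intro!: prod_nonneg prod_le_1 mult_nonneg_nonneg mult_le_one psi_one)
    then have "\<bar>\<phi> n x\<bar> \<le> indicator (cbox a b) x" for n x
      using off[of x n] by (auto simp: indicator_def)
    then show "AE x in lebesgue. norm (\<phi> n x * (indicator \<Omega> x * g x))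
        \<le> \<bar>indicator (cbox a b) x * (indicator \<Omega> x * g x)\<bar>" for n
      by (auto simp: abs_mult intro!: mult_right_mono)
    show "AE x in lebesgue. (\<lambda>n. \<phi> n x * (indicator \<Omega> x * g x)) \<longlonglongrightarrow>
        indicator (box a b) x * (indicator \<Omega> x * g x)"
      unfolding \<phi>_def by (intro AE_I2 tendsto_mult_right box_bump_tendsto)
  qed
  moreover have "(\<integral>x. \<phi> n x * (indicator \<Omega> x * g x) \<partial>lebesgue) = 0" for n
    using orth[OF test, of n] \<Omega> by (simp add: inner_L2_def integral_restrict_space ac_simps)
  ultimately show ?thesis by (simp add: LIMSEQ_const_iff)
qed

text \<open>Lebesgue differentiation: almost every value of the localized function \<open>f\<close>
  is the limit of its averages over small cubes with lower corner \<open>x\<close>, and all these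
  averages are 0. The faces of the box are negligible.\<close>

lemma L2_orthogonal_AE_box:
  fixes g :: "'a::euclidean_space \<Rightarrow> real"
  assumes \<Omega>: "\<Omega> \<in> sets lebesgue" and g: "g \<in> L2 \<Omega>"
    and orth: "\<And>\<phi>. \<phi> \<in> test_functions \<Omega> \<Longrightarrow> inner_L2 \<Omega> g \<phi> = 0"
    and sub: "cbox a b \<subseteq> \<Omega>"
  shows "AE x in lebesgue. x \<in> cbox a b \<longrightarrow> g x = 0"
proof -
  define f where "f x = indicator (cbox a b) x * (indicator \<Omega> x * g x)" for x
  have int: "integrable lebesgue f"
    unfolding f_def by (rule L2_integrable_box[OF \<Omega> g])
  then have abs: "f absolutely_integrable_on S" if "S \<in> sets lebesgue" for S
    unfolding set_integrable_def using that by (intro integrable_mult_indicator int)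
  then have "f integrable_on cbox c d" for c d
    by (simp add: set_lebesgue_integral_eq_integral(1))
  then obtain N where N: "negligible N"
    "\<And>x e. \<lbrakk>x \<notin> N; 0 < e\<rbrakk> \<Longrightarrow> \<exists>d>0. \<forall>h. 0 < h \<and> h < d \<longrightarrow>
        norm (integral (cbox x (x + h *\<^sub>R One)) f /\<^sub>R h ^ DIM('a) - f x) < e"
    using integrable_ccontinuous_explicit by blast
  have zero: "integral (cbox c d) f = 0" if "cbox c d \<subseteq> cbox a b" for c d
  proof -
    have eq: "indicator (box c d) x *\<^sub>R f x = indicator (box c d) x * (indicator \<Omega> x * g x)" for x
      using that box_subset_cbox[of c d] by (auto simp: f_def indicator_def)
    have "integral (cbox c d) f = integral (box c d) f"
      by (simp add: integral_open_interval)
    also have "\<dots> = (\<integral>x. indicator (box c d) x * (indicator \<Omega> x * g x) \<partial>lebesgue)"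
      using set_lebesgue_integral_eq_integral(2)[OF abs[of "box c d"]]
      unfolding set_lebesgue_integral_def eq by simp
    also have "\<dots> = 0"
      by (rule L2_orthogonal_integral_box[OF \<Omega> g orth]) (use that sub in auto)
    finally show ?thesis .
  qed
  have "g x = 0" if x: "x \<in> box a b" "x \<notin> N" for x
  proof (rule ccontr)
    assume "g x \<noteq> 0"
    then have "norm (f x) > 0"
      using x box_subset_cbox[of a b] sub by (auto simp: f_def indicator_def)
    then obtain d where d: "d > 0" "\<And>h. 0 < h \<Longrightarrow> h < d \<Longrightarrow>
        norm (integral (cbox x (x + h *\<^sub>R One)) f /\<^sub>R h ^ DIM('a) - f x) < norm (f x)"
      using N(2)[OF x(2), of "norm (f x)"] by blast
    \<comment> \<open>The least distance from \<open>x\<close> to an upper face: a cube with lower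
      corner \<open>x\<close> and side at most \<open>m\<close> stays in the box.\<close>
    define m where "m = Min ((\<lambda>i. b \<bullet> i - x \<bullet> i) ` Basis)"
    have m: "m > 0" "\<And>i. i \<in> Basis \<Longrightarrow> m \<le> b \<bullet> i - x \<bullet> i"
      using x(1) by (auto simp: m_def mem_box)
    define h where "h = min m (d / 2)"
    have h: "0 < h" "h < d" "h \<le> m" using m d by (auto simp: h_def)
    have "cbox x (x + h *\<^sub>R One) \<subseteq> cbox a b"
      using x(1) m(2) h by (force simp: mem_box inner_add_left algebra_simps)
    then show False using d(2)[OF h(1,2)] zero by simp
  qed
  then have "{x. \<not> (x \<in> cbox a b \<longrightarrow> g x = 0)} \<subseteq> N \<union> (cbox a b - box a b)" by auto
  moreover have "negligible (N \<union> (cbox a b - box a b))"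
    by (rule negligible_Un[OF N(1) negligible_frontier_interval])
  ultimately have "negligible {x. \<not> (x \<in> cbox a b \<longrightarrow> g x = 0)}"
    by (rule negligible_subset[rotated])
  then show ?thesis
    by (simp add: eventually_ae_filter_negligible) blast
qed

text \<open>An open set is a countable union of closed boxes, so the exceptional null sets of the
  boxes add up to a null set. This is what makes weak gradients unique.\<close>

lemma L2_orthogonal_test_functions:
  fixes g :: "'a::euclidean_space \<Rightarrow> real"
  assumes \<Omega>: "open \<Omega>" and g: "g \<in> L2 \<Omega>"
    and orth: "\<And>\<phi>. \<phi> \<in> test_functions \<Omega> \<Longrightarrow> inner_L2 \<Omega> g \<phi> = 0"
  shows "AE x in lebesgue_on \<Omega>. g x = 0"
proof -
  have L: "\<Omega> \<in> sets lebesgue" using \<Omega> by simp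
  obtain \<D> where \<D>: "countable \<D>" "\<D> \<subseteq> Pow \<Omega>" "\<And>X. X \<in> \<D> \<Longrightarrow> \<exists>a b. X = cbox a b" "\<Union>\<D> = \<Omega>"
    using open_countable_Union_open_cbox[OF \<Omega>] by blast
  have "AE x in lebesgue. x \<in> X \<longrightarrow> g x = 0" if X: "X \<in> \<D>" for X
  proof -
    obtain a b where "X = cbox a b" using \<D>(3)[OF X] by blast
    moreover have "X \<subseteq> \<Omega>" using \<D>(2) X by auto
    ultimately have "X = cbox a b" "cbox a b \<subseteq> \<Omega>" by simp_all
    then show ?thesis using L2_orthogonal_AE_box[OF L g orth] by simp
  qed
  then have "\<forall>X\<in>\<D>. AE x in lebesgue. x \<in> X \<longrightarrow> g x = 0" ..
  then have "AE x in lebesgue. \<forall>X\<in>\<D>. x \<in> X \<longrightarrow> g x = 0"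
    unfolding AE_ball_countable[OF \<D>(1)] .
  then have "AE x in lebesgue. x \<in> \<Omega> \<longrightarrow> g x = 0"
    by eventually_elim (use \<D>(4) in blast)
  then show ?thesis using L by (simp add: AE_restrict_space_iff)
qed

section \<open>The inner product space \<open>L2\<close> and weak gradients\<close>

lemma L2_measurable: "f \<in> L2 S \<Longrightarrow> f \<in> borel_measurable (lebesgue_on S)"
  by (simp add: L2_def)

lemma L2_inner_integrable:
  assumes "f \<in> L2 S" "g \<in> L2 S"
  shows "integrable (lebesgue_on S) (\<lambda>x. f x \<bullet> g x)"
proof (rule Bochner_Integration.integrable_bound)
  show "integrable (lebesgue_on S) (\<lambda>x. (norm (f x))\<^sup>2 + (norm (g x))\<^sup>2)"
    using assms by (simp add: L2_def)
  show "(\<lambda>x. f x \<bullet> g x) \<in> borel_measurable (lebesgue_on S)"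
    using assms by (intro borel_measurable_inner L2_measurable)
  have "\<bar>f x \<bullet> g x\<bar> \<le> (norm (f x))\<^sup>2 + (norm (g x))\<^sup>2" for x
  proof -
    have "2 * (norm (f x) * norm (g x)) \<le> (norm (f x))\<^sup>2 + (norm (g x))\<^sup>2"
      using sum_squares_bound[of "norm (f x)" "norm (g x)"] by simp
    moreover have "0 \<le> norm (f x) * norm (g x)" by simp
    ultimately show ?thesis using Cauchy_Schwarz_ineq2[of "f x" "g x"] by linarith
  qed
  then show "AE x in lebesgue_on S. norm (f x \<bullet> g x) \<le> norm ((norm (f x))\<^sup>2 + (norm (g x))\<^sup>2)"
    by simp
qed

lemma L2_lincomb:
  assumes "f \<in> L2 S" "g \<in> L2 S"
  shows "(\<lambda>x. a *\<^sub>R f x + b *\<^sub>R g x) \<in> L2 S"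
proof -
  have "(norm (a *\<^sub>R f x + b *\<^sub>R g x))\<^sup>2
      = a\<^sup>2 * (norm (f x))\<^sup>2 + 2 * a * b * (f x \<bullet> g x) + b\<^sup>2 * (norm (g x))\<^sup>2" for x
    unfolding power2_norm_eq_inner
    by (simp add: inner_add_left inner_add_right inner_commute[of "g x" "f x"] power2_eq_square algebra_simps)
  moreover have "integrable (lebesgue_on S)
      (\<lambda>x. a\<^sup>2 * (norm (f x))\<^sup>2 + 2 * a * b * (f x \<bullet> g x) + b\<^sup>2 * (norm (g x))\<^sup>2)"
    using assms L2_inner_integrable[OF assms] by (simp add: L2_def)
  ultimately show ?thesis
    using L2_measurable[OF assms(1)] L2_measurable[OF assms(2)] by (simp add: L2_def)
qed

lemma L2_add: "f \<in> L2 S \<Longrightarrow> g \<in> L2 S \<Longrightarrow> (\<lambda>x. f x + g x) \<in> L2 S"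
  using L2_lincomb[of f S g 1 1] by simp

lemma L2_diff: "f \<in> L2 S \<Longrightarrow> g \<in> L2 S \<Longrightarrow> (\<lambda>x. f x - g x) \<in> L2 S"
  using L2_lincomb[of f S g 1 "-1"] by simp

lemma L2_bound:
  assumes "g \<in> L2 S" "f \<in> borel_measurable (lebesgue_on S)"
    and "\<And>x. x \<in> S \<Longrightarrow> norm (f x) \<le> norm (g x)"
  shows "f \<in> L2 S"
proof -
  have "integrable (lebesgue_on S) (\<lambda>x. (norm (f x))\<^sup>2)"
  proof (rule Bochner_Integration.integrable_bound)
    show "integrable (lebesgue_on S) (\<lambda>x. (norm (g x))\<^sup>2)" using assms(1) by (simp add: L2_def)
    show "(\<lambda>x. (norm (f x))\<^sup>2) \<in> borel_measurable (lebesgue_on S)" using assms(2) by measurable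
    show "AE x in lebesgue_on S. norm ((norm (f x))\<^sup>2) \<le> norm ((norm (g x))\<^sup>2)"
      using assms(3) by (intro AE_I2) (simp add: power_mono space_restrict_space)
  qed
  then show ?thesis using assms(2) by (simp add: L2_def)
qed

lemma L2_mono:
  assumes "f \<in> L2 S" "T \<subseteq> S" "S \<in> sets lebesgue" "T \<in> sets lebesgue"
  shows "f \<in> L2 T"
proof -
  have eq: "indicator T x *\<^sub>R f x = indicator T x *\<^sub>R (indicator S x *\<^sub>R f x)"
    "indicator T x *\<^sub>R (norm (f x))\<^sup>2 = indicator T x *\<^sub>R (indicator S x *\<^sub>R (norm (f x))\<^sup>2)" for x
    using assms(2) by (auto simp: indicator_def)
  have "(\<lambda>x. indicator S x *\<^sub>R f x) \<in> borel_measurable lebesgue"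
    using assms by (simp add: L2_def borel_measurable_restrict_space_iff)
  then have "(\<lambda>x. indicator T x *\<^sub>R f x) \<in> borel_measurable lebesgue"
    unfolding eq(1) by (rule borel_measurable_scaleR[OF borel_measurable_indicator[OF assms(4)]])
  moreover have "integrable lebesgue (\<lambda>x. indicator S x *\<^sub>R (norm (f x))\<^sup>2)"
    using assms by (simp add: L2_def integrable_restrict_space)
  then have "integrable lebesgue (\<lambda>x. indicator T x *\<^sub>R (norm (f x))\<^sup>2)"
    unfolding eq(2) by (rule integrable_mult_indicator[OF assms(4)])
  ultimately show ?thesis
    using assms(4) by (simp add: L2_def integrable_restrict_space borel_measurable_restrict_space_iff)
qed

lemma inner_L2_commute: "inner_L2 S f g = inner_L2 S g f"
  by (simp add: inner_L2_def inner_commute)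

lemma inner_L2_lincomb_left:
  assumes "f \<in> L2 S" "g \<in> L2 S" "h \<in> L2 S"
  shows "inner_L2 S (\<lambda>x. a *\<^sub>R f x + b *\<^sub>R g x) h = a * inner_L2 S f h + b * inner_L2 S g h"
  using L2_inner_integrable[OF assms(1,3)] L2_inner_integrable[OF assms(2,3)]
  by (simp add: inner_L2_def inner_add_left)

lemma inner_L2_lincomb_right:
  assumes "f \<in> L2 S" "g \<in> L2 S" "h \<in> L2 S"
  shows "inner_L2 S h (\<lambda>x. a *\<^sub>R f x + b *\<^sub>R g x) = a * inner_L2 S h f + b * inner_L2 S h g"
  using inner_L2_lincomb_left[OF assms] by (simp add: inner_L2_commute[of S h])

lemma inner_L2_cong_AE:
  assumes "AE x in lebesgue_on S. f x = f' x" "AE x in lebesgue_on S. g x = g' x"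
    and "f \<in> L2 S" "f' \<in> L2 S" "g \<in> L2 S" "g' \<in> L2 S"
  shows "inner_L2 S f g = inner_L2 S f' g'"
  unfolding inner_L2_def
  using assms(1,2) assms(3-)[THEN L2_measurable]
  by (intro integral_cong_AE borel_measurable_inner) auto

lemma inner_L2_self: "inner_L2 S f f = (\<integral>x. (norm (f x))\<^sup>2 \<partial>lebesgue_on S)"
  by (simp add: inner_L2_def power2_norm_eq_inner)

lemma inner_L2_self_nonneg: "0 \<le> inner_L2 S f f"
  by (simp add: inner_L2_def)

lemma inner_L2_self_eq_0:
  assumes "f \<in> L2 S"
  shows "inner_L2 S f f = 0 \<longleftrightarrow> (AE x in lebesgue_on S. f x = 0)"
  using integral_nonneg_eq_0_iff_AE[of "lebesgue_on S" "\<lambda>x. f x \<bullet> f x"] L2_inner_integrable[OF assms assms]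
  by (simp add: inner_L2_def)

text \<open>Half of the parallelogram law. It serves as the triangle inequality for squared norms,
  at the price of a factor 2 that is harmless in limits.\<close>

lemma inner_L2_self_add:
  assumes "f \<in> L2 S" "g \<in> L2 S"
  shows "inner_L2 S (\<lambda>x. f x + g x) (\<lambda>x. f x + g x) \<le> 2 * inner_L2 S f f + 2 * inner_L2 S g g"
proof -
  have "inner_L2 S (\<lambda>x. f x + g x) (\<lambda>x. f x + g x) + inner_L2 S (\<lambda>x. f x - g x) (\<lambda>x. f x - g x)
      = 2 * inner_L2 S f f + 2 * inner_L2 S g g"
    using inner_L2_lincomb_left[OF assms L2_add[OF assms], of 1 1]
      inner_L2_lincomb_left[OF assms L2_diff[OF assms], of 1 "-1"]
      inner_L2_lincomb_right[OF assms assms(1), of 1 1] inner_L2_lincomb_right[OF assms assms(2), of 1 1]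
      inner_L2_lincomb_right[OF assms assms(1), of 1 "-1"] inner_L2_lincomb_right[OF assms assms(2), of 1 "-1"]
    by simp
  with inner_L2_self_nonneg[of S "\<lambda>x. f x - g x"] show ?thesis by linarith
qed

lemma inner_L2_self_subset:
  assumes "f \<in> L2 S" "T \<subseteq> S" "S \<in> sets lebesgue" "T \<in> sets lebesgue"
  shows "inner_L2 T f f \<le> inner_L2 S f f"
proof -
  have "integrable lebesgue (\<lambda>x. indicator S x *\<^sub>R (f x \<bullet> f x))"
    using L2_inner_integrable[OF assms(1,1)] assms(3) by (simp add: integrable_restrict_space)
  moreover have "integrable lebesgue (\<lambda>x. indicator T x *\<^sub>R (f x \<bullet> f x))"
    using L2_inner_integrable[OF L2_mono[OF assms] L2_mono[OF assms]] assms(4)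
    by (simp add: integrable_restrict_space)
  ultimately show ?thesis
    unfolding inner_L2_def using assms(2-4)
    by (simp add: integral_restrict_space) (intro integral_mono, auto simp: indicator_def)
qed

text \<open>The quadratic form \<open>inner_L2 S (a f + b g) (a f + b g)\<close> is nonnegative for
  all \<open>a\<close> and \<open>b\<close>. A \<open>g\<close> of norm 0 need not be the zero
  function, hence the separate degenerate case.\<close>

lemma inner_L2_Cauchy_Schwarz:
  assumes "f \<in> L2 S" "g \<in> L2 S"
  shows "(inner_L2 S f g)\<^sup>2 \<le> inner_L2 S f f * inner_L2 S g g"
proof -
  let ?A = "inner_L2 S f f" and ?B = "inner_L2 S g g" and ?C = "inner_L2 S f g"
  have *: "0 \<le> a\<^sup>2 * ?A + 2 * a * b * ?C + b\<^sup>2 * ?B" for a b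
  proof -
    have "0 \<le> inner_L2 S (\<lambda>x. a *\<^sub>R f x + b *\<^sub>R g x) (\<lambda>x. a *\<^sub>R f x + b *\<^sub>R g x)"
      by (rule inner_L2_self_nonneg)
    also have "\<dots> = a\<^sup>2 * ?A + 2 * a * b * ?C + b\<^sup>2 * ?B"
      using assms by (simp add: inner_L2_lincomb_left inner_L2_lincomb_right L2_lincomb
          inner_L2_commute[of S g f] power2_eq_square algebra_simps)
    finally show ?thesis .
  qed
  show ?thesis
  proof (cases "?B = 0")
    case True
    have "?C = 0"
    proof (rule ccontr)
      assume C: "?C \<noteq> 0"
      \<comment> \<open>With \<open>?B = 0\<close> the form is linear in \<open>b\<close>; this
        \<open>b\<close> is chosen so that the right-hand side equals -1.\<close>
      have "0 \<le> ?A + 2 * (- (?A + 1) / (2 * ?C)) * ?C"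
        using *[of 1 "- (?A + 1) / (2 * ?C)"] True by simp
      with C show False by (simp add: field_simps)
    qed
    then show ?thesis using True by simp
  next
    case False
    then have B: "?B > 0" using inner_L2_self_nonneg[of S g] by simp
    \<comment> \<open>The choice \<open>a = ?B\<close>, \<open>b = - ?C\<close> minimizes the form
      up to scaling and avoids a division.\<close>
    have "0 \<le> ?B * (?A * ?B - ?C\<^sup>2)"
      using *[of ?B "- ?C"] by (simp add: power2_eq_square algebra_simps)
    with B show ?thesis by (simp add: zero_le_mult_iff)
  qed
qed

section \<open>Convergence in L2\<close>

lemma LIMSEQ_squeeze_zero:
  fixes a b :: "nat \<Rightarrow> real"
  assumes "b \<longlonglongrightarrow> 0" "\<And>n. 0 \<le> a n" "\<And>n. a n \<le> b n"
  shows "a \<longlonglongrightarrow> 0"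
  by (rule tendsto_sandwich[OF _ _ tendsto_const assms(1)]) (auto simp: assms)

text \<open>Squared distances are used, so that limits can be handled with
  \<open>inner_L2_self_add\<close> and without square roots.\<close>

definition L2_tendsto ::
  "'a::euclidean_space set \<Rightarrow> (nat \<Rightarrow> 'a \<Rightarrow> 'b::euclidean_space) \<Rightarrow> ('a \<Rightarrow> 'b) \<Rightarrow> bool" where
  "L2_tendsto S F f \<longleftrightarrow> (\<lambda>n. inner_L2 S (\<lambda>x. F n x - f x) (\<lambda>x. F n x - f x)) \<longlonglongrightarrow> 0"

lemma L2_tendsto_inner:
  assumes "L2_tendsto S F f" "\<And>n. F n \<in> L2 S" "f \<in> L2 S" "g \<in> L2 S"
  shows "(\<lambda>n. inner_L2 S (F n) g) \<longlonglongrightarrow> inner_L2 S f g"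
proof -
  let ?d = "\<lambda>n x. F n x - f x"
  have "(\<lambda>n. inner_L2 S (?d n) (?d n) * inner_L2 S g g) \<longlonglongrightarrow> 0 * inner_L2 S g g"
    using assms(1) unfolding L2_tendsto_def by (rule tendsto_mult_right)
  then have "(\<lambda>n. (inner_L2 S (?d n) g)\<^sup>2) \<longlonglongrightarrow> 0"
    by (intro LIMSEQ_squeeze_zero[where a = "\<lambda>n. (inner_L2 S (?d n) g)\<^sup>2"])
       (auto intro!: inner_L2_Cauchy_Schwarz L2_diff assms)
  then have "(\<lambda>n. inner_L2 S (?d n) g) \<longlonglongrightarrow> 0"
    using tendsto_real_sqrt[of _ 0] by (fastforce simp: tendsto_rabs_zero_iff)
  moreover have "inner_L2 S (?d n) g = inner_L2 S (F n) g - inner_L2 S f g" for n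
    using inner_L2_lincomb_left[OF assms(2)[of n] assms(3,4), of 1 "-1"] by simp
  ultimately show ?thesis by (simp add: LIM_zero_iff)
qed

lemma L2_tendsto_lincomb:
  assumes "L2_tendsto S F f" "\<And>n. F n \<in> L2 S" "f \<in> L2 S"
    and "L2_tendsto S G g" "\<And>n. G n \<in> L2 S" "g \<in> L2 S"
  shows "L2_tendsto S (\<lambda>n x. a *\<^sub>R F n x + b *\<^sub>R G n x) (\<lambda>x. a *\<^sub>R f x + b *\<^sub>R g x)"
proof -
  let ?F = "\<lambda>n x. F n x - f x" and ?G = "\<lambda>n x. G n x - g x"
  have FG: "?F n \<in> L2 S" "?G n \<in> L2 S" for n using assms by (auto intro: L2_diff)
  have "(\<lambda>n. 2 * (a\<^sup>2 * inner_L2 S (?F n) (?F n)) + 2 * (b\<^sup>2 * inner_L2 S (?G n) (?G n)))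
      \<longlonglongrightarrow> 2 * (a\<^sup>2 * 0) + 2 * (b\<^sup>2 * 0)"
    using assms(1,4) unfolding L2_tendsto_def by (intro tendsto_intros)
  moreover have "inner_L2 S (\<lambda>x. (a *\<^sub>R F n x + b *\<^sub>R G n x) - (a *\<^sub>R f x + b *\<^sub>R g x))
      (\<lambda>x. (a *\<^sub>R F n x + b *\<^sub>R G n x) - (a *\<^sub>R f x + b *\<^sub>R g x))
      \<le> 2 * (a\<^sup>2 * inner_L2 S (?F n) (?F n)) + 2 * (b\<^sup>2 * inner_L2 S (?G n) (?G n))" for n
  proof -
    have "inner_L2 S (\<lambda>x. c *\<^sub>R h x) (\<lambda>x. c *\<^sub>R h x) = c\<^sup>2 * inner_L2 S h h" for c and h :: "'a \<Rightarrow> 'b"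
      by (simp add: inner_L2_def power2_eq_square mult.assoc)
    moreover have "(\<lambda>x. (a *\<^sub>R F n x + b *\<^sub>R G n x) - (a *\<^sub>R f x + b *\<^sub>R g x))
        = (\<lambda>x. a *\<^sub>R ?F n x + b *\<^sub>R ?G n x)"
      by (simp add: algebra_simps)
    ultimately show ?thesis
      using inner_L2_self_add[of "\<lambda>x. a *\<^sub>R ?F n x" S "\<lambda>x. b *\<^sub>R ?G n x"]
        L2_lincomb[OF FG(1)[of n] FG(1)[of n], of a 0] L2_lincomb[OF FG(2)[of n] FG(2)[of n], of b 0]
      by simp
  qed
  ultimately show ?thesis unfolding L2_tendsto_def
    by (intro LIMSEQ_squeeze_zero[OF _ inner_L2_self_nonneg]) simp_all
qed

lemma L2_tendsto_subset:
  assumes "L2_tendsto S F f" "\<And>n. F n \<in> L2 S" "f \<in> L2 S"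
    and "T \<subseteq> S" "S \<in> sets lebesgue" "T \<in> sets lebesgue"
  shows "L2_tendsto T F f"
  using assms(1) unfolding L2_tendsto_def
  by (rule LIMSEQ_squeeze_zero) (intro inner_L2_self_nonneg inner_L2_self_subset L2_diff assms)+

section \<open>Calculus of weak gradients\<close>

lemma test_function_L2:
  assumes "\<phi> \<in> test_functions \<Omega>" and S: "S \<in> sets lebesgue"
  shows "\<phi> \<in> L2 S" "cgrad \<phi> \<in> L2 S"
proof -
  have *: "h \<in> L2 S" if c: "continuous_on UNIV h" and K: "compact K" "\<And>x. x \<notin> K \<Longrightarrow> h x = 0"
    for h :: "'a \<Rightarrow> 'b::euclidean_space" and K
  proof -
    have h: "h \<in> borel_measurable lborel"
      using borel_measurable_continuous_onI[OF c] by simp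
    have c2: "continuous_on UNIV (\<lambda>x. (norm (h x))\<^sup>2)"
      by (intro continuous_intros c)
    have "integrable lborel (\<lambda>x. (norm (h x))\<^sup>2)"
      by (rule integrable_compact_support[OF c2 K(1)]) (simp add: K)
    then have "integrable lebesgue (\<lambda>x. (norm (h x))\<^sup>2)"
      using borel_measurable_continuous_onI[OF c2] by (subst integrable_completion) auto
    then have "integrable lebesgue (\<lambda>x. indicator S x *\<^sub>R (norm (h x))\<^sup>2)"
      by (rule integrable_mult_indicator[OF S])
    moreover have "h \<in> borel_measurable (lebesgue_on S)"
      by (rule measurable_restrict_space1[OF measurable_completion[OF h]])
    ultimately show ?thesis
      using S by (simp add: L2_def integrable_restrict_space)
  qed
  obtain K where K: "compact K" "\<And>x. x \<notin> K \<Longrightarrow> \<phi> x = 0" "\<And>x. x \<notin> K \<Longrightarrow> cgrad \<phi> x = 0"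
    using test_functionsE[OF assms(1)] by metis
  show "\<phi> \<in> L2 S" by (rule *[OF test_function_continuous[OF assms(1)] K(1,2)])
  show "cgrad \<phi> \<in> L2 S" by (rule *[OF test_function_continuous_cgrad[OF assms(1)] K(1,3)])
qed

lemma L2_inner_const: "g \<in> L2 S \<Longrightarrow> i \<in> Basis \<Longrightarrow> (\<lambda>x. g x \<bullet> i) \<in> L2 S"
proof -
  assume g: "g \<in> L2 S" and i: "i \<in> Basis"
  show ?thesis
  proof (rule L2_bound[OF g])
    show "(\<lambda>x. g x \<bullet> i) \<in> borel_measurable (lebesgue_on S)"
      using L2_measurable[OF g] by measurable
    show "norm (g x \<bullet> i) \<le> norm (g x)" for x using Basis_le_norm[OF i] by simp
  qed
qed

lemma is_weak_gradient_cgrad: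
  "is_weak_gradient \<Omega> u g \<longleftrightarrow> (\<forall>\<phi>\<in>test_functions \<Omega>. \<forall>i\<in>Basis.
     inner_L2 \<Omega> u (\<lambda>x. cgrad \<phi> x \<bullet> i) = - inner_L2 \<Omega> (\<lambda>x. g x \<bullet> i) \<phi>)"
  by (simp add: is_weak_gradient_def cgrad_inner)

lemma weak_gradient_lincomb:
  assumes \<Omega>: "\<Omega> \<in> sets lebesgue"
    and "is_weak_gradient \<Omega> u g" "is_weak_gradient \<Omega> v k"
    and "u \<in> L2 \<Omega>" "v \<in> L2 \<Omega>" "g \<in> L2 \<Omega>" "k \<in> L2 \<Omega>"
  shows "is_weak_gradient \<Omega> (\<lambda>x. a *\<^sub>R u x + b *\<^sub>R v x) (\<lambda>x. a *\<^sub>R g x + b *\<^sub>R k x)"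
  unfolding is_weak_gradient_cgrad
proof (intro ballI)
  fix \<phi> i assume \<phi>: "\<phi> \<in> test_functions \<Omega>" and i: "i \<in> (Basis :: 'a set)"
  note T = test_function_L2[OF \<phi> \<Omega>]
  have "inner_L2 \<Omega> (\<lambda>x. a *\<^sub>R u x + b *\<^sub>R v x) (\<lambda>x. cgrad \<phi> x \<bullet> i)
      = a * inner_L2 \<Omega> u (\<lambda>x. cgrad \<phi> x \<bullet> i) + b * inner_L2 \<Omega> v (\<lambda>x. cgrad \<phi> x \<bullet> i)"
    by (intro inner_L2_lincomb_left assms L2_inner_const T i)
  moreover have "inner_L2 \<Omega> (\<lambda>x. a *\<^sub>R (g x \<bullet> i) + b *\<^sub>R (k x \<bullet> i)) \<phi>
      = a * inner_L2 \<Omega> (\<lambda>x. g x \<bullet> i) \<phi> + b * inner_L2 \<Omega> (\<lambda>x. k x \<bullet> i) \<phi>"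
    by (intro inner_L2_lincomb_left assms L2_inner_const T i)
  ultimately show "inner_L2 \<Omega> (\<lambda>x. a *\<^sub>R u x + b *\<^sub>R v x) (\<lambda>x. cgrad \<phi> x \<bullet> i)
      = - inner_L2 \<Omega> (\<lambda>x. (a *\<^sub>R g x + b *\<^sub>R k x) \<bullet> i) \<phi>"
    using assms(2,3) \<phi> i by (simp add: is_weak_gradient_cgrad inner_add_left algebra_simps)
qed

text \<open>For a fixed test function both sides of the defining identity are continuous in L2, so
  the identity survives the limit.\<close>

lemma weak_gradient_limit:
  assumes \<Omega>: "\<Omega> \<in> sets lebesgue"
    and wg: "\<And>n. is_weak_gradient \<Omega> (U n) (G n)"
    and U: "L2_tendsto \<Omega> U u" "\<And>n. U n \<in> L2 \<Omega>" "u \<in> L2 \<Omega>"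
    and G: "L2_tendsto \<Omega> G g" "\<And>n. G n \<in> L2 \<Omega>" "g \<in> L2 \<Omega>"
  shows "is_weak_gradient \<Omega> u g"
  unfolding is_weak_gradient_cgrad
proof (intro ballI)
  fix \<phi> i assume \<phi>: "\<phi> \<in> test_functions \<Omega>" and i: "i \<in> (Basis :: 'a set)"
  note T = test_function_L2[OF \<phi> \<Omega>]
  \<comment> \<open>Moving the basis vector onto the test function leaves the vector field itself as
    an argument, which is where L2 convergence is assumed.\<close>
  have eq: "inner_L2 \<Omega> (\<lambda>x. h x \<bullet> i) \<phi> = inner_L2 \<Omega> h (\<lambda>x. \<phi> x *\<^sub>R i)" for h
    by (simp add: inner_L2_def mult.commute)
  have Ti: "(\<lambda>x. \<phi> x *\<^sub>R i) \<in> L2 \<Omega>"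
    by (rule L2_bound[OF T(1)]) (use L2_measurable[OF T(1)] i in auto)
  have "(\<lambda>n. inner_L2 \<Omega> (U n) (\<lambda>x. cgrad \<phi> x \<bullet> i)) \<longlonglongrightarrow> inner_L2 \<Omega> u (\<lambda>x. cgrad \<phi> x \<bullet> i)"
    by (intro L2_tendsto_inner U L2_inner_const T i)
  moreover have "(\<lambda>n. - inner_L2 \<Omega> (\<lambda>x. G n x \<bullet> i) \<phi>) \<longlonglongrightarrow> - inner_L2 \<Omega> (\<lambda>x. g x \<bullet> i) \<phi>"
    unfolding eq by (intro tendsto_minus L2_tendsto_inner G Ti)
  moreover have "inner_L2 \<Omega> (U n) (\<lambda>x. cgrad \<phi> x \<bullet> i) = - inner_L2 \<Omega> (\<lambda>x. G n x \<bullet> i) \<phi>" for n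
    using wg[of n] \<phi> i by (simp add: is_weak_gradient_cgrad)
  ultimately show "inner_L2 \<Omega> u (\<lambda>x. cgrad \<phi> x \<bullet> i) = - inner_L2 \<Omega> (\<lambda>x. g x \<bullet> i) \<phi>"
    by (simp add: LIMSEQ_unique)
qed

text \<open>Each component of the difference is orthogonal to all test functions. Allowing
  \<open>u\<close> and \<open>v\<close> to differ on a null set is needed because functions in
  \<open>V_sub\<close> are given only almost everywhere.\<close>

lemma weak_gradient_unique:
  assumes \<Omega>: "open \<Omega>"
    and "is_weak_gradient \<Omega> u g" "is_weak_gradient \<Omega> v k"
    and "u \<in> L2 \<Omega>" "v \<in> L2 \<Omega>" "g \<in> L2 \<Omega>" "k \<in> L2 \<Omega>"
    and uv: "AE x in lebesgue_on \<Omega>. u x = v x"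
  shows "AE x in lebesgue_on \<Omega>. g x = k x"
proof -
  have L: "\<Omega> \<in> sets lebesgue" using \<Omega> by simp
  have "AE x in lebesgue_on \<Omega>. (g x - k x) \<bullet> i = 0" if i: "i \<in> Basis" for i
  proof (rule L2_orthogonal_test_functions[OF \<Omega>])
    show "(\<lambda>x. (g x - k x) \<bullet> i) \<in> L2 \<Omega>"
      by (intro L2_inner_const L2_diff assms i)
    fix \<phi> assume \<phi>: "\<phi> \<in> test_functions \<Omega>"
    note T = test_function_L2[OF \<phi> L]
    have "inner_L2 \<Omega> u (\<lambda>x. cgrad \<phi> x \<bullet> i) = inner_L2 \<Omega> v (\<lambda>x. cgrad \<phi> x \<bullet> i)"
      by (intro inner_L2_cong_AE uv assms L2_inner_const T i) simp
    moreover have "inner_L2 \<Omega> (\<lambda>x. 1 *\<^sub>R (g x \<bullet> i) + -1 *\<^sub>R (k x \<bullet> i)) \<phi>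
        = 1 * inner_L2 \<Omega> (\<lambda>x. g x \<bullet> i) \<phi> + -1 * inner_L2 \<Omega> (\<lambda>x. k x \<bullet> i) \<phi>"
      by (intro inner_L2_lincomb_left assms L2_inner_const T i)
    ultimately show "inner_L2 \<Omega> (\<lambda>x. (g x - k x) \<bullet> i) \<phi> = 0"
      using assms(2,3) \<phi> i by (simp add: is_weak_gradient_cgrad inner_diff_left)
  qed
  then have "AE x in lebesgue_on \<Omega>. \<forall>i\<in>Basis. (g x - k x) \<bullet> i = 0"
    by (simp add: AE_finite_all[OF finite_Basis])
  then show ?thesis
    by eventually_elim (simp add: euclidean_eq_iff[of "g _"] inner_diff_left)
qed

text \<open>The choice operator in \<open>grad\<close> returns some representative; uniqueness ties
  it almost everywhere to any gradient known explicitly.\<close>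

lemma grad_weak_gradient:
  assumes \<Omega>: "open \<Omega>" and "u \<in> L2 \<Omega>" "g \<in> L2 \<Omega>" "is_weak_gradient \<Omega> u g"
  shows "grad \<Omega> u \<in> L2 \<Omega>" "is_weak_gradient \<Omega> u (grad \<Omega> u)"
    "AE x in lebesgue_on \<Omega>. grad \<Omega> u x = g x"
proof -
  show *: "grad \<Omega> u \<in> L2 \<Omega>" "is_weak_gradient \<Omega> u (grad \<Omega> u)"
    using someI[of "\<lambda>g. g \<in> L2 \<Omega> \<and> is_weak_gradient \<Omega> u g" g] assms by (auto simp: grad_def)
  show "AE x in lebesgue_on \<Omega>. grad \<Omega> u x = g x"
    by (rule weak_gradient_unique[OF \<Omega> *(2) assms(4) assms(2,2) *(1) assms(3)]) simp
qed

section \<open>A pair characterization of \<open>H10\<close>\<close>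

text \<open>The closure of the graph of the classical gradient on test functions. Carrying the
  gradient as an explicit partner of \<open>u\<close> avoids \<open>grad\<close>, whose chosen
  representative obeys no equations pointwise.\<close>

definition H10_pair :: "'a::euclidean_space set \<Rightarrow> ('a \<Rightarrow> real) \<Rightarrow> ('a \<Rightarrow> 'a) \<Rightarrow> bool" where
  "H10_pair \<Omega> u g \<longleftrightarrow> u \<in> L2 \<Omega> \<and> g \<in> L2 \<Omega> \<and>
     (\<exists>\<phi>. (\<forall>n. \<phi> n \<in> test_functions \<Omega>) \<and> L2_tendsto \<Omega> \<phi> u \<and> L2_tendsto \<Omega> (\<lambda>n. cgrad (\<phi> n)) g)"

lemma H10_pairE:
  assumes "H10_pair \<Omega> u g"
  obtains \<phi> where "\<And>n. \<phi> n \<in> test_functions \<Omega>" "L2_tendsto \<Omega> \<phi> u" "L2_tendsto \<Omega> (\<lambda>n. cgrad (\<phi> n)) g"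
  using assms unfolding H10_pair_def by blast

lemma H10_pairD: "H10_pair \<Omega> u g \<Longrightarrow> u \<in> L2 \<Omega>" "H10_pair \<Omega> u g \<Longrightarrow> g \<in> L2 \<Omega>"
  by (auto simp: H10_pair_def)

lemma H10_pair_weak_gradient:
  assumes "open \<Omega>" "H10_pair \<Omega> u g"
  shows "is_weak_gradient \<Omega> u g"
proof -
  have L: "\<Omega> \<in> sets lebesgue" using assms(1) by simp
  obtain \<phi> where \<phi>: "\<And>n. \<phi> n \<in> test_functions \<Omega>" "L2_tendsto \<Omega> \<phi> u" "L2_tendsto \<Omega> (\<lambda>n. cgrad (\<phi> n)) g"
    using H10_pairE[OF assms(2)] by blast
  show ?thesis
    by (rule weak_gradient_limit[OF L test_functions_weak_gradient[OF assms(1) \<phi>(1)] \<phi>(2) _ _ \<phi>(3)])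
       (intro test_function_L2[OF \<phi>(1) L] H10_pairD[OF assms(2)])+
qed

lemma H10_pair_grad:
  assumes "open \<Omega>" "H10_pair \<Omega> u g"
  shows "AE x in lebesgue_on \<Omega>. grad \<Omega> u x = g x" "grad \<Omega> u \<in> L2 \<Omega>"
  using grad_weak_gradient[OF assms(1) H10_pairD(1,2)[OF assms(2)] H10_pair_weak_gradient[OF assms]] by auto

text \<open>The norm contains the chosen gradient of the difference; almost everywhere it is the
  difference of the known gradients.\<close>

lemma norm_H1_diff_test_function:
  assumes \<Omega>: "open \<Omega>" and \<phi>: "\<phi> \<in> test_functions \<Omega>"
    and u: "u \<in> L2 \<Omega>" "g \<in> L2 \<Omega>" "is_weak_gradient \<Omega> u g"
  shows "norm_H1 \<Omega> (\<lambda>x. \<phi> x - u x) = sqrt (inner_L2 \<Omega> (\<lambda>x. \<phi> x - u x) (\<lambda>x. \<phi> x - u x)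
    + inner_L2 \<Omega> (\<lambda>x. cgrad \<phi> x - g x) (\<lambda>x. cgrad \<phi> x - g x))"
proof -
  have L: "\<Omega> \<in> sets lebesgue" using \<Omega> by simp
  note T = test_function_L2[OF \<phi> L]
  have "is_weak_gradient \<Omega> (\<lambda>x. \<phi> x - u x) (\<lambda>x. cgrad \<phi> x - g x)"
    using weak_gradient_lincomb[OF L test_functions_weak_gradient[OF \<Omega> \<phi>] u(3) T(1) u(1) T(2) u(2), of 1 "-1"]
    by simp
  note G = grad_weak_gradient[OF \<Omega> L2_diff[OF T(1) u(1)] L2_diff[OF T(2) u(2)] this]
  have "inner_L2 \<Omega> (grad \<Omega> (\<lambda>x. \<phi> x - u x)) (grad \<Omega> (\<lambda>x. \<phi> x - u x))
      = inner_L2 \<Omega> (\<lambda>x. cgrad \<phi> x - g x) (\<lambda>x. cgrad \<phi> x - g x)"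
    by (intro inner_L2_cong_AE G L2_diff T u)
  then show ?thesis by (simp add: norm_H1_def)
qed

lemma H10_pair_imp_H10:
  assumes \<Omega>: "open \<Omega>" and ug: "H10_pair \<Omega> u g"
  shows "u \<in> H10 \<Omega>"
proof -
  note w = H10_pair_weak_gradient[OF assms]
  obtain \<phi> where \<phi>: "\<And>n. \<phi> n \<in> test_functions \<Omega>" "L2_tendsto \<Omega> \<phi> u" "L2_tendsto \<Omega> (\<lambda>n. cgrad (\<phi> n)) g"
    using H10_pairE[OF ug] by blast
  have "(\<lambda>n. norm_H1 \<Omega> (\<lambda>x. \<phi> n x - u x)) \<longlonglongrightarrow> sqrt (0 + 0)"
    unfolding norm_H1_diff_test_function[OF \<Omega> \<phi>(1) H10_pairD[OF ug] w]
    using \<phi>(2,3) unfolding L2_tendsto_def by (intro tendsto_intros)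
  then show ?thesis
    using w H10_pairD[OF ug] \<phi>(1) by (auto simp: H10_def H1_def)
qed

lemma H10_imp_H10_pair:
  assumes \<Omega>: "open \<Omega>" and u: "u \<in> H10 \<Omega>"
  shows "H10_pair \<Omega> u (grad \<Omega> u)"
proof -
  obtain g where g: "u \<in> L2 \<Omega>" "g \<in> L2 \<Omega>" "is_weak_gradient \<Omega> u g"
    using u by (auto simp: H10_def H1_def)
  note G = grad_weak_gradient[OF \<Omega> g]
  obtain \<phi> where \<phi>: "\<And>n. \<phi> n \<in> test_functions \<Omega>" "(\<lambda>n. norm_H1 \<Omega> (\<lambda>x. \<phi> n x - u x)) \<longlonglongrightarrow> 0"
    using u by (auto simp: H10_def)
  let ?a = "\<lambda>n. inner_L2 \<Omega> (\<lambda>x. \<phi> n x - u x) (\<lambda>x. \<phi> n x - u x)"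
  let ?b = "\<lambda>n. inner_L2 \<Omega> (\<lambda>x. cgrad (\<phi> n) x - grad \<Omega> u x) (\<lambda>x. cgrad (\<phi> n) x - grad \<Omega> u x)"
  have "(\<lambda>n. (norm_H1 \<Omega> (\<lambda>x. \<phi> n x - u x))\<^sup>2) \<longlonglongrightarrow> 0\<^sup>2"
    by (intro tendsto_intros \<phi>)
  then have ab: "(\<lambda>n. ?a n + ?b n) \<longlonglongrightarrow> 0"
    by (simp add: norm_H1_diff_test_function[OF \<Omega> \<phi>(1) g(1) G(1,2)] inner_L2_self_nonneg)
  have "?a \<longlonglongrightarrow> 0" "?b \<longlonglongrightarrow> 0"
    by (rule LIMSEQ_squeeze_zero[OF ab]; simp add: inner_L2_self_nonneg)+
  then show ?thesis using g(1) G(1) \<phi>(1) unfolding H10_pair_def L2_tendsto_def by blast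
qed

lemma H10_L2:
  assumes "open \<Omega>" "u \<in> H10 \<Omega>"
  shows "u \<in> L2 \<Omega>" "grad \<Omega> u \<in> L2 \<Omega>"
  using H10_pairD[OF H10_imp_H10_pair[OF assms]] by auto

lemma test_function_lincomb:
  assumes "\<phi> \<in> test_functions \<Omega>" "\<psi> \<in> test_functions \<Omega>"
  shows "(\<lambda>x. a *\<^sub>R \<phi> x + b *\<^sub>R \<psi> x) \<in> test_functions \<Omega>"
    and "cgrad (\<lambda>x. a *\<^sub>R \<phi> x + b *\<^sub>R \<psi> x) = (\<lambda>x. a *\<^sub>R cgrad \<phi> x + b *\<^sub>R cgrad \<psi> x)"
proof -
  obtain K L where K: "compact K" "K \<subseteq> \<Omega>" "\<And>x. x \<notin> K \<Longrightarrow> \<phi> x = 0"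
    and L: "compact L" "L \<subseteq> \<Omega>" "\<And>x. x \<notin> L \<Longrightarrow> \<psi> x = 0"
    using test_functionsE[OF assms(1)] test_functionsE[OF assms(2)] by metis
  show "(\<lambda>x. a *\<^sub>R \<phi> x + b *\<^sub>R \<psi> x) \<in> test_functions \<Omega>"
    unfolding real_scaleR_def
    by (rule test_functionsI[of _ "K \<union> L"])
       (use K L in \<open>auto intro!: Ck_add Ck_cmult test_function_Ck[OF assms(1)] test_function_Ck[OF assms(2)]\<close>)
  show "cgrad (\<lambda>x. a *\<^sub>R \<phi> x + b *\<^sub>R \<psi> x) = (\<lambda>x. a *\<^sub>R cgrad \<phi> x + b *\<^sub>R cgrad \<psi> x)"
  proof
    fix x
    have "((\<lambda>x. a *\<^sub>R \<phi> x + b *\<^sub>R \<psi> x) has_derivative (\<lambda>h. a *\<^sub>R (cgrad \<phi> x \<bullet> h) + b *\<^sub>R (cgrad \<psi> x \<bullet> h))) (at x)"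
      by (intro has_derivative_add has_derivative_scaleR_right test_function_has_derivative[OF assms(1)]
          test_function_has_derivative[OF assms(2)])
    then show "cgrad (\<lambda>x. a *\<^sub>R \<phi> x + b *\<^sub>R \<psi> x) x = a *\<^sub>R cgrad \<phi> x + b *\<^sub>R cgrad \<psi> x"
      by (intro cgrad_eqI) (simp add: inner_add_left)
  qed
qed

lemma H10_pair_lincomb:
  assumes \<Omega>: "\<Omega> \<in> sets lebesgue" and u: "H10_pair \<Omega> u g" and v: "H10_pair \<Omega> v k"
  shows "H10_pair \<Omega> (\<lambda>x. a *\<^sub>R u x + b *\<^sub>R v x) (\<lambda>x. a *\<^sub>R g x + b *\<^sub>R k x)"
proof -
  obtain \<phi> where \<phi>: "\<And>n. \<phi> n \<in> test_functions \<Omega>" "L2_tendsto \<Omega> \<phi> u" "L2_tendsto \<Omega> (\<lambda>n. cgrad (\<phi> n)) g"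
    using H10_pairE[OF u] by blast
  obtain \<psi> where \<psi>: "\<And>n. \<psi> n \<in> test_functions \<Omega>" "L2_tendsto \<Omega> \<psi> v" "L2_tendsto \<Omega> (\<lambda>n. cgrad (\<psi> n)) k"
    using H10_pairE[OF v] by blast
  note T = test_function_L2[OF \<phi>(1) \<Omega>] test_function_L2[OF \<psi>(1) \<Omega>] H10_pairD[OF u] H10_pairD[OF v]
  show ?thesis unfolding H10_pair_def
  proof (intro conjI exI allI)
    show "(\<lambda>x. a *\<^sub>R \<phi> n x + b *\<^sub>R \<psi> n x) \<in> test_functions \<Omega>" for n
      by (rule test_function_lincomb(1)[OF \<phi>(1) \<psi>(1)])
    show "L2_tendsto \<Omega> (\<lambda>n x. a *\<^sub>R \<phi> n x + b *\<^sub>R \<psi> n x) (\<lambda>x. a *\<^sub>R u x + b *\<^sub>R v x)"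
      by (intro L2_tendsto_lincomb \<phi> \<psi> T)
    show "L2_tendsto \<Omega> (\<lambda>n. cgrad (\<lambda>x. a *\<^sub>R \<phi> n x + b *\<^sub>R \<psi> n x)) (\<lambda>x. a *\<^sub>R g x + b *\<^sub>R k x)"
      unfolding test_function_lincomb(2)[OF \<phi>(1) \<psi>(1)] by (intro L2_tendsto_lincomb \<phi> \<psi> T)
  qed (intro L2_lincomb T)+
qed

lemma L2_tendsto_approx:
  assumes "\<And>n. inner_L2 S (\<lambda>x. F n x - H n x) (\<lambda>x. F n x - H n x) \<le> inverse (real (Suc n))"
    and "L2_tendsto S H f" "\<And>n. F n \<in> L2 S" "\<And>n. H n \<in> L2 S" "f \<in> L2 S"
  shows "L2_tendsto S F f"
  unfolding L2_tendsto_def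
proof (rule LIMSEQ_squeeze_zero[OF _ inner_L2_self_nonneg])
  have "(\<lambda>n. 2 * inverse (real (Suc n)) + 2 * inner_L2 S (\<lambda>x. H n x - f x) (\<lambda>x. H n x - f x)) \<longlonglongrightarrow> 2 * 0 + 2 * 0"
    using assms(2) unfolding L2_tendsto_def by (intro tendsto_intros LIMSEQ_inverse_real_of_nat)
  then show "(\<lambda>n. 2 * inverse (real (Suc n)) + 2 * inner_L2 S (\<lambda>x. H n x - f x) (\<lambda>x. H n x - f x)) \<longlonglongrightarrow> 0"
    by simp
  show "inner_L2 S (\<lambda>x. F n x - f x) (\<lambda>x. F n x - f x)
      \<le> 2 * inverse (real (Suc n)) + 2 * inner_L2 S (\<lambda>x. H n x - f x) (\<lambda>x. H n x - f x)" for n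
    using inner_L2_self_add[OF L2_diff[OF assms(3,4)] L2_diff[OF assms(4,5)], of n n n] assms(1)[of n] by simp
qed

text \<open>Diagonal argument: for each \<open>n\<close> one test function is taken that is close to
  \<open>U n\<close> and whose gradient is close to \<open>G n\<close>, both with squared error
  below \<open>1 / (n + 1)\<close>.\<close>

lemma H10_pair_limit:
  assumes \<Omega>: "\<Omega> \<in> sets lebesgue" and UG: "\<And>n. H10_pair \<Omega> (U n) (G n)"
    and U: "L2_tendsto \<Omega> U u" "u \<in> L2 \<Omega>" and G: "L2_tendsto \<Omega> G g" "g \<in> L2 \<Omega>"
  shows "H10_pair \<Omega> u g"
proof -
  have "\<exists>\<phi>. \<phi> \<in> test_functions \<Omega> \<and>
      inner_L2 \<Omega> (\<lambda>x. \<phi> x - U n x) (\<lambda>x. \<phi> x - U n x) < inverse (real (Suc n)) \<and>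
      inner_L2 \<Omega> (\<lambda>x. cgrad \<phi> x - G n x) (\<lambda>x. cgrad \<phi> x - G n x) < inverse (real (Suc n))" for n
  proof -
    obtain \<phi> where \<phi>: "\<And>n. \<phi> n \<in> test_functions \<Omega>" "L2_tendsto \<Omega> \<phi> (U n)" "L2_tendsto \<Omega> (\<lambda>n. cgrad (\<phi> n)) (G n)"
      using H10_pairE[OF UG[of n]] by blast
    have pos: "inverse (real (Suc n)) > 0" by simp
    have "eventually (\<lambda>m. inner_L2 \<Omega> (\<lambda>x. \<phi> m x - U n x) (\<lambda>x. \<phi> m x - U n x) < inverse (real (Suc n)) \<and>
      inner_L2 \<Omega> (\<lambda>x. cgrad (\<phi> m) x - G n x) (\<lambda>x. cgrad (\<phi> m) x - G n x) < inverse (real (Suc n))) sequentially"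
      using \<phi>(2,3) pos unfolding L2_tendsto_def by (intro eventually_conj order_tendstoD(2))
    then show ?thesis using \<phi>(1) by (auto simp: eventually_sequentially)
  qed
  then have "\<exists>\<phi>. \<forall>n. \<phi> n \<in> test_functions \<Omega> \<and>
      inner_L2 \<Omega> (\<lambda>x. \<phi> n x - U n x) (\<lambda>x. \<phi> n x - U n x) < inverse (real (Suc n)) \<and>
      inner_L2 \<Omega> (\<lambda>x. cgrad (\<phi> n) x - G n x) (\<lambda>x. cgrad (\<phi> n) x - G n x) < inverse (real (Suc n))"
    by (intro choice allI)
  then obtain \<phi> where \<phi>: "\<And>n. \<phi> n \<in> test_functions \<Omega>"
    "\<And>n. inner_L2 \<Omega> (\<lambda>x. \<phi> n x - U n x) (\<lambda>x. \<phi> n x - U n x) \<le> inverse (real (Suc n))"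
    "\<And>n. inner_L2 \<Omega> (\<lambda>x. cgrad (\<phi> n) x - G n x) (\<lambda>x. cgrad (\<phi> n) x - G n x) \<le> inverse (real (Suc n))"
    by (auto intro: less_imp_le)
  note T = test_function_L2[OF \<phi>(1) \<Omega>]
  have "L2_tendsto \<Omega> \<phi> u"
    by (rule L2_tendsto_approx[OF \<phi>(2) U(1) T(1) H10_pairD(1)[OF UG] U(2)])
  moreover have "L2_tendsto \<Omega> (\<lambda>n. cgrad (\<phi> n)) g"
    by (rule L2_tendsto_approx[OF \<phi>(3) G(1) T(2) H10_pairD(2)[OF UG] G(2)])
  ultimately show ?thesis unfolding H10_pair_def using \<phi>(1) U(2) G(2) by blast
qed

section \<open>Extension by zero\<close>

lemma inner_L2_zero_extension:
  assumes "T \<subseteq> S" "S \<in> sets lebesgue" "T \<in> sets lebesgue"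
  shows "inner_L2 S (\<lambda>x. if x \<in> T then f x else 0) g = inner_L2 T f g"
proof -
  have "indicator S x *\<^sub>R ((if x \<in> T then f x else 0) \<bullet> g x) = indicator T x *\<^sub>R (f x \<bullet> g x)" for x
    using assms(1) by (auto simp: indicator_def)
  then show ?thesis using assms by (simp add: inner_L2_def integral_restrict_space)
qed

lemma L2_zero_extension:
  assumes "T \<subseteq> S" "S \<in> sets lebesgue" "T \<in> sets lebesgue" "f \<in> L2 T"
  shows "(\<lambda>x. if x \<in> T then f x else 0) \<in> L2 S"
proof -
  have "indicator S x *\<^sub>R (if x \<in> T then f x else 0) = indicator T x *\<^sub>R f x"
    "indicator S x *\<^sub>R (norm (if x \<in> T then f x else 0))\<^sup>2 = indicator T x *\<^sub>R (norm (f x))\<^sup>2" for x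
    using assms(1) by (auto simp: indicator_def)
  then show ?thesis using assms
    by (simp add: L2_def integrable_restrict_space borel_measurable_restrict_space_iff)
qed

lemma L2_tendsto_zero_extension:
  assumes sub: "T \<subseteq> S" and S: "S \<in> sets lebesgue" and T: "T \<in> sets lebesgue"
    and F: "L2_tendsto T F f" "\<And>n x. x \<notin> T \<Longrightarrow> F n x = 0"
  shows "L2_tendsto S F (\<lambda>x. if x \<in> T then f x else 0)"
proof -
  have 1: "(\<lambda>x. F n x - (if x \<in> T then f x else 0)) = (\<lambda>x. if x \<in> T then F n x - f x else 0)" for n
    using F(2) by auto
  have "inner_L2 T (\<lambda>x. F n x - f x) (\<lambda>x. if x \<in> T then F n x - f x else 0)
      = inner_L2 T (\<lambda>x. F n x - f x) (\<lambda>x. F n x - f x)" for n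
    using inner_L2_zero_extension[OF order_refl T T, of "\<lambda>x. F n x - f x" "\<lambda>x. F n x - f x"]
    by (subst inner_L2_commute)
  then show ?thesis
    using F(1) by (simp add: L2_tendsto_def 1 inner_L2_zero_extension[OF sub S T])
qed

text \<open>A test function on \<open>T\<close> is one on \<open>S\<close> and vanishes off
  \<open>T\<close> with its gradient, so the same approximating sequence works and the boundary of
  \<open>T\<close> plays no part.\<close>

lemma H10_pair_zero_extension:
  assumes sub: "T \<subseteq> S" and S: "S \<in> sets lebesgue" and T: "T \<in> sets lebesgue" and u: "H10_pair T u g"
  shows "H10_pair S (\<lambda>x. if x \<in> T then u x else 0) (\<lambda>x. if x \<in> T then g x else 0)"
proof -
  obtain \<phi> where \<phi>: "\<And>n. \<phi> n \<in> test_functions T" "L2_tendsto T \<phi> u" "L2_tendsto T (\<lambda>n. cgrad (\<phi> n)) g"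
    using H10_pairE[OF u] by blast
  have off: "\<phi> n x = 0 \<and> cgrad (\<phi> n) x = 0" if "x \<notin> T" for n x
    using test_functionsE[OF \<phi>(1)[of n]] that by (metis subsetD)
  show ?thesis unfolding H10_pair_def
  proof (intro conjI exI allI)
    show "\<phi> n \<in> test_functions S" for n
      using \<phi>(1)[of n] test_functions_mono[OF sub] by blast
    show "L2_tendsto S \<phi> (\<lambda>x. if x \<in> T then u x else 0)"
      by (rule L2_tendsto_zero_extension[OF sub S T \<phi>(2)]) (simp add: off)
    show "L2_tendsto S (\<lambda>n. cgrad (\<phi> n)) (\<lambda>x. if x \<in> T then g x else 0)"
      by (rule L2_tendsto_zero_extension[OF sub S T \<phi>(3)]) (simp add: off)
  qed (intro L2_zero_extension[OF sub S T] H10_pairD[OF u])+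
qed

text \<open>Poincare's inequality in a strip; integrating the derivative of \<open>(x \<bullet> i) * (\<phi> x)\<^sup>2\<close> avoids
  one-dimensional slicing.\<close>

lemma Poincare_test_function:
  fixes \<phi> :: "'a::euclidean_space \<Rightarrow> real"
  assumes \<Omega>: "\<Omega> \<in> sets lebesgue" and i: "i \<in> Basis" and C: "\<And>x. x \<in> \<Omega> \<Longrightarrow> \<bar>x \<bullet> i\<bar> \<le> C"
    and \<phi>: "\<phi> \<in> test_functions \<Omega>"
  shows "inner_L2 \<Omega> \<phi> \<phi> \<le> 4 * C\<^sup>2 * inner_L2 \<Omega> (cgrad \<phi>) (cgrad \<phi>)"
proof -
  obtain K where K: "compact K" "K \<subseteq> \<Omega>" "\<And>x. x \<notin> K \<Longrightarrow> \<phi> x = 0" "\<And>x. x \<notin> K \<Longrightarrow> cgrad \<phi> x = 0"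
    using test_functionsE[OF \<phi>] by metis
  note cont = test_function_continuous[OF \<phi>] test_function_continuous_cgrad[OF \<phi>]
  note T = test_function_L2[OF \<phi> \<Omega>]
  define h where "h x = \<phi> x * \<phi> x + 2 * (x \<bullet> i) * \<phi> x * (cgrad \<phi> x \<bullet> i)" for x
  have ch: "continuous_on UNIV h"
    unfolding h_def[abs_def] by (intro continuous_intros cont)
  have hK: "h x = 0" if "x \<notin> K" for x using K(3,4)[OF that] by (simp add: h_def)
  define F' where "F' x k = (k \<bullet> i) * (\<phi> x * \<phi> x)
      + (x \<bullet> i) * (\<phi> x * (cgrad \<phi> x \<bullet> k) + (cgrad \<phi> x \<bullet> k) * \<phi> x)" for x k
  have "(\<integral>x. F' x i \<partial>lborel) = 0"
  proof (rule integral_directional_derivative_eq_0[where F = "\<lambda>x. (x \<bullet> i) * (\<phi> x * \<phi> x)" and K = K])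
    show "((\<lambda>x. (x \<bullet> i) * (\<phi> x * \<phi> x)) has_derivative F' x) (at x)" for x
      unfolding F'_def using has_derivative_mult[OF has_derivative_inner_left[OF has_derivative_ident, of i]
          has_derivative_mult[OF test_function_has_derivative[OF \<phi>] test_function_has_derivative[OF \<phi>]]]
      by (simp add: add.commute)
    show "continuous_on UNIV (\<lambda>x. F' x i)"
      unfolding F'_def by (intro continuous_intros cont)
  qed (use K(1,3) in \<open>simp_all add: F'_def\<close>)
  moreover have "F' x i = h x" for x
    using i by (simp add: F'_def h_def algebra_simps)
  ultimately have "(\<integral>x. h x \<partial>lborel) = 0" by simp
  moreover have hO: "h x = 0" if "x \<notin> \<Omega>" for x using hK K(2) that by blast
  ultimately have int0: "(\<integral>x. h x \<partial>lebesgue_on \<Omega>) = 0"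
    using lebesgue_on_borel_support(1)[OF \<Omega> borel_measurable_continuous_onI[OF ch]] by simp
  have inth: "integrable (lebesgue_on \<Omega>) h"
    using lebesgue_on_borel_support(2)[OF \<Omega> borel_measurable_continuous_onI[OF ch] hO]
      integrable_compact_support[OF ch K(1) hK] by simp
  note I = L2_inner_integrable[OF T(1,1)] L2_inner_integrable[OF T(2,2)]
  have "(\<integral>x. (1/2) * (\<phi> x \<bullet> \<phi> x) \<partial>lebesgue_on \<Omega>)
      \<le> (\<integral>x. h x + 2 * C\<^sup>2 * (cgrad \<phi> x \<bullet> cgrad \<phi> x) \<partial>lebesgue_on \<Omega>)"
  proof (rule integral_mono)
    fix x assume "x \<in> space (lebesgue_on \<Omega>)"
    then have x: "\<bar>x \<bullet> i\<bar> \<le> C" using C by (simp add: space_restrict_space)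
    let ?D = "cgrad \<phi> x \<bullet> i"
    \<comment> \<open>Completing the square: half of this square plus half of the square of
      \<open>\<phi> x\<close> exceeds \<open>h x\<close> by exactly
      \<open>2 * (x \<bullet> i)\<^sup>2 * ?D\<^sup>2\<close>. Since \<open>h\<close> has integral
      0, doubling the integrated estimate gives the constant \<open>4 * C\<^sup>2\<close>.\<close>
    have "0 \<le> (\<phi> x + 2 * (x \<bullet> i) * ?D)\<^sup>2" by simp
    then have "(1/2) * (\<phi> x * \<phi> x) \<le> h x + 2 * ((x \<bullet> i)\<^sup>2 * ?D\<^sup>2)"
      by (simp add: h_def power2_eq_square algebra_simps)
    moreover have "(x \<bullet> i)\<^sup>2 * ?D\<^sup>2 \<le> C\<^sup>2 * (cgrad \<phi> x \<bullet> cgrad \<phi> x)"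
    proof (rule mult_mono)
      show "(x \<bullet> i)\<^sup>2 \<le> C\<^sup>2" using x by (metis abs_ge_zero order.trans abs_of_nonneg power2_le_iff_abs_le)
      show "?D\<^sup>2 \<le> cgrad \<phi> x \<bullet> cgrad \<phi> x"
        using Basis_le_norm[OF i, of "cgrad \<phi> x"] by (metis abs_ge_zero power2_abs power2_norm_eq_inner power_mono)
    qed auto
    ultimately show "(1/2) * (\<phi> x \<bullet> \<phi> x) \<le> h x + 2 * C\<^sup>2 * (cgrad \<phi> x \<bullet> cgrad \<phi> x)" by simp
  qed (use I inth in auto)
  then show ?thesis using I inth int0 by (simp add: inner_L2_def)
qed

text \<open>Poincare's inequality is applied to the approximants, whose gradients tend to
  \<open>g\<close> and hence to 0 in L2. So the approximants tend to 0 as well as to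
  \<open>u\<close>. This is the definiteness of the gradient form.\<close>

lemma H10_pair_zero_gradient:
  fixes u :: "'a::euclidean_space \<Rightarrow> real"
  assumes \<Omega>: "\<Omega> \<in> sets lebesgue" and i: "i \<in> Basis" and C: "\<And>x. x \<in> \<Omega> \<Longrightarrow> \<bar>x \<bullet> i\<bar> \<le> C"
    and u: "H10_pair \<Omega> u g" and g: "inner_L2 \<Omega> g g = 0"
  shows "AE x in lebesgue_on \<Omega>. u x = 0"
proof -
  obtain \<phi> where \<phi>: "\<And>n. \<phi> n \<in> test_functions \<Omega>" "L2_tendsto \<Omega> \<phi> u" "L2_tendsto \<Omega> (\<lambda>n. cgrad (\<phi> n)) g"
    using H10_pairE[OF u] by blast
  note T = test_function_L2[OF \<phi>(1) \<Omega>]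
  note U = H10_pairD[OF u]
  let ?a = "\<lambda>n. inner_L2 \<Omega> (\<lambda>x. \<phi> n x - u x) (\<lambda>x. \<phi> n x - u x)"
  let ?b = "\<lambda>n. inner_L2 \<Omega> (\<lambda>x. cgrad (\<phi> n) x - g x) (\<lambda>x. cgrad (\<phi> n) x - g x)"
  have "inner_L2 \<Omega> u u \<le> 2 * ?a n + 2 * (4 * C\<^sup>2 * (2 * ?b n))" for n
  proof -
    have "inner_L2 \<Omega> u u \<le> 2 * inner_L2 \<Omega> (\<lambda>x. u x - \<phi> n x) (\<lambda>x. u x - \<phi> n x) + 2 * inner_L2 \<Omega> (\<phi> n) (\<phi> n)"
      using inner_L2_self_add[OF L2_diff[OF U(1) T(1)] T(1), of n n] by simp
    also have "inner_L2 \<Omega> (\<lambda>x. u x - \<phi> n x) (\<lambda>x. u x - \<phi> n x) = ?a n"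
      unfolding inner_L2_def by (intro arg_cong[where f = "integral\<^sup>L _"]) (simp add: fun_eq_iff algebra_simps)
    also have "inner_L2 \<Omega> (\<phi> n) (\<phi> n) \<le> 4 * C\<^sup>2 * inner_L2 \<Omega> (cgrad (\<phi> n)) (cgrad (\<phi> n))"
      by (rule Poincare_test_function[OF \<Omega> i C \<phi>(1)])
    also have "inner_L2 \<Omega> (cgrad (\<phi> n)) (cgrad (\<phi> n)) \<le> 2 * ?b n"
      using inner_L2_self_add[OF L2_diff[OF T(2) U(2)] U(2), of n] g by simp
    finally show ?thesis by (simp add: mult_left_mono)
  qed
  moreover have "(\<lambda>n. 2 * ?a n + 2 * (4 * C\<^sup>2 * (2 * ?b n))) \<longlonglongrightarrow> 2 * 0 + 2 * (4 * C\<^sup>2 * (2 * 0))"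
    using \<phi>(2,3) unfolding L2_tendsto_def by (intro tendsto_intros)
  ultimately have "inner_L2 \<Omega> u u \<le> 0"
    by (intro LIMSEQ_le_const[where X = "\<lambda>n. 2 * ?a n + 2 * (4 * C\<^sup>2 * (2 * ?b n))"]) auto
  then show ?thesis
    using inner_L2_self_nonneg[of \<Omega> u] inner_L2_self_eq_0[OF U(1)] by simp
qed

section \<open>Reflection across the line \<open>x\<^sub>1 = 1\<close>\<close>

text \<open>The linear part of the affine reflection \<open>mirror\<close>: functions are composed
  with \<open>mirror\<close>, and their gradients are additionally transformed by
  \<open>flip\<close>.\<close>

definition flip :: "real \<times> real \<Rightarrow> real \<times> real" where
  "flip x = (- fst x, snd x)"

definition mirror :: "real \<times> real \<Rightarrow> real \<times> real" where
  "mirror x = flip x + (2, 0)"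

lemma fst_mirror [simp]: "fst (mirror x) = 2 - fst x" and snd_mirror [simp]: "snd (mirror x) = snd x"
  by (simp_all add: mirror_def flip_def)

lemma mirror_mirror [simp]: "mirror (mirror x) = x"
  by (simp add: prod_eq_iff)

lemma flip_flip [simp]: "flip (flip x) = x"
  by (simp add: flip_def)

lemma mirror_image: "mirror ` S = mirror -` S"
  by (auto simp: image_iff) (metis mirror_mirror)

lemma mirror_image_iff [simp]: "x \<in> mirror ` S \<longleftrightarrow> mirror x \<in> S"
  by (simp add: mirror_image)

lemma mirror_image_image [simp]: "mirror ` mirror ` S = S"
  by (auto simp: image_image)

lemma bounded_linear_flip: "bounded_linear flip"
  unfolding flip_def[abs_def] by (intro bounded_linear_Pair bounded_linear_minus bounded_linear_fst bounded_linear_snd)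

lemma flip_inner: "flip x \<bullet> y = x \<bullet> flip y"
  by (simp add: flip_def inner_prod_def)

lemma norm_flip [simp]: "norm (flip x) = norm x"
  by (simp add: norm_eq_sqrt_inner flip_inner)

lemma flip_diff: "flip (x - y) = flip x - flip y"
  by (simp add: flip_def)

lemma continuous_on_mirror: "continuous_on S mirror"
  unfolding mirror_def[abs_def] flip_def[abs_def] by (intro continuous_intros)

lemma closure_mirror: "closure (mirror ` S) = mirror ` closure S"
proof
  have "closed (mirror ` closure S)"
    unfolding mirror_image by (rule closed_vimage[OF closed_closure continuous_on_mirror])
  then show "closure (mirror ` S) \<subseteq> mirror ` closure S"
    using closure_subset by (intro closure_minimal image_mono)
  show "mirror ` closure S \<subseteq> closure (mirror ` S)"
    by (intro image_closure_subset continuous_on_mirror closed_closure closure_subset)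
qed

lemma open_mirror: "open S \<Longrightarrow> open (mirror ` S)"
  unfolding mirror_image by (rule open_vimage[OF _ continuous_on_mirror])

lemma interior_mirror: "interior (mirror ` S) = mirror ` interior S"
proof -
  have *: "mirror ` interior T \<subseteq> interior (mirror ` T)" for T
    by (intro interior_maximal open_mirror open_interior image_mono interior_subset)
  have "mirror ` interior (mirror ` S) \<subseteq> interior S"
    using *[of "mirror ` S"] by simp
  then have "mirror ` mirror ` interior (mirror ` S) \<subseteq> mirror ` interior S"
    by (rule image_mono)
  then show ?thesis using *[of S] by (simp add: subset_antisym)
qed

lemma Basis_real_prod: "(Basis :: (real \<times> real) set) = {(1, 0), (0, 1)}"
  by (auto simp: Basis_prod_def)

text \<open>Both follow from the rule for affine maps with diagonal linear part: \<open>c\<close> is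
  the diagonal of \<open>flip\<close>, and the absolute value of its determinant is 1.\<close>

lemma mirror_measurable: "mirror \<in> lebesgue \<rightarrow>\<^sub>M lebesgue"
  and distr_mirror: "distr lebesgue lebesgue mirror = lebesgue"
proof -
  define c :: "real \<times> real \<Rightarrow> real" where "c j = (if j = (1, 0) then -1 else 1)" for j
  have c: "\<And>j. j \<in> Basis \<Longrightarrow> c j \<noteq> 0" by (simp add: c_def)
  have eq: "(\<lambda>x. (2, 0) + (\<Sum>j\<in>Basis. (c j * (x \<bullet> j)) *\<^sub>R j)) = mirror"
    by (simp add: fun_eq_iff Basis_real_prod c_def mirror_def flip_def)
  show "mirror \<in> lebesgue \<rightarrow>\<^sub>M lebesgue"
    using lebesgue_affine_measurable[where t = "(2, 0)" and c = c, OF c] unfolding eq .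
  have "(\<Prod>j\<in>(Basis :: (real \<times> real) set). \<bar>c j\<bar>) = 1" by (simp add: Basis_real_prod c_def)
  then show "distr lebesgue lebesgue mirror = lebesgue"
    using lebesgue_affine_euclidean[where t = "(2, 0)" and c = c, OF c] unfolding eq by (simp add: density_1)
qed

lemma sets_lebesgue_mirror: "S \<in> sets lebesgue \<Longrightarrow> mirror ` S \<in> sets lebesgue"
  using measurable_sets[OF mirror_measurable] by (simp add: mirror_image)

lemma measurable_lebesgue_on_mirror:
  fixes f :: "real \<times> real \<Rightarrow> 'b::euclidean_space"
  assumes S: "S \<in> sets lebesgue" and f: "f \<in> borel_measurable (lebesgue_on S)"
  shows "(\<lambda>x. f (mirror x)) \<in> borel_measurable (lebesgue_on (mirror ` S))"
proof -
  have "(\<lambda>x. indicator S x *\<^sub>R f x) \<in> borel_measurable lebesgue"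
    using f S by (simp add: borel_measurable_restrict_space_iff)
  from measurable_compose[OF mirror_measurable this]
  have "(\<lambda>x. indicator S (mirror x) *\<^sub>R f (mirror x)) \<in> borel_measurable lebesgue" .
  then show ?thesis
    using sets_lebesgue_mirror[OF S] by (simp add: borel_measurable_restrict_space_iff indicator_def)
qed

lemma lebesgue_on_mirror:
  fixes f :: "real \<times> real \<Rightarrow> real"
  assumes S: "S \<in> sets lebesgue" and f: "f \<in> borel_measurable (lebesgue_on S)"
  shows "integral\<^sup>L (lebesgue_on (mirror ` S)) (\<lambda>x. f (mirror x)) = integral\<^sup>L (lebesgue_on S) f"
    and "integrable (lebesgue_on S) f \<Longrightarrow> integrable (lebesgue_on (mirror ` S)) (\<lambda>x. f (mirror x))"
proof -
  let ?F = "\<lambda>x. indicator S x *\<^sub>R f x"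
  have F: "?F \<in> borel_measurable lebesgue"
    using f S by (simp add: borel_measurable_restrict_space_iff)
  have eq: "(\<lambda>x. indicator (mirror ` S) x *\<^sub>R f (mirror x)) = (\<lambda>x. ?F (mirror x))"
    by (simp add: fun_eq_iff indicator_def)
  note S' = sets_lebesgue_mirror[OF S]
  have "integral\<^sup>L (lebesgue_on (mirror ` S)) (\<lambda>x. f (mirror x)) = integral\<^sup>L lebesgue (\<lambda>x. ?F (mirror x))"
    using S' by (simp add: integral_restrict_space eq del: real_scaleR_def)
  also have "\<dots> = integral\<^sup>L lebesgue ?F"
    using integral_distr[OF mirror_measurable F] unfolding distr_mirror by simp
  also have "\<dots> = integral\<^sup>L (lebesgue_on S) f"
    using S by (simp add: integral_restrict_space)
  finally show "integral\<^sup>L (lebesgue_on (mirror ` S)) (\<lambda>x. f (mirror x)) = integral\<^sup>L (lebesgue_on S) f" .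
  assume "integrable (lebesgue_on S) f"
  then have "integrable lebesgue ?F" using S by (simp add: integrable_restrict_space)
  then have "integrable lebesgue (\<lambda>x. ?F (mirror x))"
    using integrable_distr_eq[OF mirror_measurable F] unfolding distr_mirror by simp
  then show "integrable (lebesgue_on (mirror ` S)) (\<lambda>x. f (mirror x))"
    using S' by (simp add: integrable_restrict_space eq del: real_scaleR_def)
qed

lemma L2_mirror:
  fixes f :: "real \<times> real \<Rightarrow> 'b::euclidean_space"
  assumes S: "S \<in> sets lebesgue" and f: "f \<in> L2 S"
  shows "(\<lambda>x. f (mirror x)) \<in> L2 (mirror ` S)"
  using f measurable_lebesgue_on_mirror[OF S, of f] lebesgue_on_mirror(2)[OF S, of "\<lambda>x. (norm (f x))\<^sup>2"]
  by (simp add: L2_def)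

lemma inner_L2_mirror:
  fixes f :: "real \<times> real \<Rightarrow> 'b::euclidean_space"
  assumes "S \<in> sets lebesgue" "f \<in> L2 S" "g \<in> L2 S"
  shows "inner_L2 (mirror ` S) (\<lambda>x. f (mirror x)) (\<lambda>x. g (mirror x)) = inner_L2 S f g"
  unfolding inner_L2_def
  by (rule lebesgue_on_mirror(1)[OF assms(1)]) (intro borel_measurable_inner L2_measurable assms)

lemma L2_flip: "f \<in> L2 S \<Longrightarrow> (\<lambda>x. flip (f x)) \<in> L2 S"
proof (rule L2_bound)
  assume "f \<in> L2 S"
  show "(\<lambda>x. flip (f x)) \<in> borel_measurable (lebesgue_on S)"
    by (rule measurable_compose[OF L2_measurable[OF \<open>f \<in> L2 S\<close>]])
       (intro borel_measurable_continuous_onI bounded_linear.continuous_on[OF bounded_linear_flip] continuous_on_id)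
qed auto

lemma inner_L2_flip: "inner_L2 S (\<lambda>x. flip (f x)) (\<lambda>x. flip (g x)) = inner_L2 S f g"
  by (simp add: inner_L2_def flip_inner)

text \<open>The chain rule produces the adjoint of the derivative of \<open>mirror\<close>, and
  \<open>flip\<close> is its own adjoint.\<close>

lemma test_function_mirror:
  assumes "\<phi> \<in> test_functions \<Omega>"
  shows "(\<lambda>x. \<phi> (mirror x)) \<in> test_functions (mirror ` \<Omega>)"
    and "cgrad (\<lambda>x. \<phi> (mirror x)) = (\<lambda>x. flip (cgrad \<phi> (mirror x)))"
proof -
  obtain K where K: "compact K" "K \<subseteq> \<Omega>" "\<And>x. x \<notin> K \<Longrightarrow> \<phi> x = 0"
    using test_functionsE[OF assms] by metis
  show "(\<lambda>x. \<phi> (mirror x)) \<in> test_functions (mirror ` \<Omega>)"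
  proof (rule test_functionsI)
    show "Ck k (\<lambda>x. \<phi> (mirror x))" for k
      unfolding mirror_def by (rule Ck_affine[OF bounded_linear_flip test_function_Ck[OF assms]])
    show "compact (mirror ` K)" by (rule compact_continuous_image[OF continuous_on_mirror K(1)])
    show "mirror ` K \<subseteq> mirror ` \<Omega>" using K(2) by (rule image_mono)
  qed (use K(3) in simp)
  show "cgrad (\<lambda>x. \<phi> (mirror x)) = (\<lambda>x. flip (cgrad \<phi> (mirror x)))"
  proof
    fix x
    have "(mirror has_derivative flip) (at x)"
      unfolding mirror_def[abs_def] using bounded_linear_imp_has_derivative[OF bounded_linear_flip]
      by (auto intro!: derivative_eq_intros)
    then have "((\<lambda>x. \<phi> (mirror x)) has_derivative (\<lambda>h. cgrad \<phi> (mirror x) \<bullet> flip h)) (at x)"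
      by (rule has_derivative_compose[OF _ test_function_has_derivative[OF assms]])
    then show "cgrad (\<lambda>x. \<phi> (mirror x)) x = flip (cgrad \<phi> (mirror x))"
      by (intro cgrad_eqI) (simp add: flip_inner)
  qed
qed

lemma L2_tendsto_mirror:
  fixes f :: "real \<times> real \<Rightarrow> 'b::euclidean_space"
  assumes S: "S \<in> sets lebesgue" and "L2_tendsto S F f" "\<And>n. F n \<in> L2 S" "f \<in> L2 S"
  shows "L2_tendsto (mirror ` S) (\<lambda>n x. F n (mirror x)) (\<lambda>x. f (mirror x))"
  using assms(2) unfolding L2_tendsto_def
  by (simp add: inner_L2_mirror[OF S L2_diff[OF assms(3,4)] L2_diff[OF assms(3,4)]])

lemma H10_pair_mirror:
  assumes S: "S \<in> sets lebesgue" and u: "H10_pair S u g"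
  shows "H10_pair (mirror ` S) (\<lambda>x. u (mirror x)) (\<lambda>x. flip (g (mirror x)))"
proof -
  obtain \<phi> where \<phi>: "\<And>n. \<phi> n \<in> test_functions S" "L2_tendsto S \<phi> u" "L2_tendsto S (\<lambda>n. cgrad (\<phi> n)) g"
    using H10_pairE[OF u] by blast
  note T = test_function_L2[OF \<phi>(1) S] and U = H10_pairD[OF u]
  show ?thesis unfolding H10_pair_def
  proof (intro conjI exI allI)
    show "(\<lambda>x. \<phi> n (mirror x)) \<in> test_functions (mirror ` S)" for n
      by (rule test_function_mirror(1)[OF \<phi>(1)])
    show "L2_tendsto (mirror ` S) (\<lambda>n x. \<phi> n (mirror x)) (\<lambda>x. u (mirror x))"
      by (rule L2_tendsto_mirror[OF S \<phi>(2) T(1) U(1)])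
    have "L2_tendsto (mirror ` S) (\<lambda>n x. cgrad (\<phi> n) (mirror x)) (\<lambda>x. g (mirror x))"
      by (rule L2_tendsto_mirror[OF S \<phi>(3) T(2) U(2)])
    then show "L2_tendsto (mirror ` S) (\<lambda>n. cgrad (\<lambda>x. \<phi> n (mirror x))) (\<lambda>x. flip (g (mirror x)))"
      by (simp add: test_function_mirror(2)[OF \<phi>(1)] L2_tendsto_def flip_diff[symmetric] inner_L2_flip)
  qed (intro L2_flip L2_mirror[OF S] U)+
qed

section \<open>Dominated convergence in L2\<close>

lemma L2_tendsto_dominated:
  fixes f :: "'a::euclidean_space \<Rightarrow> 'b::euclidean_space"
  assumes "\<And>n. F n \<in> L2 S" "f \<in> L2 S" "w \<in> L2 S"
    and "\<And>x. x \<in> S \<Longrightarrow> (\<lambda>n. F n x) \<longlonglongrightarrow> f x"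
    and "\<And>n x. x \<in> S \<Longrightarrow> norm (F n x - f x) \<le> norm (w x)"
  shows "L2_tendsto S F f"
proof -
  have "(\<lambda>n. \<integral>x. (norm (F n x - f x))\<^sup>2 \<partial>lebesgue_on S) \<longlonglongrightarrow> (\<integral>x. 0 \<partial>lebesgue_on S)"
  proof (rule integral_dominated_convergence)
    show "integrable (lebesgue_on S) (\<lambda>x. (norm (w x))\<^sup>2)" using assms(3) by (simp add: L2_def)
    show "(\<lambda>x. (norm (F n x - f x))\<^sup>2) \<in> borel_measurable (lebesgue_on S)" for n
      using L2_measurable[OF L2_diff[OF assms(1,2)]] by measurable
    show "AE x in lebesgue_on S. norm ((norm (F n x - f x))\<^sup>2) \<le> (norm (w x))\<^sup>2" for n
      using assms(5) by (intro AE_I2) (simp add: space_restrict_space power_mono)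
    show "AE x in lebesgue_on S. (\<lambda>n. (norm (F n x - f x))\<^sup>2) \<longlonglongrightarrow> 0"
    proof (rule AE_I2)
      fix x assume "x \<in> space (lebesgue_on S)"
      then have "x \<in> S" by (simp add: space_restrict_space)
      then have "(\<lambda>n. (norm (F n x - f x))\<^sup>2) \<longlonglongrightarrow> (norm (f x - f x))\<^sup>2"
        by (intro tendsto_intros assms(4))
      then show "(\<lambda>n. (norm (F n x - f x))\<^sup>2) \<longlonglongrightarrow> 0" by simp
    qed
  qed simp
  then show ?thesis by (simp add: L2_tendsto_def inner_L2_self)
qed

lemma L2_const_indicator:
  fixes K :: "'a::euclidean_space set"
  assumes "S \<in> sets lebesgue" "compact K"
  shows "(\<lambda>x. c * indicator K x :: real) \<in> L2 S"
proof -
  have K: "K \<in> sets lborel" using assms(2) by (simp add: borel_compact)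
  have fin: "emeasure lborel K < \<infinity>" by (rule emeasure_bounded_finite[OF compact_imp_bounded[OF assms(2)]])
  have "integrable lborel (\<lambda>x. c\<^sup>2 * indicator K x :: real)"
    by (intro integrable_mult_right integrable_real_indicator K fin)
  then have "integrable lebesgue (\<lambda>x. c\<^sup>2 * indicator K x :: real)"
    using K by (subst integrable_completion) auto
  then have "integrable lebesgue (\<lambda>x. indicator S x *\<^sub>R (c\<^sup>2 * indicator K x :: real))"
    by (rule integrable_mult_indicator[OF assms(1)])
  moreover have "(norm (c * indicator K x :: real))\<^sup>2 = c\<^sup>2 * indicator K x" for x
    by (simp add: indicator_def)
  moreover have "(\<lambda>x. c * indicator K x :: real) \<in> borel_measurable (lebesgue_on S)"
    using K by (intro measurable_restrict_space1 measurable_completion) auto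
  ultimately show ?thesis
    using assms(1) by (simp add: L2_def integrable_restrict_space)
qed

section \<open>Odd functions vanish on the interface\<close>

abbreviation dpsi :: "real \<Rightarrow> real" where "dpsi \<equiv> psi [:0, 0, 1:]"

text \<open>For \<open>s = n * (1 - x1) - 1\<close> the factor \<open>s + 1\<close> is the slope
  \<open>n\<close> times the distance to the interface, so this is a bound uniform in
  \<open>n\<close> for the dangerous term of the cut-off gradient. With \<open>x = 1 / s\<close> it
  reduces to \<open>x + x\<^sup>2 \<le> 2 * exp x\<close>.\<close>

lemma dpsi_bound: "0 \<le> dpsi s" "\<bar>(s + 1) * dpsi s\<bar> \<le> 2"
proof -
  show 0: "0 \<le> dpsi s" by (simp add: psi_def)
  show "\<bar>(s + 1) * dpsi s\<bar> \<le> 2"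
  proof (cases "s > 0")
    case True
    define x where "x = 1 / s"
    have x: "x > 0" "s = 1 / x" using True by (simp_all add: x_def)
    have "x + x\<^sup>2 \<le> 2 * exp x"
      using exp_lower_Taylor_quadratic[of x] x(1) by simp
    then have "(x + x\<^sup>2) * exp (- x) \<le> 2"
      by (simp add: exp_minus field_simps)
    moreover have "dpsi s = x\<^sup>2 * exp (- x)"
      using True by (simp add: psi_def x_def power2_eq_square)
    then have "(s + 1) * dpsi s = (x + x\<^sup>2) * exp (- x)"
      using x(1) unfolding x(2) by (simp add: power2_eq_square algebra_simps)
    moreover have "0 \<le> (s + 1) * dpsi s" using True 0 by simp
    ultimately show ?thesis by simp
  qed (simp add: psi_def)
qed

text \<open>\<open>dpsi s\<close> decays like \<open>1 / s\<^sup>2\<close>, which beats the linear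
  factor at each fixed positive distance \<open>t\<close> from the interface.\<close>

lemma dpsi_tendsto:
  assumes "t > 0"
  shows "(\<lambda>n. (real n * t) * dpsi (real n * t - 1)) \<longlonglongrightarrow> 0"
proof -
  have lim: "filterlim (\<lambda>n. real n * t - 1) at_top sequentially"
    using assms by real_asymp
  have "((\<lambda>s::real. (s + 1) * ((1 / s)\<^sup>2 * exp (- (1 / s)))) \<longlongrightarrow> 0) at_top"
    by real_asymp
  from filterlim_compose[OF this lim]
  have "(\<lambda>n. (real n * t - 1 + 1) * ((1 / (real n * t - 1))\<^sup>2 * exp (- (1 / (real n * t - 1))))) \<longlonglongrightarrow> 0" .
  moreover have "eventually (\<lambda>n. (real n * t - 1 + 1) * ((1 / (real n * t - 1))\<^sup>2 * exp (- (1 / (real n * t - 1))))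
      = (real n * t) * dpsi (real n * t - 1)) sequentially"
    using filterlim_at_top_dense[THEN iffD1, OF lim, rule_format, of 0]
    by eventually_elim (simp add: psi_def power2_eq_square)
  ultimately show ?thesis by (rule Lim_transform_eventually)
qed

text \<open>The shift by -1 makes the function vanish wherever \<open>n * (1 - x1) \<le> 1\<close>,
  a whole strip beside the interface, so that products with test functions have compact support in
  the open left half.\<close>

definition cutoff :: "nat \<Rightarrow> real \<times> real \<Rightarrow> real" where
  "cutoff n x = psi 1 (real n * (1 - fst x) - 1)"

lemma cutoff_affine: "cutoff n x = psi 1 ((- real n, 0) \<bullet> x + (real n - 1))"
  by (simp add: cutoff_def inner_prod_def algebra_simps)

lemma Ck_cutoff: "Ck k (cutoff n)"
  unfolding cutoff_affine[abs_def] by (rule Ck_psi)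

lemma cutoff_has_derivative:
  "(cutoff n has_derivative (\<lambda>h. ((- real n * dpsi (real n * (1 - fst x) - 1)) *\<^sub>R (1, 0)) \<bullet> h)) (at x)"
proof -
  have "psi ([:0, 0, 1:] * (1 - pderiv 1)) ((- real n, 0) \<bullet> x + (real n - 1)) * ((- real n, 0) \<bullet> h)
      = ((- real n * dpsi (real n * (1 - fst x) - 1)) *\<^sub>R (1, 0)) \<bullet> h" for h
    by (simp add: inner_prod_def algebra_simps)
  then show ?thesis
    unfolding cutoff_affine[abs_def] by (intro has_derivative_eq_rhs[OF psi_has_derivative] ext)
qed

text \<open>A test function \<open>\<theta>\<close> vanishing on the line \<open>x\<^sub>1 = 1\<close> is \<open>O(1 - x\<^sub>1)\<close> there, which compensates
  the gradient of the cut-off function of slope \<open>n\<close>.\<close>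

lemma H10_pair_half_test_function:
  fixes \<theta> :: "real \<times> real \<Rightarrow> real"
  assumes \<Omega>: "\<Omega> \<in> sets lebesgue" and \<Omega>1: "\<Omega>1 = {x \<in> \<Omega>. fst x < 1}" "\<Omega>1 \<in> sets lebesgue"
    and \<theta>: "\<theta> \<in> test_functions \<Omega>" and van: "\<And>x. fst x = 1 \<Longrightarrow> \<theta> x = 0"
  shows "H10_pair \<Omega>1 \<theta> (cgrad \<theta>)"
proof -
  obtain K where K: "compact K" "K \<subseteq> \<Omega>" "\<And>x. x \<notin> K \<Longrightarrow> \<theta> x = 0" "\<And>x. x \<notin> K \<Longrightarrow> cgrad \<theta> x = 0"
    using test_functionsE[OF \<theta>] by metis
  obtain B where B: "B > 0" "\<And>x. norm (cgrad \<theta> x) \<le> B"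
    using bounded_compact_support[OF test_function_continuous_cgrad[OF \<theta>] K(1,4)] by blast
  \<comment> \<open>The comparison point is the horizontal projection to the line. The segment may
    leave \<Omega>, but \<theta> is smooth on the whole plane with the same gradient bound.\<close>
  have lip: "\<bar>\<theta> x\<bar> \<le> B * (1 - fst x)" if "fst x < 1" for x
  proof -
    have "norm (\<theta> x - \<theta> (1, snd x)) \<le> B * norm (x - (1, snd x))"
    proof (rule differentiable_bound[OF convex_UNIV])
      show "(\<theta> has_derivative (\<lambda>h. cgrad \<theta> y \<bullet> h)) (at y within UNIV)" for y
        using test_function_has_derivative[OF \<theta>] by simp
      show "onorm (\<lambda>h. cgrad \<theta> y \<bullet> h) \<le> B" for y
      proof (rule onorm_le)
        fix h
        show "norm (cgrad \<theta> y \<bullet> h) \<le> B * norm h"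
          using Cauchy_Schwarz_ineq2[of "cgrad \<theta> y" h] mult_right_mono[OF B(2)[of y] norm_ge_zero[of h]] by simp
      qed
    qed auto
    moreover have "norm (x - (1, snd x)) = 1 - fst x"
      using that by (simp add: norm_prod_def)
    ultimately show ?thesis using van[of "(1, snd x)"] by simp
  qed
  define \<eta> where "\<eta> n x = \<theta> x * cutoff n x" for n x
  have test: "\<eta> n \<in> test_functions \<Omega>1" for n
  proof (rule test_functionsI)
    show "Ck k (\<eta> n)" for k
      unfolding \<eta>_def[abs_def] by (intro Ck_mult test_function_Ck[OF \<theta>] Ck_cutoff)
    have "closed {x :: real \<times> real. 1 \<le> real n * (1 - fst x)}"
      by (intro closed_Collect_le continuous_intros)
    then show "compact (K \<inter> {x. 1 \<le> real n * (1 - fst x)})"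
      using K(1) by (rule compact_Int_closed[rotated])
    show "K \<inter> {x. 1 \<le> real n * (1 - fst x)} \<subseteq> \<Omega>1"
    proof
      fix x assume x: "x \<in> K \<inter> {x. 1 \<le> real n * (1 - fst x)}"
      then have "0 < real n * (1 - fst x)" by auto
      then have "fst x < 1" by (simp add: zero_less_mult_iff)
      then show "x \<in> \<Omega>1" using x K(2) \<Omega>1(1) by auto
    qed
    show "\<eta> n x = 0" if "x \<notin> K \<inter> {x. 1 \<le> real n * (1 - fst x)}" for x
    proof (cases "x \<in> K")
      case True
      then show ?thesis using that by (simp add: \<eta>_def cutoff_def psi_one(3))
    qed (simp add: \<eta>_def K(3))
  qed
  have grad: "cgrad (\<eta> n) x - cgrad \<theta> x = (cutoff n x - 1) *\<^sub>R cgrad \<theta> x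
      + (\<theta> x * (- real n * dpsi (real n * (1 - fst x) - 1))) *\<^sub>R (1, 0)" for n x
  proof -
    have "cgrad (\<eta> n) x = \<theta> x *\<^sub>R ((- real n * dpsi (real n * (1 - fst x) - 1)) *\<^sub>R (1, 0)) + cutoff n x *\<^sub>R cgrad \<theta> x"
      unfolding \<eta>_def[abs_def]
      by (intro cgrad_eqI has_derivative_eq_rhs[OF has_derivative_mult[OF test_function_has_derivative[OF \<theta>] cutoff_has_derivative]])
         (simp add: fun_eq_iff inner_add_left mult.commute)
    then show ?thesis by (simp add: scaleR_diff_left)
  qed
  note T = test_function_L2[OF \<theta> \<Omega>1(2)] test_function_L2[OF test \<Omega>1(2)]
  have lim: "(\<lambda>n. cutoff n x) \<longlonglongrightarrow> 1" if "x \<in> \<Omega>1" for x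
    unfolding cutoff_def using psi_one_tendsto[of "1 - fst x" "-1"] that \<Omega>1(1) by simp
  have c01: "\<bar>cutoff n x - 1\<bar> \<le> 1" for n x
    using psi_one(1,2)[of "real n * (1 - fst x) - 1"] by (simp add: cutoff_def abs_le_iff)
  have slope: "\<bar>\<theta> x * (- real n * dpsi (real n * (1 - fst x) - 1))\<bar>
      \<le> B * \<bar>real n * (1 - fst x) * dpsi (real n * (1 - fst x) - 1)\<bar>" if "x \<in> \<Omega>1" for n x
  proof -
    have "\<bar>\<theta> x\<bar> \<le> B * (1 - fst x)" "fst x < 1" using lip that \<Omega>1(1) by auto
    from mult_right_mono[OF this(1), of "real n * dpsi (real n * (1 - fst x) - 1)"] this(2)
    show ?thesis using dpsi_bound(1) by (simp add: abs_mult ac_simps)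
  qed
  have "L2_tendsto \<Omega>1 \<eta> \<theta>"
  proof (rule L2_tendsto_dominated[OF T(3) T(1) T(1)])
    show "(\<lambda>n. \<eta> n x) \<longlonglongrightarrow> \<theta> x" if "x \<in> \<Omega>1" for x
      unfolding \<eta>_def using tendsto_mult[OF tendsto_const[of "\<theta> x"] lim[OF that]] by simp
    show "norm (\<eta> n x - \<theta> x) \<le> norm (\<theta> x)" for n x
    proof -
      have "\<eta> n x - \<theta> x = \<theta> x * (cutoff n x - 1)" by (simp add: \<eta>_def algebra_simps)
      then show ?thesis using mult_left_mono[OF c01[of n x] abs_ge_zero[of "\<theta> x"]] by (simp add: abs_mult)
    qed
  qed
  moreover have "L2_tendsto \<Omega>1 (\<lambda>n. cgrad (\<eta> n)) (cgrad \<theta>)"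
  \<comment> \<open>The constant is \<open>B\<close> from
    \<open>(cutoff n x - 1) *\<^sub>R cgrad \<theta> x\<close> plus \<open>2 * B\<close> from the
    derivative of the cut-off, by \<open>slope\<close> and \<open>dpsi_bound\<close>.\<close>
  proof (rule L2_tendsto_dominated[OF T(4) T(2) L2_const_indicator[OF \<Omega>1(2) K(1), of "3 * B"]])
    fix x assume x: "x \<in> \<Omega>1"
    have "(\<lambda>n. B * \<bar>real n * (1 - fst x) * dpsi (real n * (1 - fst x) - 1)\<bar>) \<longlonglongrightarrow> B * \<bar>0\<bar>"
      using x \<Omega>1(1) by (intro tendsto_intros dpsi_tendsto) auto
    then have "(\<lambda>n. \<theta> x * (- real n * dpsi (real n * (1 - fst x) - 1))) \<longlonglongrightarrow> 0"
      by (intro tendsto_rabs_zero_cancel[OF LIMSEQ_squeeze_zero[OF _ abs_ge_zero slope[OF x]]]) simp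
    then have "(\<lambda>n. cgrad (\<eta> n) x - cgrad \<theta> x) \<longlonglongrightarrow> (1 - 1) *\<^sub>R cgrad \<theta> x + 0 *\<^sub>R (1, 0)"
      unfolding grad by (intro tendsto_intros lim[OF x])
    then have "(\<lambda>n. cgrad (\<eta> n) x - cgrad \<theta> x) \<longlonglongrightarrow> 0" by (simp add: zero_prod_def)
    then show "(\<lambda>n. cgrad (\<eta> n) x) \<longlonglongrightarrow> cgrad \<theta> x" by (rule LIM_zero_cancel)
    show "norm (cgrad (\<eta> n) x - cgrad \<theta> x) \<le> norm (3 * B * indicator K x :: real)" for n
    proof (cases "x \<in> K")
      case True
      have "norm ((cutoff n x - 1) *\<^sub>R cgrad \<theta> x) \<le> 1 * B"
        unfolding norm_scaleR by (intro mult_mono c01 B) auto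
      moreover have "\<bar>real n * (1 - fst x) * dpsi (real n * (1 - fst x) - 1)\<bar> \<le> 2"
        using dpsi_bound(2)[of "real n * (1 - fst x) - 1"] by simp
      then have "norm ((\<theta> x * (- real n * dpsi (real n * (1 - fst x) - 1))) *\<^sub>R (1::real, 0::real)) \<le> B * 2"
        using order_trans[OF slope[OF x, of n] mult_left_mono] B(1) by (simp add: norm_prod_def)
      ultimately have "norm (cgrad (\<eta> n) x - cgrad \<theta> x) \<le> 1 * B + B * 2"
        unfolding grad by (rule norm_triangle_mono)
      then show ?thesis using True B(1) by simp
    next
      case False
      then show ?thesis unfolding grad by (simp add: K zero_prod_def[symmetric])
    qed
  qed
  ultimately show ?thesis
    unfolding H10_pair_def using test T(1,2) by blast
qed

text \<open>The line \<open>x1 = 1\<close> consists of fixed points of \<open>mirror\<close>, so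
  antisymmetrizing each approximating test function makes it vanish there exactly. Each one then
  belongs to the half domain, and \<open>H10_pair\<close> is closed under limits.\<close>

lemma H10_pair_antisymmetric_half:
  assumes \<Omega>: "\<Omega> \<in> sets lebesgue" "mirror ` \<Omega> = \<Omega>"
    and \<Omega>1: "\<Omega>1 = {x \<in> \<Omega>. fst x < 1}" "\<Omega>1 \<in> sets lebesgue"
    and u: "H10_pair \<Omega> u g"
  shows "H10_pair \<Omega>1 (\<lambda>x. u x - u (mirror x)) (\<lambda>x. g x - flip (g (mirror x)))"
proof -
  obtain \<phi> where \<phi>: "\<And>n. \<phi> n \<in> test_functions \<Omega>" "L2_tendsto \<Omega> \<phi> u" "L2_tendsto \<Omega> (\<lambda>n. cgrad (\<phi> n)) g"
    using H10_pairE[OF u] by blast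
  note T = test_function_L2[OF \<phi>(1) \<Omega>(1)] and U = H10_pairD[OF u]
  have m: "(\<lambda>x. \<phi> n (mirror x)) \<in> test_functions \<Omega>" for n
    using test_function_mirror(1)[OF \<phi>(1)] \<Omega>(2) by simp
  define \<theta> where "\<theta> n x = 1 *\<^sub>R \<phi> n x + (-1) *\<^sub>R \<phi> n (mirror x)" for n x
  have \<theta>: "\<theta> n \<in> test_functions \<Omega>" "cgrad (\<theta> n) = (\<lambda>x. 1 *\<^sub>R cgrad (\<phi> n) x + (-1) *\<^sub>R flip (cgrad (\<phi> n) (mirror x)))" for n
    using test_function_lincomb[OF \<phi>(1)[of n] m[of n], of 1 "-1"]
    unfolding \<theta>_def[abs_def] test_function_mirror(2)[OF \<phi>(1)] by simp_all
  note T' = test_function_L2[OF m \<Omega>(1)]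
  have Um: "(\<lambda>x. u (mirror x)) \<in> L2 \<Omega>" "(\<lambda>x. flip (g (mirror x))) \<in> L2 \<Omega>"
    using L2_mirror[OF \<Omega>(1) U(1)] L2_flip[OF L2_mirror[OF \<Omega>(1) U(2)]] \<Omega>(2) by simp_all
  have l1: "L2_tendsto \<Omega> (\<lambda>n x. \<phi> n (mirror x)) (\<lambda>x. u (mirror x))"
    using L2_tendsto_mirror[OF \<Omega>(1) \<phi>(2) T(1) U(1)] \<Omega>(2) by simp
  have "L2_tendsto \<Omega> (\<lambda>n x. cgrad (\<phi> n) (mirror x)) (\<lambda>x. g (mirror x))"
    using L2_tendsto_mirror[OF \<Omega>(1) \<phi>(3) T(2) U(2)] \<Omega>(2) by simp
  then have l2: "L2_tendsto \<Omega> (\<lambda>n x. flip (cgrad (\<phi> n) (mirror x))) (\<lambda>x. flip (g (mirror x)))"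
    by (simp add: L2_tendsto_def flip_diff[symmetric] inner_L2_flip)
  have T2: "(\<lambda>x. flip (cgrad (\<phi> n) (mirror x))) \<in> L2 \<Omega>" for n
    using T'(2)[of n] by (simp add: test_function_mirror(2)[OF \<phi>(1)])
  have L1: "L2_tendsto \<Omega> \<theta> (\<lambda>x. 1 *\<^sub>R u x + (-1) *\<^sub>R u (mirror x))"
    unfolding \<theta>_def[abs_def] by (intro L2_tendsto_lincomb \<phi> l1 T T' U Um)
  have L2: "L2_tendsto \<Omega> (\<lambda>n. cgrad (\<theta> n)) (\<lambda>x. 1 *\<^sub>R g x + (-1) *\<^sub>R flip (g (mirror x)))"
    unfolding \<theta>(2) by (intro L2_tendsto_lincomb \<phi> l2 T T2 U Um)
  have sub: "\<Omega>1 \<subseteq> \<Omega>" using \<Omega>1(1) by auto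
  have M: "(\<lambda>x. 1 *\<^sub>R u x + (-1) *\<^sub>R u (mirror x)) \<in> L2 \<Omega>"
    "(\<lambda>x. 1 *\<^sub>R g x + (-1) *\<^sub>R flip (g (mirror x))) \<in> L2 \<Omega>"
    by (intro L2_lincomb U Um)+
  have van: "\<theta> n x = 0" if "fst x = 1" for n x
  proof -
    have "mirror x = x" using that by (simp add: prod_eq_iff)
    then show ?thesis by (simp add: \<theta>_def)
  qed
  have "H10_pair \<Omega>1 (\<lambda>x. 1 *\<^sub>R u x + (-1) *\<^sub>R u (mirror x)) (\<lambda>x. 1 *\<^sub>R g x + (-1) *\<^sub>R flip (g (mirror x)))"
  proof (rule H10_pair_limit[OF \<Omega>1(2)])
    show "H10_pair \<Omega>1 (\<theta> n) (cgrad (\<theta> n))" for n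
      by (rule H10_pair_half_test_function[OF \<Omega>(1) \<Omega>1 \<theta>(1) van])
    show "L2_tendsto \<Omega>1 \<theta> (\<lambda>x. 1 *\<^sub>R u x + (-1) *\<^sub>R u (mirror x))"
      by (rule L2_tendsto_subset[OF L1 test_function_L2(1)[OF \<theta>(1) \<Omega>(1)] M(1) sub \<Omega>(1) \<Omega>1(2)])
    show "L2_tendsto \<Omega>1 (\<lambda>n. cgrad (\<theta> n)) (\<lambda>x. 1 *\<^sub>R g x + (-1) *\<^sub>R flip (g (mirror x)))"
      by (rule L2_tendsto_subset[OF L2 test_function_L2(2)[OF \<theta>(1) \<Omega>(1)] M(2) sub \<Omega>(1) \<Omega>1(2)])
  qed (intro L2_mono[OF M(1) sub \<Omega>(1) \<Omega>1(2)] L2_mono[OF M(2) sub \<Omega>(1) \<Omega>1(2)])+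
  then show ?thesis by simp
qed

section \<open>Geometry of the mirrored domain\<close>

lemma open_Omega1:
  assumes "continuous_on {0<..<1} r1" "continuous_on {0<..<1} r2"
  shows "open (Omega1 r1 r2)"
proof -
  let ?U = "{0<..<1} \<times> (UNIV :: real set)"
  have "continuous_on ?U (\<lambda>x. min (snd x - r1 (fst x)) (r2 (fst x) - snd x))"
    by (intro continuous_intros continuous_on_compose2[OF assms(1)] continuous_on_compose2[OF assms(2)]) auto
  then have "open (?U \<inter> (\<lambda>x. min (snd x - r1 (fst x)) (r2 (fst x) - snd x)) -` {0<..})"
    by (rule continuous_open_preimage) (auto intro: open_Times)
  also have "?U \<inter> (\<lambda>x. min (snd x - r1 (fst x)) (r2 (fst x) - snd x)) -` {0<..} = Omega1 r1 r2"
    by (auto simp: Omega1_def)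
  finally show ?thesis .
qed

lemma Omega2_eq: "Omega2 r1 r2 = mirror ` Omega1 r1 r2"
proof (rule set_eqI)
  fix x
  have "mirror x = (2 - fst x, snd x)" by (simp add: prod_eq_iff)
  then show "x \<in> Omega2 r1 r2 \<longleftrightarrow> x \<in> mirror ` Omega1 r1 r2"
    by (simp add: Omega2_def case_prod_beta)
qed

lemma mirror_Omega: "mirror ` Omega r1 r2 = Omega r1 r2"
  by (simp add: Omega_def Omega2_eq interior_mirror[symmetric] closure_mirror image_Un Un_commute)

lemma closure_Omega1_fst: "x \<in> closure (Omega1 r1 r2) \<Longrightarrow> 0 \<le> fst x \<and> fst x \<le> 1"
proof -
  have "closure (Omega1 r1 r2) \<subseteq> {x. 0 \<le> fst x \<and> fst x \<le> 1}"
    by (intro closure_minimal closed_Collect_conj closed_Collect_le continuous_intros) (auto simp: Omega1_def)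
  then show "x \<in> closure (Omega1 r1 r2) \<Longrightarrow> 0 \<le> fst x \<and> fst x \<le> 1" by auto
qed

lemma closure_Omega2_fst: "x \<in> closure (Omega2 r1 r2) \<Longrightarrow> 1 \<le> fst x \<and> fst x \<le> 2"
  using closure_Omega1_fst[of "mirror x" r1 r2] by (auto simp: Omega2_eq closure_mirror)

lemma Omega_subset_closure: "x \<in> Omega r1 r2 \<Longrightarrow> x \<in> closure (Omega1 r1 r2) \<or> x \<in> closure (Omega2 r1 r2)"
  using interior_subset by (fastforce simp: Omega_def)

text \<open>Points of the open strip violating one of the inequalities form an open set disjoint
  from \<open>Omega1 r1 r2\<close>, so none of them is in the closure.\<close>

lemma closure_Omega1_strip:
  assumes "continuous_on {0<..<1} r1" "continuous_on {0<..<1} r2"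
    and x: "x \<in> closure (Omega1 r1 r2)" "0 < fst x" "fst x < 1"
  shows "r1 (fst x) \<le> snd x \<and> snd x \<le> r2 (fst x)"
proof (rule ccontr)
  assume out: "\<not> ?thesis"
  let ?U = "{0<..<1} \<times> (UNIV :: real set)"
  let ?m = "\<lambda>x. min (snd x - r1 (fst x)) (r2 (fst x) - snd x)"
  have "continuous_on ?U ?m"
    by (intro continuous_intros continuous_on_compose2[OF assms(1)] continuous_on_compose2[OF assms(2)]) auto
  then have "open (?U \<inter> ?m -` {..<0})"
    by (rule continuous_open_preimage) (auto intro: open_Times)
  moreover have "x \<in> ?U \<inter> ?m -` {..<0}" using x(2,3) out by (auto simp: mem_Times_iff)
  moreover have "(?U \<inter> ?m -` {..<0}) \<inter> Omega1 r1 r2 = {}" by (auto simp: Omega1_def)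
  ultimately show False using x(1) open_Int_closure_eq_empty by blast
qed

text \<open>Taking the interior of the closures must not add boundary points on the left. A point of
  \<Omega> has room in every direction, and nearby points left of the line lie in the closure of
  \<open>Omega1 r1 r2\<close>; moving by \<open>e / 2\<close> makes the weak inequalities of the
  closure strict.\<close>

lemma Omega1_eq:
  assumes "continuous_on {0<..<1} r1" "continuous_on {0<..<1} r2"
  shows "Omega1 r1 r2 = {x \<in> Omega r1 r2. fst x < 1}"
proof (intro equalityI subsetI)
  fix x assume "x \<in> Omega1 r1 r2"
  moreover have "Omega1 r1 r2 \<subseteq> Omega r1 r2"
    unfolding Omega_def using closure_subset by (intro interior_maximal open_Omega1 assms) blast
  ultimately show "x \<in> {x \<in> Omega r1 r2. fst x < 1}" by (auto simp: Omega1_def)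
next
  fix x assume "x \<in> {x \<in> Omega r1 r2. fst x < 1}"
  then have x: "x \<in> Omega r1 r2" "fst x < 1" by auto
  have "open (Omega r1 r2)" by (simp add: Omega_def)
  then obtain e where e: "e > 0" "\<And>y. dist y x < e \<Longrightarrow> y \<in> Omega r1 r2"
    using x(1) by (auto simp: open_dist)
  have near: "x + y \<in> closure (Omega1 r1 r2)" if "norm y < e" "fst (x + y) < 1" for y
  proof -
    have "x + y \<in> Omega r1 r2" using that(1) by (intro e(2)) (simp add: dist_norm)
    then show ?thesis
      using Omega_subset_closure[of "x + y" r1 r2] closure_Omega2_fst[of "x + y" r1 r2] that(2) by auto
  qed
  \<comment> \<open>The shift to the left comes first: positivity of \<open>fst x\<close> is
    required before the strip lemma can be applied to the vertical shifts.\<close>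
  have "0 \<le> fst (x + (- e / 2, 0))"
    using near[of "(- e / 2, 0)"] e(1) x(2) closure_Omega1_fst[of "x + (- e / 2, 0)" r1 r2]
    by (simp add: norm_prod_def)
  then have pos: "0 < fst x" using e(1) by simp
  have up: "x + (0, e / 2) \<in> closure (Omega1 r1 r2)" and down: "x + (0, - e / 2) \<in> closure (Omega1 r1 r2)"
    using e(1) x(2) by (intro near; simp add: norm_prod_def)+
  have "snd x + e / 2 \<le> r2 (fst x)" "r1 (fst x) \<le> snd x - e / 2"
    using closure_Omega1_strip[OF assms up] closure_Omega1_strip[OF assms down] pos x(2) by auto
  then show "x \<in> Omega1 r1 r2"
    using e(1) pos x(2) by (auto simp: Omega1_def case_prod_beta)
qed

section \<open>The gradient form on the mirrored domain\<close>

lemma AE_lebesgue_on_subset: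
  assumes "AE x in lebesgue_on S. P x" "T \<subseteq> S" "S \<in> sets lebesgue" "T \<in> sets lebesgue"
  shows "AE x in lebesgue_on T. P x"
  using assms(1) unfolding AE_restrict_space_iff[of S lebesgue, simplified, OF assms(3)]
    AE_restrict_space_iff[of T lebesgue, simplified, OF assms(4)]
  by eventually_elim (use assms(2) in auto)

lemma AE_lebesgue_on_mirror:
  assumes "AE x in lebesgue_on S. P x" "S \<in> sets lebesgue" "mirror ` S = S"
  shows "AE x in lebesgue_on S. P (mirror x)"
proof -
  have "AE x in lebesgue. x \<in> S \<longrightarrow> P x"
    using assms(1,2) by (simp add: AE_restrict_space_iff)
  then have "AE x in distr lebesgue lebesgue mirror. x \<in> S \<longrightarrow> P x" unfolding distr_mirror .
  then have "AE x in lebesgue. mirror x \<in> S \<longrightarrow> P (mirror x)"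
    by (rule AE_distrD[OF mirror_measurable])
  then show ?thesis
    using assms(2,3) by (simp add: AE_restrict_space_iff mirror_image_iff[symmetric] del: mirror_image_iff)
qed

lemma H10_lincomb:
  assumes "open \<Omega>" "u \<in> H10 \<Omega>" "v \<in> H10 \<Omega>"
  shows "(\<lambda>x. a * u x + b * v x) \<in> H10 \<Omega>"
  using H10_pair_imp_H10[OF assms(1) H10_pair_lincomb[OF _ H10_imp_H10_pair[OF assms(1,2)] H10_imp_H10_pair[OF assms(1,3)], of a b]]
    assms(1) by simp

text \<open>Replaces the chosen gradients by explicit ones. Gradients are always taken in \<Omega>;
  only the integration is restricted to \<open>S\<close>.\<close>

lemma inner_grad_H10_pair:
  assumes \<Omega>: "open \<Omega>" and S: "S \<subseteq> \<Omega>" "S \<in> sets lebesgue"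
    and u: "H10_pair \<Omega> u g" and v: "H10_pair \<Omega> v k"
  shows "inner_L2 S (grad \<Omega> u) (grad \<Omega> v) = inner_L2 S g k"
proof -
  have L: "\<Omega> \<in> sets lebesgue" using \<Omega> by simp
  note m = L2_mono[OF _ S(1) L S(2)]
  show ?thesis
    by (intro inner_L2_cong_AE m H10_pair_grad[OF \<Omega> u] H10_pair_grad[OF \<Omega> v] H10_pairD[OF u] H10_pairD[OF v]
        AE_lebesgue_on_subset[OF _ S(1) L S(2)])
qed

lemma inner_grad_lincomb:
  assumes \<Omega>: "open \<Omega>" and S: "S \<subseteq> \<Omega>" "S \<in> sets lebesgue"
    and u: "u \<in> H10 \<Omega>" and v: "v \<in> H10 \<Omega>" and w: "w \<in> H10 \<Omega>"
  shows "inner_L2 S (grad \<Omega> (\<lambda>x. a * u x + b * v x)) (grad \<Omega> w)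
    = a * inner_L2 S (grad \<Omega> u) (grad \<Omega> w) + b * inner_L2 S (grad \<Omega> v) (grad \<Omega> w)"
proof -
  have L: "\<Omega> \<in> sets lebesgue" using \<Omega> by simp
  note P = H10_imp_H10_pair[OF \<Omega> u] H10_imp_H10_pair[OF \<Omega> v] H10_imp_H10_pair[OF \<Omega> w]
  have "inner_L2 S (grad \<Omega> (\<lambda>x. a *\<^sub>R u x + b *\<^sub>R v x)) (grad \<Omega> w)
    = inner_L2 S (\<lambda>x. a *\<^sub>R grad \<Omega> u x + b *\<^sub>R grad \<Omega> v x) (grad \<Omega> w)"
    by (rule inner_grad_H10_pair[OF \<Omega> S H10_pair_lincomb[OF L P(1,2)] P(3)])
  also have "\<dots> = a * inner_L2 S (grad \<Omega> u) (grad \<Omega> w) + b * inner_L2 S (grad \<Omega> v) (grad \<Omega> w)"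
    by (intro inner_L2_lincomb_left L2_mono[OF _ S(1) L S(2)] H10_pairD(2)[OF P(1)] H10_pairD(2)[OF P(2)] H10_pairD(2)[OF P(3)])
  finally show ?thesis by simp
qed

text \<open>Such a \<open>v\<close> agrees almost everywhere with an extension by zero, so by
  uniqueness its gradient in \<Omega> is the extended gradient, which vanishes off
  \<open>T\<close>.\<close>

lemma V_sub_grad_zero:
  assumes \<Omega>: "open \<Omega>" and T: "open T" "T \<subseteq> \<Omega>" and S: "S \<subseteq> \<Omega>" "S \<in> sets lebesgue" "S \<inter> T = {}"
    and v: "v \<in> V_sub \<Omega> T"
  shows "inner_L2 S (grad \<Omega> v) g = 0"
proof -
  have L: "\<Omega> \<in> sets lebesgue" "T \<in> sets lebesgue" using \<Omega> T by simp_all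
  obtain k where v: "v \<in> H10 \<Omega>" and k: "k \<in> H10 T" "AE x in lebesgue_on \<Omega>. v x = (if x \<in> T then k x else 0)"
    using v by (auto simp: V_sub_def)
  note P = H10_imp_H10_pair[OF \<Omega> v]
    and E = H10_pair_zero_extension[OF T(2) L H10_imp_H10_pair[OF T(1) k(1)]]
  have "AE x in lebesgue_on \<Omega>. grad \<Omega> v x = (if x \<in> T then grad T k x else 0)"
    by (rule weak_gradient_unique[OF \<Omega> H10_pair_weak_gradient[OF \<Omega> P] H10_pair_weak_gradient[OF \<Omega> E]
          H10_pairD(1)[OF P] H10_pairD(1)[OF E] H10_pairD(2)[OF P] H10_pairD(2)[OF E] k(2)])
  then have "AE x in lebesgue_on S. grad \<Omega> v x = (if x \<in> T then grad T k x else 0)"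
    by (rule AE_lebesgue_on_subset[OF _ S(1) L(1) S(2)])
  then have "AE x in lebesgue_on S. grad \<Omega> v x \<bullet> g x = 0"
    using AE_space by eventually_elim (use S(3) in \<open>auto simp: space_restrict_space\<close>)
  then show ?thesis by (simp add: inner_L2_def integral_eq_zero_AE)
qed

lemma V_sub_mirror:
  assumes \<Omega>: "open \<Omega>" "mirror ` \<Omega> = \<Omega>" and T: "open T" and v: "v \<in> V_sub \<Omega> T"
  shows "(\<lambda>x. v (mirror x)) \<in> V_sub \<Omega> (mirror ` T)"
proof -
  have L: "\<Omega> \<in> sets lebesgue" "T \<in> sets lebesgue" using \<Omega> T by simp_all
  obtain k where v: "v \<in> H10 \<Omega>" and k: "k \<in> H10 T" "AE x in lebesgue_on \<Omega>. v x = (if x \<in> T then k x else 0)"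
    using v by (auto simp: V_sub_def)
  have "(\<lambda>x. v (mirror x)) \<in> H10 \<Omega>"
    using H10_pair_imp_H10[OF \<Omega>(1)] H10_pair_mirror[OF L(1) H10_imp_H10_pair[OF \<Omega>(1) v]] \<Omega>(2) by auto
  moreover have "(\<lambda>x. k (mirror x)) \<in> H10 (mirror ` T)"
    by (rule H10_pair_imp_H10[OF open_mirror[OF T] H10_pair_mirror[OF L(2) H10_imp_H10_pair[OF T k(1)]]])
  moreover have "AE x in lebesgue_on \<Omega>. v (mirror x) = (if x \<in> mirror ` T then k (mirror x) else 0)"
    using AE_lebesgue_on_mirror[OF k(2) L(1) \<Omega>(2)] by simp
  ultimately show ?thesis
    unfolding V_sub_def by (intro CollectI conjI bexI[of _ "\<lambda>x. k (mirror x)"])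
qed

section \<open>Forms on the two halves and their behaviour under reflection\<close>

locale mirror_domain =
  fixes r1 r2 :: "real \<Rightarrow> real"
  assumes cont: "continuous_on {0<..<1} r1" "continuous_on {0<..<1} r2"
begin

abbreviation "\<Omega> \<equiv> Omega r1 r2"
abbreviation "\<Omega>1 \<equiv> Omega1 r1 r2"
abbreviation "\<Omega>2 \<equiv> Omega2 r1 r2"
abbreviation "V1 \<equiv> V_sub \<Omega> \<Omega>1"
abbreviation "V2 \<equiv> V_sub \<Omega> \<Omega>2"
abbreviation "V\<Gamma> \<equiv> V_Gamma r1 r2"

abbreviation form :: "(real \<times> real) set \<Rightarrow> (real \<times> real \<Rightarrow> real) \<Rightarrow> (real \<times> real \<Rightarrow> real) \<Rightarrow> real" where
  "form S u v \<equiv> inner_L2 S (grad \<Omega> u) (grad \<Omega> v)"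

definition reflect :: "(real \<times> real \<Rightarrow> real) \<Rightarrow> real \<times> real \<Rightarrow> real" where
  "reflect u x = u (mirror x)"

lemma open_domains: "open \<Omega>" "open \<Omega>1" "open \<Omega>2"
  by (simp_all add: Omega_def open_Omega1[OF cont] Omega2_eq open_mirror)

lemma lebesgue_domains: "\<Omega> \<in> sets lebesgue" "\<Omega>1 \<in> sets lebesgue" "\<Omega>2 \<in> sets lebesgue"
  using open_domains by simp_all

lemma mirror_domains: "mirror ` \<Omega> = \<Omega>" "mirror ` \<Omega>1 = \<Omega>2" "mirror ` \<Omega>2 = \<Omega>1"
  by (simp_all add: mirror_Omega Omega2_eq)

lemma Omega2_eq_half: "\<Omega>2 = {x \<in> \<Omega>. fst x > 1}"
proof (rule set_eqI)
  fix x
  have "mirror x \<in> \<Omega> \<longleftrightarrow> x \<in> \<Omega>"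
    using mirror_image_iff[of x \<Omega>] mirror_domains(1) by simp
  then show "x \<in> \<Omega>2 \<longleftrightarrow> x \<in> {x \<in> \<Omega>. fst x > 1}"
    unfolding Omega2_eq mirror_image_iff Omega1_eq[OF cont] by auto
qed

lemma subset_domains: "\<Omega>1 \<subseteq> \<Omega>" "\<Omega>2 \<subseteq> \<Omega>" "\<Omega>1 \<inter> \<Omega>2 = {}" "\<Omega>2 \<inter> \<Omega>1 = {}"
  unfolding Omega2_eq_half Omega1_eq[OF cont] by auto

lemma abs_fst_le: "x \<in> \<Omega> \<Longrightarrow> \<bar>x \<bullet> (1, 0)\<bar> \<le> 2"
  using Omega_subset_closure[of x r1 r2] closure_Omega1_fst[of x r1 r2] closure_Omega2_fst[of x r1 r2]
  by (auto simp: inner_prod_def)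

text \<open>What \<Omega> has beyond the two halves lies on the line \<open>x1 = 1\<close>, a null
  set.\<close>

lemma inner_L2_split:
  assumes "f \<in> L2 \<Omega>" "g \<in> L2 \<Omega>"
  shows "inner_L2 \<Omega> f g = inner_L2 \<Omega>1 f g + inner_L2 \<Omega>2 f g"
proof -
  have I: "integrable lebesgue (\<lambda>x. indicator S x *\<^sub>R (f x \<bullet> g x))" if "S \<subseteq> \<Omega>" "S \<in> sets lebesgue" for S
    using L2_inner_integrable[OF assms[THEN L2_mono[OF _ that(1) lebesgue_domains(1) that(2)]]] that(2)
    by (simp add: integrable_restrict_space)
  have N: "negligible {x :: real \<times> real. x \<bullet> (1, 0) = 1}"
    by (rule negligible_standard_hyperplane) (simp add: Basis_real_prod)
  have "AE x in lebesgue. x \<notin> {x :: real \<times> real. x \<bullet> (1, 0) = 1}"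
    using N by (simp add: eventually_ae_filter_negligible) blast
  then have AE: "AE x in lebesgue. indicator \<Omega> x *\<^sub>R (f x \<bullet> g x)
      = indicator \<Omega>1 x *\<^sub>R (f x \<bullet> g x) + indicator \<Omega>2 x *\<^sub>R (f x \<bullet> g x)"
    by eventually_elim (unfold Omega2_eq_half Omega1_eq[OF cont], auto simp: indicator_def inner_prod_def)
  note J = I[OF order_refl lebesgue_domains(1)] I[OF subset_domains(1) lebesgue_domains(2)]
    I[OF subset_domains(2) lebesgue_domains(3)]
  have E: "inner_L2 S f g = (\<integral>x. indicator S x *\<^sub>R (f x \<bullet> g x) \<partial>lebesgue)" if "S \<in> sets lebesgue" for S
    unfolding inner_L2_def using that by (intro integral_restrict_space) simp
  have "inner_L2 \<Omega> f g = (\<integral>x. indicator \<Omega>1 x *\<^sub>R (f x \<bullet> g x) + indicator \<Omega>2 x *\<^sub>R (f x \<bullet> g x) \<partial>lebesgue)"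
    unfolding E[OF lebesgue_domains(1)]
    by (intro integral_cong_AE AE borel_measurable_add borel_measurable_integrable J)
  also have "\<dots> = inner_L2 \<Omega>1 f g + inner_L2 \<Omega>2 f g"
    unfolding E[OF lebesgue_domains(2)] E[OF lebesgue_domains(3)]
    by (rule Bochner_Integration.integral_add[OF J(2,3)])
  finally show ?thesis .
qed

lemma form_split: "u \<in> H10 \<Omega> \<Longrightarrow> v \<in> H10 \<Omega> \<Longrightarrow> form \<Omega> u v = form \<Omega>1 u v + form \<Omega>2 u v"
  by (intro inner_L2_split H10_L2(2) open_domains)

lemma form_commute: "form S u v = form S v u"
  by (rule inner_L2_commute)

lemmas form_lincomb1 = inner_grad_lincomb[OF open_domains(1) subset_domains(1) lebesgue_domains(2)]
  and form_lincomb2 = inner_grad_lincomb[OF open_domains(1) subset_domains(2) lebesgue_domains(3)]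

lemmas H10_lincomb' = H10_lincomb[OF open_domains(1)]

lemma reflect_reflect [simp]: "reflect (reflect u) = u"
  by (simp add: reflect_def fun_eq_iff)

lemma H10_pair_reflect: "H10_pair \<Omega> u g \<Longrightarrow> H10_pair \<Omega> (reflect u) (\<lambda>x. flip (g (mirror x)))"
  using H10_pair_mirror[OF lebesgue_domains(1)] mirror_domains(1) by (fastforce simp: reflect_def[abs_def])

lemma reflect_H10: "u \<in> H10 \<Omega> \<Longrightarrow> reflect u \<in> H10 \<Omega>"
  by (rule H10_pair_imp_H10[OF open_domains(1) H10_pair_reflect[OF H10_imp_H10_pair[OF open_domains(1)]]])

lemma form_reflect:
  assumes u: "u \<in> H10 \<Omega>" and v: "v \<in> H10 \<Omega>"
  shows "form \<Omega>1 (reflect u) (reflect v) = form \<Omega>2 u v"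
proof -
  note P = H10_imp_H10_pair[OF open_domains(1) u] H10_imp_H10_pair[OF open_domains(1) v]
  have m: "w \<in> H10 \<Omega> \<Longrightarrow> grad \<Omega> w \<in> L2 \<Omega>2" for w
    by (intro L2_mono[OF _ subset_domains(2) lebesgue_domains(1,3)] H10_L2(2) open_domains)
  have "form \<Omega>1 (reflect u) (reflect v)
      = inner_L2 \<Omega>1 (\<lambda>x. flip (grad \<Omega> u (mirror x))) (\<lambda>x. flip (grad \<Omega> v (mirror x)))"
    by (rule inner_grad_H10_pair[OF open_domains(1) subset_domains(1) lebesgue_domains(2) H10_pair_reflect[OF P(1)] H10_pair_reflect[OF P(2)]])
  also have "\<dots> = form \<Omega>2 u v"
    using inner_L2_mirror[OF lebesgue_domains(3) m[OF u] m[OF v]] mirror_domains(3) by (simp add: inner_L2_flip)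
  finally show ?thesis .
qed

lemma form_reflect_right:
  assumes "u \<in> H10 \<Omega>" "v \<in> H10 \<Omega>"
  shows "form \<Omega>1 (reflect u) v = form \<Omega>2 u (reflect v)" "form \<Omega>2 (reflect u) v = form \<Omega>1 u (reflect v)"
  using form_reflect[OF assms(1) reflect_H10[OF assms(2)]] form_reflect[OF reflect_H10[OF assms(1)] assms(2)] by simp_all

lemma V_H10: "v \<in> V1 \<Longrightarrow> v \<in> H10 \<Omega>" "v \<in> V2 \<Longrightarrow> v \<in> H10 \<Omega>" "v \<in> V\<Gamma> \<Longrightarrow> v \<in> H10 \<Omega>"
  by (auto simp: V_sub_def V_Gamma_def)

lemma V1_form_zero: "v \<in> V1 \<Longrightarrow> form \<Omega>2 v u = 0" "v \<in> V1 \<Longrightarrow> form \<Omega>2 u v = 0"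
  using V_sub_grad_zero[OF open_domains(1,2) subset_domains(1,2) lebesgue_domains(3) subset_domains(4)]
  by (simp_all add: form_commute[of _ u])

lemma V2_form_zero: "v \<in> V2 \<Longrightarrow> form \<Omega>1 v u = 0" "v \<in> V2 \<Longrightarrow> form \<Omega>1 u v = 0"
  using V_sub_grad_zero[OF open_domains(1,3) subset_domains(2,1) lebesgue_domains(2) subset_domains(3)]
  by (simp_all add: form_commute[of _ u])

lemma reflect_V: "v \<in> V1 \<Longrightarrow> reflect v \<in> V2" "v \<in> V2 \<Longrightarrow> reflect v \<in> V1"
  using V_sub_mirror[OF open_domains(1) mirror_domains(1) open_domains(2)]
    V_sub_mirror[OF open_domains(1) mirror_domains(1) open_domains(3)]
  by (auto simp: reflect_def[abs_def] mirror_domains)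

lemma H10_pair_half:
  assumes "H10_pair \<Omega> u g"
  shows "H10_pair \<Omega>1 (\<lambda>x. u x - reflect u x) (\<lambda>x. g x - flip (g (mirror x)))"
    and "H10_pair \<Omega>2 (\<lambda>x. u x - reflect u x) (\<lambda>x. g x - flip (g (mirror x)))"
proof -
  show *: "H10_pair \<Omega>1 (\<lambda>x. u x - reflect u x) (\<lambda>x. g x - flip (g (mirror x)))"
    unfolding reflect_def
    by (rule H10_pair_antisymmetric_half[OF lebesgue_domains(1) mirror_domains(1) Omega1_eq[OF cont] lebesgue_domains(2) assms])
  from H10_pair_mirror[OF lebesgue_domains(2) this]
  have "H10_pair \<Omega>2 (\<lambda>x. reflect u x - u x) (\<lambda>x. flip (g (mirror x)) - g x)"
    by (simp add: mirror_domains reflect_def flip_diff)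
  \<comment> \<open>Reflecting the result for the left half reverses the sign of the odd function;
    the coefficients -1 and 0 undo this.\<close>
  from H10_pair_lincomb[OF lebesgue_domains(3) this this, of "-1" 0]
  show "H10_pair \<Omega>2 (\<lambda>x. u x - reflect u x) (\<lambda>x. g x - flip (g (mirror x)))" by simp
qed

text \<open>On \<open>T\<close> the extension pairs like \<open>u - reflect u\<close> with every
  \<open>v\<close> in \<open>H10 \<Omega>\<close>, so it can stand in for that difference in one
  argument of the form while being admissible in \<open>V_sub\<close>.\<close>

lemma half_V_sub:
  assumes T: "open T" "T \<subseteq> \<Omega>" and u: "u \<in> H10 \<Omega>" and v: "v \<in> H10 \<Omega>"
    and half: "H10_pair T (\<lambda>x. u x - reflect u x) (\<lambda>x. grad \<Omega> u x - flip (grad \<Omega> u (mirror x)))"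
  shows "(\<lambda>x. if x \<in> T then u x - reflect u x else 0) \<in> V_sub \<Omega> T"
    and "form T (\<lambda>x. if x \<in> T then u x - reflect u x else 0) v = form T u v - form T (reflect u) v"
proof -
  have L: "T \<in> sets lebesgue" using T by simp
  note E = H10_pair_zero_extension[OF T(2) lebesgue_domains(1) L half]
  show "(\<lambda>x. if x \<in> T then u x - reflect u x else 0) \<in> V_sub \<Omega> T"
    using H10_pair_imp_H10[OF open_domains(1) E] H10_pair_imp_H10[OF T(1) half]
    unfolding V_sub_def by (intro CollectI conjI bexI[of _ "\<lambda>x. u x - reflect u x"]) auto
  note P = H10_imp_H10_pair[OF open_domains(1) u] H10_imp_H10_pair[OF open_domains(1) v]
  note R = H10_pair_reflect[OF P(1)]
  note m = L2_mono[OF H10_pairD(2) T(2) lebesgue_domains(1) L]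
  have "form T (\<lambda>x. if x \<in> T then u x - reflect u x else 0) v
      = inner_L2 T (\<lambda>x. if x \<in> T then grad \<Omega> u x - flip (grad \<Omega> u (mirror x)) else 0) (grad \<Omega> v)"
    by (rule inner_grad_H10_pair[OF open_domains(1) T(2) L E P(2)])
  also have "\<dots> = inner_L2 T (\<lambda>x. 1 *\<^sub>R grad \<Omega> u x + (-1) *\<^sub>R flip (grad \<Omega> u (mirror x))) (grad \<Omega> v)"
    by (simp add: inner_L2_zero_extension[OF order_refl L L])
  also have "\<dots> = 1 * form T u v + (-1) * inner_L2 T (\<lambda>x. flip (grad \<Omega> u (mirror x))) (grad \<Omega> v)"
    by (rule inner_L2_lincomb_left[OF m[OF P(1)] m[OF R] m[OF P(2)]])
  also have "inner_L2 T (\<lambda>x. flip (grad \<Omega> u (mirror x))) (grad \<Omega> v) = form T (reflect u) v"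
    by (rule inner_grad_H10_pair[OF open_domains(1) T(2) L R P(2), symmetric])
  finally show "form T (\<lambda>x. if x \<in> T then u x - reflect u x else 0) v = form T u v - form T (reflect u) v"
    by simp
qed

lemma half1:
  assumes u: "u \<in> H10 \<Omega>"
  obtains d where "d \<in> V1" "\<And>v. v \<in> H10 \<Omega> \<Longrightarrow> form \<Omega>1 d v = form \<Omega>1 u v - form \<Omega>1 (reflect u) v"
  using half_V_sub[OF open_domains(2) subset_domains(1) u _ H10_pair_half(1)[OF H10_imp_H10_pair[OF open_domains(1) u]]] u
  by blast

lemma half2:
  assumes u: "u \<in> H10 \<Omega>"
  obtains d where "d \<in> V2" "\<And>v. v \<in> H10 \<Omega> \<Longrightarrow> form \<Omega>2 d v = form \<Omega>2 u v - form \<Omega>2 (reflect u) v"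
  using half_V_sub[OF open_domains(3) subset_domains(2) u _ H10_pair_half(2)[OF H10_imp_H10_pair[OF open_domains(1) u]]] u
  by blast

lemma form_zero_AE:
  assumes "u \<in> H10 \<Omega>" "form \<Omega> u u = 0"
  shows "AE x in lebesgue_on \<Omega>. u x = 0"
  by (rule H10_pair_zero_gradient[OF lebesgue_domains(1) _ abs_fst_le H10_imp_H10_pair[OF open_domains(1) assms(1)] assms(2)])
     (simp add: Basis_real_prod)

lemma form_zero:
  assumes "u \<in> H10 \<Omega>" "form \<Omega> u u = 0"
  shows "form \<Omega>1 u v = 0"
proof -
  have "AE x in lebesgue_on \<Omega>. grad \<Omega> u x = 0"
    using assms inner_L2_self_eq_0[OF H10_L2(2)[OF open_domains(1) assms(1)]] by simp
  then have "AE x in lebesgue_on \<Omega>1. grad \<Omega> u x = 0"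
    by (rule AE_lebesgue_on_subset[OF _ subset_domains(1) lebesgue_domains(1,2)])
  then have "AE x in lebesgue_on \<Omega>1. grad \<Omega> u x \<bullet> grad \<Omega> v x = 0"
    by eventually_elim simp
  then show ?thesis by (simp add: inner_L2_def integral_eq_zero_AE)
qed

text \<open>Elements of \<open>V1\<close> and \<open>V2\<close> have zero gradient on the opposite
  half, so the global orthogonality localizes.\<close>

lemma V_Gamma_form:
  assumes "e \<in> V\<Gamma>"
  shows "v \<in> V1 \<Longrightarrow> form \<Omega>1 e v = 0" "v \<in> V2 \<Longrightarrow> form \<Omega>2 e v = 0"
proof -
  note S = form_split[OF V_H10(3)[OF assms]]
  have orth: "form \<Omega> e v = 0" if "v \<in> V1 \<or> v \<in> V2"
    using assms that by (simp add: V_Gamma_def)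
  show "form \<Omega>1 e v = 0" if "v \<in> V1"
    using orth S[OF V_H10(1)[OF that]] V1_form_zero(2)[OF that, of e] that by simp
  show "form \<Omega>2 e v = 0" if "v \<in> V2"
    using orth S[OF V_H10(2)[OF that]] V2_form_zero(2)[OF that, of e] that by simp
qed

lemma V_GammaI:
  assumes "e \<in> H10 \<Omega>" "\<And>v. v \<in> V1 \<Longrightarrow> form \<Omega>1 e v = 0" "\<And>v. v \<in> V2 \<Longrightarrow> form \<Omega>2 e v = 0"
  shows "e \<in> V\<Gamma>"
proof -
  have "form \<Omega> e v = 0" if "v \<in> V1 \<or> v \<in> V2" for v
    using that
  proof
    assume v: "v \<in> V1"
    show ?thesis using form_split[OF assms(1) V_H10(1)[OF v]] assms(2)[OF v] V1_form_zero(2)[OF v, of e] by simp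
  next
    assume v: "v \<in> V2"
    show ?thesis using form_split[OF assms(1) V_H10(2)[OF v]] assms(3)[OF v] V2_form_zero(2)[OF v, of e] by simp
  qed
  then show ?thesis using assms(1) unfolding V_Gamma_def by auto
qed

text \<open>The odd part \<open>d = e - reflect e\<close> has zero energy: on each half one copy of
  \<open>d\<close> may be exchanged for a function of \<open>V1\<close> or \<open>V2\<close>, and
  \<open>e\<close> is orthogonal to that function and to its mirror image.\<close>

lemma V_Gamma_reflect:
  assumes e: "e \<in> V\<Gamma>" and v: "v \<in> H10 \<Omega>"
  shows "form \<Omega>1 (reflect e) v = form \<Omega>1 e v"
proof -
  have eH: "e \<in> H10 \<Omega>" using V_H10(3)[OF e] .
  note RH = reflect_H10[OF eH]
  define d where "d x = 1 * e x + (-1) * reflect e x" for x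
  have dH: "d \<in> H10 \<Omega>" unfolding d_def by (rule H10_lincomb'[OF eH RH])
  have d1: "form \<Omega>1 d w = form \<Omega>1 e w - form \<Omega>1 (reflect e) w"
    and d2: "form \<Omega>2 d w = form \<Omega>2 e w - form \<Omega>2 (reflect e) w" if "w \<in> H10 \<Omega>" for w
    unfolding d_def[abs_def] using form_lincomb1[OF eH RH that, where a = 1 and b = "-1"]
      form_lincomb2[OF eH RH that, where a = 1 and b = "-1"] by simp_all
  obtain p where p: "p \<in> V1" "\<And>v. v \<in> H10 \<Omega> \<Longrightarrow> form \<Omega>1 p v = form \<Omega>1 e v - form \<Omega>1 (reflect e) v"
    using half1[OF eH] by blast
  obtain q where q: "q \<in> V2" "\<And>v. v \<in> H10 \<Omega> \<Longrightarrow> form \<Omega>2 q v = form \<Omega>2 e v - form \<Omega>2 (reflect e) v"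
    using half2[OF eH] by blast
  \<comment> \<open>On the left half \<open>p\<close> and \<open>d\<close> pair alike with every
    function in \<open>H10 \<Omega>\<close>. Afterwards, reflection turns the pairing of
    \<open>reflect e\<close> with \<open>p\<close> into one of \<open>e\<close> with
    \<open>reflect p\<close> in \<open>V2\<close>.\<close>
  have "form \<Omega>1 d d = form \<Omega>1 d p"
    using p(2)[OF dH] d1[OF dH] by (simp add: form_commute[of _ d p])
  also have "\<dots> = form \<Omega>1 e p - form \<Omega>2 e (reflect p)"
    using d1[OF V_H10(1)[OF p(1)]] form_reflect_right(1)[OF eH V_H10(1)[OF p(1)]] by simp
  also have "\<dots> = 0"
    using V_Gamma_form[OF e] p(1) reflect_V(1)[OF p(1)] by simp
  finally have 1: "form \<Omega>1 d d = 0" .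
  have "form \<Omega>2 d d = form \<Omega>2 d q"
    using q(2)[OF dH] d2[OF dH] by (simp add: form_commute[of _ d q])
  also have "\<dots> = form \<Omega>2 e q - form \<Omega>1 e (reflect q)"
    using d2[OF V_H10(2)[OF q(1)]] form_reflect_right(2)[OF eH V_H10(2)[OF q(1)]] by simp
  also have "\<dots> = 0"
    using V_Gamma_form[OF e] q(1) reflect_V(2)[OF q(1)] by simp
  finally have "form \<Omega> d d = 0" using 1 form_split[OF dH dH] by simp
  from form_zero[OF dH this] d1[OF v] show ?thesis by simp
qed

text \<open>On the left half the odd part of \<open>v\<close> is represented in \<open>V1\<close>
  and so is invisible to \<open>e\<close>, which allows replacing \<open>v\<close> by
  \<open>reflect v\<close>. Replacing \<open>e\<close> by \<open>reflect e\<close> as well turns the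
  integral into one over the right half.\<close>

lemma V_Gamma_balanced:
  assumes e: "e \<in> V\<Gamma>" and v: "v \<in> H10 \<Omega>"
  shows "form \<Omega>1 e v = form \<Omega>2 e v"
proof -
  have eH: "e \<in> H10 \<Omega>" using V_H10(3)[OF e] .
  obtain p where p: "p \<in> V1" "\<And>w. w \<in> H10 \<Omega> \<Longrightarrow> form \<Omega>1 p w = form \<Omega>1 v w - form \<Omega>1 (reflect v) w"
    using half1[OF v] by blast
  have "form \<Omega>1 e v - form \<Omega>1 e (reflect v) = form \<Omega>1 e p"
    using p(2)[OF eH] by (simp add: form_commute[of _ e])
  also have "\<dots> = 0" by (rule V_Gamma_form(1)[OF e p(1)])
  finally have "form \<Omega>1 e v = form \<Omega>1 e (reflect v)" by simp
  also have "\<dots> = form \<Omega>1 (reflect e) (reflect v)"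
    by (rule V_Gamma_reflect[OF e reflect_H10[OF v], symmetric])
  also have "\<dots> = form \<Omega>2 e v" by (rule form_reflect[OF eH v])
  finally show ?thesis .
qed

end

section \<open>The decomposition\<close>

context mirror_domain
begin

context
  fixes f :: "real \<times> real \<Rightarrow> real" and u :: "real \<times> real \<Rightarrow> real \<times> real \<Rightarrow> real"
  assumes u_H10: "\<And>y1 y2. y1 > 0 \<Longrightarrow> y2 > 0 \<Longrightarrow> u (y1, y2) \<in> H10 \<Omega>"
    and u_solves: "\<And>y1 y2 v. y1 > 0 \<Longrightarrow> y2 > 0 \<Longrightarrow> v \<in> H10 \<Omega> \<Longrightarrow>
      y1 * form \<Omega>1 (u (y1, y2)) v + y2 * form \<Omega>2 (u (y1, y2)) v = inner_L2 \<Omega> f v"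
begin

text \<open>Tested in \<open>V1\<close> or \<open>V2\<close>, one term of the equation drops out.
  Tested in \<open>V\<Gamma>\<close>, balance makes the two unknown forms equal, so their weights
  add up.\<close>

lemma form_solution:
  assumes y: "y1 > 0" "y2 > 0"
  shows "v \<in> V1 \<Longrightarrow> form \<Omega>1 (u (y1, y2)) v = inner_L2 \<Omega> f v / y1"
    and "v \<in> V2 \<Longrightarrow> form \<Omega>2 (u (y1, y2)) v = inner_L2 \<Omega> f v / y2"
    and "v \<in> V\<Gamma> \<Longrightarrow> form \<Omega>1 (u (y1, y2)) v = inner_L2 \<Omega> f v / (y1 + y2)"
    and "v \<in> V\<Gamma> \<Longrightarrow> form \<Omega>2 (u (y1, y2)) v = inner_L2 \<Omega> f v / (y1 + y2)"
proof -
  show "form \<Omega>1 (u (y1, y2)) v = inner_L2 \<Omega> f v / y1" if "v \<in> V1"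
    using u_solves[OF y V_H10(1)[OF that]] V1_form_zero(2)[OF that] y by (simp add: field_simps)
  show "form \<Omega>2 (u (y1, y2)) v = inner_L2 \<Omega> f v / y2" if "v \<in> V2"
    using u_solves[OF y V_H10(2)[OF that]] V2_form_zero(2)[OF that] y by (simp add: field_simps)
  assume v: "v \<in> V\<Gamma>"
  have eq: "form \<Omega>1 (u (y1, y2)) v = form \<Omega>2 (u (y1, y2)) v"
    using V_Gamma_balanced[OF v u_H10[OF y]] by (simp add: form_commute[of _ v])
  have "y1 * form \<Omega>1 (u (y1, y2)) v + y2 * form \<Omega>1 (u (y1, y2)) v = inner_L2 \<Omega> f v"
    using u_solves[OF y V_H10(3)[OF v]] unfolding eq .
  then show 1: "form \<Omega>1 (u (y1, y2)) v = inner_L2 \<Omega> f v / (y1 + y2)"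
    using y by (simp add: field_simps)
  then show "form \<Omega>2 (u (y1, y2)) v = inner_L2 \<Omega> f v / (y1 + y2)" unfolding eq .
qed

lemma exists_solution_V1: "\<exists>w. solves_in \<Omega> f V1 w"
proof -
  have three: "(0::real) < 3" by simp
  note H = u_H10[OF zero_less_one zero_less_one] u_H10[OF three zero_less_one]
  note S11 = form_solution[OF zero_less_one zero_less_one] and S31 = form_solution[OF three zero_less_one]
  \<comment> \<open>The two solutions agree when tested on \<open>V2\<close>, so the difference is 0
    there; on \<open>V1\<close> it gives \<open>1 - 1/3 = 2/3\<close> of the datum, which the factor
    3/2 normalizes.\<close>
  define a where "a x = 3/2 * u (1, 1) x + (- 3/2) * u (3, 1) x" for x
  have aH: "a \<in> H10 \<Omega>" unfolding a_def[abs_def] by (rule H10_lincomb'[OF H])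
  have a1: "form \<Omega>1 a v = inner_L2 \<Omega> f v" if "v \<in> V1" for v
    unfolding a_def[abs_def] form_lincomb1[OF H V_H10(1)[OF that]]
    by (simp add: S11(1)[OF that] S31(1)[OF that])
  have a2: "form \<Omega>2 a v = 0" if "v \<in> V2" for v
    unfolding a_def[abs_def] form_lincomb2[OF H V_H10(2)[OF that]]
    by (simp add: S11(2)[OF that] S31(2)[OF that])
  obtain d where d: "d \<in> V1" "\<And>v. v \<in> H10 \<Omega> \<Longrightarrow> form \<Omega>1 d v = form \<Omega>1 a v - form \<Omega>1 (reflect a) v"
    using half1[OF aH] by blast
  have "form \<Omega> d v = inner_L2 \<Omega> f v" if v: "v \<in> V1" for v
  proof -
    have "form \<Omega> d v = form \<Omega>1 a v - form \<Omega>1 (reflect a) v"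
      using form_split[OF V_H10(1)[OF d(1)] V_H10(1)[OF v]] V1_form_zero(1)[OF d(1)] d(2)[OF V_H10(1)[OF v]] by simp
    \<comment> \<open>Passing to the odd half of \<open>a\<close> costs nothing: the extra term
      moves by reflection to a test function in \<open>V2\<close>, where \<open>a\<close> gives
      0.\<close>
    also have "form \<Omega>1 (reflect a) v = 0"
      unfolding form_reflect_right(1)[OF aH V_H10(1)[OF v]] by (rule a2[OF reflect_V(1)[OF v]])
    finally show ?thesis using a1[OF v] by simp
  qed
  then show ?thesis using d(1) unfolding solves_in_def by blast
qed

text \<open>The mirror image of the case of \<open>V1\<close>, with \<open>u (1, 3)\<close> in place
  of \<open>u (3, 1)\<close>.\<close>

lemma exists_solution_V2: "\<exists>w. solves_in \<Omega> f V2 w"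
proof -
  have three: "(0::real) < 3" by simp
  note H = u_H10[OF zero_less_one zero_less_one] u_H10[OF zero_less_one three]
  note S11 = form_solution[OF zero_less_one zero_less_one] and S13 = form_solution[OF zero_less_one three]
  define a where "a x = 3/2 * u (1, 1) x + (- 3/2) * u (1, 3) x" for x
  have aH: "a \<in> H10 \<Omega>" unfolding a_def[abs_def] by (rule H10_lincomb'[OF H])
  have a2: "form \<Omega>2 a v = inner_L2 \<Omega> f v" if "v \<in> V2" for v
    unfolding a_def[abs_def] form_lincomb2[OF H V_H10(2)[OF that]]
    by (simp add: S11(2)[OF that] S13(2)[OF that])
  have a1: "form \<Omega>1 a v = 0" if "v \<in> V1" for v
    unfolding a_def[abs_def] form_lincomb1[OF H V_H10(1)[OF that]]
    by (simp add: S11(1)[OF that] S13(1)[OF that])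
  obtain d where d: "d \<in> V2" "\<And>v. v \<in> H10 \<Omega> \<Longrightarrow> form \<Omega>2 d v = form \<Omega>2 a v - form \<Omega>2 (reflect a) v"
    using half2[OF aH] by blast
  have "form \<Omega> d v = inner_L2 \<Omega> f v" if v: "v \<in> V2" for v
  proof -
    have "form \<Omega> d v = form \<Omega>2 a v - form \<Omega>2 (reflect a) v"
      using form_split[OF V_H10(2)[OF d(1)] V_H10(2)[OF v]] V2_form_zero(1)[OF d(1)] d(2)[OF V_H10(2)[OF v]] by simp
    also have "form \<Omega>2 (reflect a) v = 0"
      unfolding form_reflect_right(2)[OF aH V_H10(2)[OF v]] by (rule a1[OF reflect_V(2)[OF v]])
    finally show ?thesis using a2[OF v] by simp
  qed
  then show ?thesis using d(1) unfolding solves_in_def by blast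
qed

lemma exists_solution_V_Gamma: "\<exists>w. solves_in \<Omega> f V\<Gamma> w"
proof -
  have three: "(0::real) < 3" by simp
  note H = u_H10[OF zero_less_one zero_less_one] u_H10[OF zero_less_one three] u_H10[OF three zero_less_one]
  note S11 = form_solution[OF zero_less_one zero_less_one] and S13 = form_solution[OF zero_less_one three]
    and S31 = form_solution[OF three zero_less_one]
  define b where "b x = 1 * u (1, 3) x + 1 * u (3, 1) x" for x
  \<comment> \<open>On \<open>V1\<close> and on \<open>V2\<close> the factors are
    \<open>4 - 3 * (1 + 1/3) = 0\<close>, which gives membership in \<open>V\<Gamma>\<close>; on
    \<open>V\<Gamma>\<close> each half contributes \<open>4 / 2 - 3 * (1/4 + 1/4) = 1/2\<close> of
    the datum.\<close>
  define a where "a x = 4 * u (1, 1) x + (- 3) * b x" for x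
  have bH: "b \<in> H10 \<Omega>" unfolding b_def[abs_def] by (rule H10_lincomb'[OF H(2,3)])
  have aH: "a \<in> H10 \<Omega>" unfolding a_def[abs_def] by (rule H10_lincomb'[OF H(1) bH])
  have form_a: "form \<Omega>1 a v = 4 * form \<Omega>1 (u (1, 1)) v - 3 * (form \<Omega>1 (u (1, 3)) v + form \<Omega>1 (u (3, 1)) v)"
    "form \<Omega>2 a v = 4 * form \<Omega>2 (u (1, 1)) v - 3 * (form \<Omega>2 (u (1, 3)) v + form \<Omega>2 (u (3, 1)) v)"
    if "v \<in> H10 \<Omega>" for v
    unfolding a_def[abs_def] form_lincomb1[OF H(1) bH that] form_lincomb2[OF H(1) bH that]
    unfolding b_def[abs_def] form_lincomb1[OF H(2,3) that] form_lincomb2[OF H(2,3) that] by simp_all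
  have "a \<in> V\<Gamma>"
  proof (rule V_GammaI[OF aH])
    show "form \<Omega>1 a v = 0" if "v \<in> V1" for v
      unfolding form_a[OF V_H10(1)[OF that]] by (simp add: S11(1)[OF that] S13(1)[OF that] S31(1)[OF that])
    show "form \<Omega>2 a v = 0" if "v \<in> V2" for v
      unfolding form_a[OF V_H10(2)[OF that]] by (simp add: S11(2)[OF that] S13(2)[OF that] S31(2)[OF that])
  qed
  moreover have "form \<Omega> a v = inner_L2 \<Omega> f v" if "v \<in> V\<Gamma>" for v
    unfolding form_split[OF aH V_H10(3)[OF that]] form_a[OF V_H10(3)[OF that]]
    by (simp add: S11(3,4)[OF that] S13(3,4)[OF that] S31(3,4)[OF that])
  ultimately show ?thesis unfolding solves_in_def by blast
qed

text \<open>Against \<open>V1\<close> the term with \<open>w1\<close> cancels the solution, while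
  \<open>w2\<close> and \<open>w\<Gamma>\<close> contribute nothing, and likewise for
  \<open>V2\<close>. So the difference \<open>e\<close> lies in \<open>V\<Gamma>\<close> and may be
  tested against itself, where balance applies to both \<open>e\<close> and
  \<open>w\<Gamma>\<close>.\<close>

lemma solution_decomposition:
  assumes w1: "solves_in \<Omega> f V1 w1" and w2: "solves_in \<Omega> f V2 w2" and w\<Gamma>: "solves_in \<Omega> f V\<Gamma> w\<Gamma>"
    and y: "y1 > 0" "y2 > 0"
  shows "AE x in lebesgue_on \<Omega>. u (y1, y2) x = 1 / y1 * w1 x + 1 / y2 * w2 x + 2 / (y1 + y2) * w\<Gamma> x"
proof -
  let ?F = "inner_L2 \<Omega> f"
  have W: "w1 \<in> V1" "w2 \<in> V2" "w\<Gamma> \<in> V\<Gamma>"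
    and F: "\<And>v. v \<in> V1 \<Longrightarrow> form \<Omega> w1 v = ?F v" "\<And>v. v \<in> V2 \<Longrightarrow> form \<Omega> w2 v = ?F v"
      "\<And>v. v \<in> V\<Gamma> \<Longrightarrow> form \<Omega> w\<Gamma> v = ?F v"
    using w1 w2 w\<Gamma> by (auto simp: solves_in_def)
  have WH: "w1 \<in> H10 \<Omega>" "w2 \<in> H10 \<Omega>" "w\<Gamma> \<in> H10 \<Omega>" using W V_H10 by auto
  note U = u_H10[OF y]
  define b where "b x = 1 / y1 * w1 x + 1 / y2 * w2 x" for x
  define c where "c x = 1 * b x + 2 / (y1 + y2) * w\<Gamma> x" for x
  define e where "e x = 1 * u (y1, y2) x + (-1) * c x" for x
  have bH: "b \<in> H10 \<Omega>" unfolding b_def[abs_def] by (rule H10_lincomb'[OF WH(1,2)])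
  have cH: "c \<in> H10 \<Omega>" unfolding c_def[abs_def] by (rule H10_lincomb'[OF bH WH(3)])
  have eH: "e \<in> H10 \<Omega>" unfolding e_def[abs_def] by (rule H10_lincomb'[OF U cH])
  have form_e1: "form \<Omega>1 e v = form \<Omega>1 (u (y1, y2)) v - form \<Omega>1 w1 v / y1 - 2 / (y1 + y2) * form \<Omega>1 w\<Gamma> v"
    if "v \<in> H10 \<Omega>" for v
    unfolding e_def[abs_def] form_lincomb1[OF U cH that]
    unfolding c_def[abs_def] form_lincomb1[OF bH WH(3) that]
    unfolding b_def[abs_def] form_lincomb1[OF WH(1,2) that] V2_form_zero(1)[OF W(2)] by simp
  have form_e2: "form \<Omega>2 e v = form \<Omega>2 (u (y1, y2)) v - form \<Omega>2 w2 v / y2 - 2 / (y1 + y2) * form \<Omega>2 w\<Gamma> v"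
    if "v \<in> H10 \<Omega>" for v
    unfolding e_def[abs_def] form_lincomb2[OF U cH that]
    unfolding c_def[abs_def] form_lincomb2[OF bH WH(3) that]
    unfolding b_def[abs_def] form_lincomb2[OF WH(1,2) that] V1_form_zero(1)[OF W(1)] by simp
  have e\<Gamma>: "e \<in> V\<Gamma>"
  proof (rule V_GammaI[OF eH])
    fix v assume v: "v \<in> V1"
    have "form \<Omega>1 w1 v = ?F v"
      using F(1)[OF v] form_split[OF WH(1) V_H10(1)[OF v]] V1_form_zero(1)[OF W(1)] by simp
    then show "form \<Omega>1 e v = 0"
      unfolding form_e1[OF V_H10(1)[OF v]] by (simp add: form_solution(1)[OF y v] V_Gamma_form(1)[OF W(3) v])
  next
    fix v assume v: "v \<in> V2"
    have "form \<Omega>2 w2 v = ?F v"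
      using F(2)[OF v] form_split[OF WH(2) V_H10(2)[OF v]] V2_form_zero(1)[OF W(2)] by simp
    then show "form \<Omega>2 e v = 0"
      unfolding form_e2[OF V_H10(2)[OF v]] by (simp add: form_solution(2)[OF y v] V_Gamma_form(2)[OF W(3) v])
  qed
  \<comment> \<open>On either half, what remains of the form of \<open>e\<close> with itself is
    \<open>?F e / (y1 + y2)\<close> minus \<open>2 / (y1 + y2)\<close> times
    \<open>?F e / 2\<close>, which is where the numerator 2 of the claim is needed.\<close>
  have "form \<Omega>1 w1 e = 0" "form \<Omega>2 w2 e = 0"
    using V_Gamma_form[OF e\<Gamma>] W by (simp_all add: form_commute[of _ _ e])
  moreover have "form \<Omega>1 w\<Gamma> e = ?F e / 2" "form \<Omega>2 w\<Gamma> e = ?F e / 2"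
    using F(3)[OF e\<Gamma>] form_split[OF WH(3) eH] V_Gamma_balanced[OF W(3) eH] by simp_all
  ultimately have "form \<Omega>1 e e = 0" "form \<Omega>2 e e = 0"
    unfolding form_e1[OF eH] form_e2[OF eH] form_solution(3,4)[OF y e\<Gamma>] by simp_all
  then have "AE x in lebesgue_on \<Omega>. e x = 0"
    using form_split[OF eH eH] by (intro form_zero_AE eH) simp
  then show ?thesis
    by eventually_elim (simp add: e_def c_def b_def)
qed

end

end

theorem theorem3p1:
  fixes r1 r2 :: "real \<Rightarrow> real"
    and f :: "real \<times> real \<Rightarrow> real"
    and u :: "real \<times> real \<Rightarrow> real \<times> real \<Rightarrow> real"
  defines "\<Omega>1 \<equiv> Omega1 r1 r2" and "\<Omega>2 \<equiv> Omega2 r1 r2" and "\<Omega> \<equiv> Omega r1 r2"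
  assumes "continuous_on {0<..<1} r1" and "continuous_on {0<..<1} r2"
    and "\<And>t. t \<in> {0<..<1} \<Longrightarrow> r1 t < r2 t"
    and "f \<in> L2 \<Omega>"
    and "\<And>y1 y2. y1 > 0 \<Longrightarrow> y2 > 0 \<Longrightarrow> u (y1, y2) \<in> H10 \<Omega>"
    and "\<And>y1 y2 v. y1 > 0 \<Longrightarrow> y2 > 0 \<Longrightarrow> v \<in> H10 \<Omega> \<Longrightarrow>
           y1 * inner_L2 \<Omega>1 (grad \<Omega> (u (y1, y2))) (grad \<Omega> v)
           + y2 * inner_L2 \<Omega>2 (grad \<Omega> (u (y1, y2))) (grad \<Omega> v) = inner_L2 \<Omega> f v"
  shows "(\<exists>w1 w2 w\<Gamma>. solves_in \<Omega> f (V_sub \<Omega> \<Omega>1) w1 \<and> solves_in \<Omega> f (V_sub \<Omega> \<Omega>2) w2 \<and>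
            solves_in \<Omega> f (V_Gamma r1 r2) w\<Gamma>)
       \<and> (\<forall>w1 w2 w\<Gamma>. solves_in \<Omega> f (V_sub \<Omega> \<Omega>1) w1 \<and> solves_in \<Omega> f (V_sub \<Omega> \<Omega>2) w2 \<and>
            solves_in \<Omega> f (V_Gamma r1 r2) w\<Gamma> \<longrightarrow>
            (\<forall>y1>0. \<forall>y2>0. AE x in lebesgue_on \<Omega>.
               u (y1, y2) x = 1 / y1 * w1 x + 1 / y2 * w2 x + 2 / (y1 + y2) * w\<Gamma> x))"
proof -
  interpret mirror_domain r1 r2
    by unfold_locales (fact assms(4,5))+
  note u = assms(8,9)[unfolded \<Omega>1_def \<Omega>2_def \<Omega>_def]
  show ?thesis
    unfolding \<Omega>1_def \<Omega>2_def \<Omega>_def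
    using exists_solution_V1[of u f, OF u] exists_solution_V2[of u f, OF u] exists_solution_V_Gamma[of u f, OF u]
      solution_decomposition[of u f, OF u] by blast
qed

end
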